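(* Let $\Gamma$ be a tree of loops with generic edge lengths. Then $\Gamma$ is (geometric) Brill-Noether general if and only if $\Gamma$ is a path of loops.
   Context: A metric graph $\Gamma$ is a compact connected metric space in which every point has a neighborhood isometric to a star-shaped set (equivalently, a finite connected graph with positive edge lengths, viewed as a length space); its genus $g$ is its first Betti number. A loop is a metric graph isometric to a circle of some positive length. A tree of loops is a metric graph that is a union of finitely many loops, any two of which meet in at most one point, such that the intersection graph (one vertex for each loop, an edge when two loops meet) is a tree; its genus is its number of loops. It is a path of loops if this intersection graph is a path (a single vertex counts as a path). Generic edge lengths: a tree of loops of genus $g$ has generic edge lengths if for every loop $L$ of $\Gamma$ and every two distinct points $p,q\in L$ at which other loops are attached, the ratio of the lengths of the two arcs of $L$ between $p$ and $q$ is not equal to a ratio of two positive integers with sum at most $2g-2$. A divisor on $\Gamma$ is an element of the free abelian group $\operatorname{Div}(\Gamma)$ on the points of $\Gamma$; its degree is the sum of its coefficients, and it is effective if all coefficients are nonnegative. For a continuous piecewise linear function $f:\Gamma\to\mathbb{R}$ with integer slopes, $\operatorname{div}(f)=\sum_v \operatorname{ord}_v(f)\, v$, where $\operatorname{ord}_v(f)$ is the sum of the incoming slopes of $f$ at $v$; such divisors are called principal. Two divisors are linearly equivalent, $D\sim D'$, if $D-D'$ is principal. $\operatorname{Pic}^d(\Gamma)$ is the set of linear equivalence classes of divisors of degree $d$; it is a torsor for $\operatorname{Pic}^0(\Gamma)\cong H_1(\Gamma,\mathbb{R})/H_1(\Gamma,\mathbb{Z})$, a real torus of dimension $g$. The rank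 $r(D)$ is $-1$ if $D$ is not equivalent to an effective divisor, and otherwise is the largest nonnegative integer $r$ such that for every effective divisor $E$ of degree $r$ the divisor $D-E$ is equivalent to an effective divisor. For nonnegative integers $r,d$, $W^r_d(\Gamma)\subseteq \operatorname{Pic}^d(\Gamma)$ is the set of classes of divisors of degree $d$ and rank at least $r$. It is a polyhedral subset, and its dimension is the largest dimension of any cell in it. Put $\rho(g,r,d)=g-(r+1)(g-d+r)$. A metric graph $\Gamma$ of genus $g$ is (geometric) Brill-Noether general if for all $r,d$: (1) $W^r_d(\Gamma)$ is empty whenever $\rho(g,r,d)<0$; and (2) $\dim W^r_d(\Gamma)=\min\{\rho(g,r,d),g\}$ whenever $\rho(g,r,d)\ge 0$. *)

theory Defs
  imports "HOL-Analysis.Analysis" "HOL-Algebra.Free_Abelian_Groups"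
begin

section \<open>Metric graphs\<close>

text \<open>
  \<open>star_chart \<Gamma> p n r a\<close>: the star-shaped set with \<open>n\<close> arms of length \<open>r\<close> (with its path
  metric) is carried isometrically, centre to \<open>p\<close>, onto the ball of radius \<open>r\<close> about \<open>p\<close>
  in \<open>\<Gamma>\<close>; \<open>a k\<close> is the unit-speed parametrisation of the \<open>k\<close>-th arm.
  For \<open>n = 0\<close> the star is a point.
\<close>

definition star_chart ::
    "'a::metric_space set \<Rightarrow> 'a \<Rightarrow> nat \<Rightarrow> real \<Rightarrow> (nat \<Rightarrow> real \<Rightarrow> 'a) \<Rightarrow> bool" where
  "star_chart \<Gamma> p n r a \<longleftrightarrow>
     0 < r \<and>
     (\<forall>k<n. a k 0 = p) \<and>
     (\<forall>k<n. \<forall>l<n. \<forall>s\<in>{0..<r}. \<forall>t\<in>{0..<r}.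
        dist (a k s) (a l t) = (if k = l then \<bar>s - t\<bar> else s + t)) \<and>
     \<Gamma> \<inter> ball p r = insert p (\<Union>k<n. a k ` {0..<r})"

text \<open>The metric is intrinsic; on a compact space this amounts to the existence of
  minimal geodesics.\<close>

definition geodesic_set :: "'a::metric_space set \<Rightarrow> bool" where
  "geodesic_set \<Gamma> \<longleftrightarrow>
     (\<forall>x\<in>\<Gamma>. \<forall>y\<in>\<Gamma>. \<exists>\<gamma>. \<gamma> 0 = x \<and> \<gamma> (dist x y) = y \<and>
        \<gamma> ` {0..dist x y} \<subseteq> \<Gamma> \<and>
        (\<forall>s\<in>{0..dist x y}. \<forall>t\<in>{0..dist x y}. dist (\<gamma> s) (\<gamma> t) = \<bar>s - t\<bar>))"

definition metric_graph :: "'a::metric_space set \<Rightarrow> bool" where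
  "metric_graph \<Gamma> \<longleftrightarrow>
     \<Gamma> \<noteq> {} \<and> compact \<Gamma> \<and> connected \<Gamma> \<and> geodesic_set \<Gamma> \<and>
     (\<forall>p\<in>\<Gamma>. \<exists>n r a. star_chart \<Gamma> p n r a)"

section \<open>Piecewise linear functions and divisors\<close>

text \<open>\<open>f\<close> is linear near \<open>p\<close> along each of the \<open>n\<close> arms at \<open>p\<close>, with outgoing slopes \<open>m\<close>.\<close>

definition local_slopes ::
    "'a::metric_space set \<Rightarrow> ('a \<Rightarrow> real) \<Rightarrow> 'a \<Rightarrow> nat \<Rightarrow> (nat \<Rightarrow> real) \<Rightarrow> bool" where
  "local_slopes \<Gamma> f p n m \<longleftrightarrow>
     (\<exists>r a. star_chart \<Gamma> p n r a \<and> (\<forall>k<n. \<forall>t\<in>{0..<r}. f (a k t) = f p + m k * t))"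

text \<open>The sum of the incoming slopes. Any two star charts at \<open>p\<close> agree near \<open>p\<close> up to a
  permutation of the arms, so the value does not depend on the chart.\<close>

definition ord_at :: "'a::metric_space set \<Rightarrow> ('a \<Rightarrow> real) \<Rightarrow> 'a \<Rightarrow> real" where
  "ord_at \<Gamma> f p = (THE j. \<exists>n m. local_slopes \<Gamma> f p n m \<and> j = - (\<Sum>k<n. m k))"

text \<open>Since \<open>\<Gamma>\<close> is compact, piecewise linearity (with finitely many pieces) is a local condition.\<close>

definition pl_integer :: "'a::metric_space set \<Rightarrow> ('a \<Rightarrow> real) \<Rightarrow> bool" where
  "pl_integer \<Gamma> f \<longleftrightarrow> continuous_on \<Gamma> f \<and>
     (\<forall>p\<in>\<Gamma>. \<exists>n m. local_slopes \<Gamma> f p n m \<and> (\<forall>k<n. m k \<in> \<int>))"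

abbreviation Div :: "'a set \<Rightarrow> ('a \<Rightarrow>\<^sub>0 int) set" where
  "Div \<Gamma> \<equiv> carrier (free_Abelian_group \<Gamma>)"

definition div_degree :: "('a \<Rightarrow>\<^sub>0 int) \<Rightarrow> int" where
  "div_degree D = (\<Sum>p\<in>Poly_Mapping.keys D. Poly_Mapping.lookup D p)"

definition effective :: "('a \<Rightarrow>\<^sub>0 int) \<Rightarrow> bool" where
  "effective D \<longleftrightarrow> (\<forall>p. 0 \<le> Poly_Mapping.lookup D p)"

definition principal :: "'a::metric_space set \<Rightarrow> ('a \<Rightarrow>\<^sub>0 int) \<Rightarrow> bool" where
  "principal \<Gamma> D \<longleftrightarrow> D \<in> Div \<Gamma> \<and>
     (\<exists>f. pl_integer \<Gamma> f \<and> (\<forall>p\<in>\<Gamma>. of_int (Poly_Mapping.lookup D p) = ord_at \<Gamma> f p))"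

definition lin_equiv :: "'a::metric_space set \<Rightarrow> (('a \<Rightarrow>\<^sub>0 int) \<times> ('a \<Rightarrow>\<^sub>0 int)) set" where
  "lin_equiv \<Gamma> = {(D, D'). D \<in> Div \<Gamma> \<and> D' \<in> Div \<Gamma> \<and> principal \<Gamma> (D - D')}"

definition equiv_to_effective :: "'a::metric_space set \<Rightarrow> ('a \<Rightarrow>\<^sub>0 int) \<Rightarrow> bool" where
  "equiv_to_effective \<Gamma> D \<longleftrightarrow> (\<exists>D'. effective D' \<and> (D, D') \<in> lin_equiv \<Gamma>)"

definition div_rank :: "'a::metric_space set \<Rightarrow> ('a \<Rightarrow>\<^sub>0 int) \<Rightarrow> int" where
  "div_rank \<Gamma> D =
     (if \<not> equiv_to_effective \<Gamma> D then -1
      else int (GREATEST r. \<forall>E\<in>Div \<Gamma>. effective E \<and> div_degree E = int r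
                              \<longrightarrow> equiv_to_effective \<Gamma> (D - E)))"

definition Pic :: "'a::metric_space set \<Rightarrow> nat \<Rightarrow> ('a \<Rightarrow>\<^sub>0 int) set set" where
  "Pic \<Gamma> d = {D \<in> Div \<Gamma>. div_degree D = int d} // lin_equiv \<Gamma>"

definition W :: "'a::metric_space set \<Rightarrow> nat \<Rightarrow> nat \<Rightarrow> ('a \<Rightarrow>\<^sub>0 int) set set" where
  "W \<Gamma> r d = {c \<in> Pic \<Gamma> d. \<exists>D\<in>c. int r \<le> div_rank \<Gamma> D}"

section \<open>First homology and the torus structure on the Picard group\<close>

text \<open>
  A real cellular 1-chain on \<open>\<Gamma>\<close> (for some subdivision of \<open>\<Gamma>\<close>) assigns a real number to each
  oriented edge. We encode it by its local primitives: for \<open>q\<close> near \<open>p\<close>, \<open>c p q\<close> is the signed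
  coefficient of the chain integrated along the short segment from \<open>p\<close> to \<open>q\<close>. Only the germ
  of \<open>c p\<close> at \<open>p\<close> matters. Along an arm at \<open>p\<close> the slope of \<open>c p\<close> is the coefficient of the
  outward-oriented edge, so the coefficient of \<open>p\<close> in the boundary of the chain is
  \<open>ord_at \<Gamma> (c p) p\<close>.
\<close>

type_synonym 'a chain = "'a \<Rightarrow> 'a \<Rightarrow> real"

definition real_chain :: "'a::metric_space set \<Rightarrow> 'a chain \<Rightarrow> bool" where
  "real_chain \<Gamma> c \<longleftrightarrow>
     (\<forall>p\<in>\<Gamma>. c p p = 0 \<and> (\<exists>n m. local_slopes \<Gamma> (c p) p n m) \<and>
        (\<forall>\<^sub>F q in at p within \<Gamma>. \<forall>\<^sub>F x in at q within \<Gamma>. c q x = c p x - c p q))"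

definition integer_chain :: "'a::metric_space set \<Rightarrow> 'a chain \<Rightarrow> bool" where
  "integer_chain \<Gamma> c \<longleftrightarrow> real_chain \<Gamma> c \<and>
     (\<forall>p\<in>\<Gamma>. \<exists>n m. local_slopes \<Gamma> (c p) p n m \<and> (\<forall>k<n. m k \<in> \<int>))"

text \<open>As there are no 2-cells, the cycles form \<open>H\<^sub>1(\<Gamma>, \<real>)\<close>.\<close>

definition real_cycle :: "'a::metric_space set \<Rightarrow> 'a chain \<Rightarrow> bool" where
  "real_cycle \<Gamma> c \<longleftrightarrow> real_chain \<Gamma> c \<and> (\<forall>p\<in>\<Gamma>. ord_at \<Gamma> (c p) p = 0)"

definition zero_chain :: "'a::metric_space set \<Rightarrow> 'a chain \<Rightarrow> bool" where
  "zero_chain \<Gamma> c \<longleftrightarrow> (\<forall>p\<in>\<Gamma>. \<forall>\<^sub>F q in at p within \<Gamma>. c p q = 0)"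

definition lin_comb :: "nat \<Rightarrow> (nat \<Rightarrow> real) \<Rightarrow> (nat \<Rightarrow> 'a chain) \<Rightarrow> 'a chain" where
  "lin_comb k x v = (\<lambda>p q. \<Sum>i<k. x i * v i p q)"

definition independent_cycles ::
    "'a::metric_space set \<Rightarrow> nat \<Rightarrow> (nat \<Rightarrow> 'a chain) \<Rightarrow> bool" where
  "independent_cycles \<Gamma> k v \<longleftrightarrow> (\<forall>i<k. real_cycle \<Gamma> (v i)) \<and>
     (\<forall>x. zero_chain \<Gamma> (lin_comb k x v) \<longrightarrow> (\<forall>i<k. x i = 0))"

text \<open>The first Betti number, i.e. the dimension of \<open>H\<^sub>1(\<Gamma>, \<real>)\<close>.\<close>

definition genus :: "'a::metric_space set \<Rightarrow> nat" where
  "genus \<Gamma> = (GREATEST k. \<exists>v. independent_cycles \<Gamma> k v)"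

text \<open>A chain is the gradient of a function on \<open>\<Gamma>\<close> iff it is orthogonal to all cycles for the
  inner product given by the edge lengths.\<close>

definition gradient_chain :: "'a::metric_space set \<Rightarrow> 'a chain \<Rightarrow> bool" where
  "gradient_chain \<Gamma> c \<longleftrightarrow> (\<exists>f. \<forall>p\<in>\<Gamma>. \<forall>\<^sub>F q in at p within \<Gamma>. c p q = f q - f p)"

text \<open>
  The isomorphism of \<open>Pic\<^sup>0(\<Gamma>)\<close> with \<open>H\<^sub>1(\<Gamma>, \<real>) / H\<^sub>1(\<Gamma>, \<int>)\<close> sends the class of a divisor, written
  as the boundary of an integral chain \<open>c\<close>, to the orthogonal projection of \<open>c\<close> to
  \<open>H\<^sub>1(\<Gamma>, \<real>)\<close>. The set \<open>jacobian_class \<Gamma> h\<close> is the class corresponding to the cycle \<open>h\<close>.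
\<close>

definition jacobian_class :: "'a::metric_space set \<Rightarrow> 'a chain \<Rightarrow> ('a \<Rightarrow>\<^sub>0 int) set" where
  "jacobian_class \<Gamma> h = {D \<in> Div \<Gamma>. \<exists>c. integer_chain \<Gamma> c \<and>
     (\<forall>p\<in>\<Gamma>. of_int (Poly_Mapping.lookup D p) = ord_at \<Gamma> (c p) p) \<and>
     gradient_chain \<Gamma> (\<lambda>p q. c p q - h p q)}"

text \<open>
  \<open>S\<close> contains a \<open>k\<close>-dimensional cell: the image in the torus of a nondegenerate \<open>k\<close>-simplex of
  \<open>H\<^sub>1(\<Gamma>, \<real>)\<close>, with one vertex at the origin, translated by the class of \<open>D\<close>. Every
  \<open>k\<close>-dimensional polyhedral cell contains such simplices.
\<close>

definition contains_cell ::
    "'a::metric_space set \<Rightarrow> ('a \<Rightarrow>\<^sub>0 int) set set \<Rightarrow> nat \<Rightarrow> bool" where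
  "contains_cell \<Gamma> S k \<longleftrightarrow>
     (\<exists>D\<in>Div \<Gamma>. \<exists>v. independent_cycles \<Gamma> k v \<and>
        (\<forall>x. (\<forall>i<k. 0 \<le> x i) \<and> (\<Sum>i<k. x i) \<le> 1 \<longrightarrow>
           (+) D ` jacobian_class \<Gamma> (lin_comb k x v) \<in> S))"

text \<open>The empty set has dimension \<open>-1\<close>.\<close>

definition polyhedral_dim :: "'a::metric_space set \<Rightarrow> ('a \<Rightarrow>\<^sub>0 int) set set \<Rightarrow> int" where
  "polyhedral_dim \<Gamma> S =
     (if S = {} then -1 else int (GREATEST k. contains_cell \<Gamma> S k))"

section \<open>Brill-Noether generality\<close>

definition bn_number :: "nat \<Rightarrow> nat \<Rightarrow> nat \<Rightarrow> int" where
  "bn_number g r d = int g - (int r + 1) * (int g - int d + int r)"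

definition brill_noether_general :: "'a::metric_space set \<Rightarrow> bool" where
  "brill_noether_general \<Gamma> \<longleftrightarrow>
     (\<forall>r d. (bn_number (genus \<Gamma>) r d < 0 \<longrightarrow> W \<Gamma> r d = {}) \<and>
            (bn_number (genus \<Gamma>) r d \<ge> 0 \<longrightarrow>
               polyhedral_dim \<Gamma> (W \<Gamma> r d) = min (bn_number (genus \<Gamma>) r d) (int (genus \<Gamma>))))"

section \<open>Trees of loops\<close>

text \<open>\<open>\<gamma>\<close> is an isometry from the circle of length \<open>len\<close>, with its arc-length metric, onto \<open>L\<close>.\<close>

definition loop_param ::
    "'a::metric_space set \<Rightarrow> real \<Rightarrow> (real \<Rightarrow> 'a) \<Rightarrow> bool" where
  "loop_param L len \<gamma> \<longleftrightarrow> 0 < len \<and> \<gamma> ` {0..<len} = L \<and>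
     (\<forall>s\<in>{0..<len}. \<forall>t\<in>{0..<len}. dist (\<gamma> s) (\<gamma> t) = min \<bar>s - t\<bar> (len - \<bar>s - t\<bar>))"

definition is_loop :: "'a::metric_space set \<Rightarrow> bool" where
  "is_loop L \<longleftrightarrow> (\<exists>len \<gamma>. loop_param L len \<gamma>)"

text \<open>Simple graphs with vertex set \<open>V\<close> and symmetric irreflexive adjacency relation \<open>E\<close>.\<close>

definition graph_cycle :: "'v set \<Rightarrow> ('v \<Rightarrow> 'v \<Rightarrow> bool) \<Rightarrow> 'v list \<Rightarrow> bool" where
  "graph_cycle V E xs \<longleftrightarrow> 3 \<le> length xs \<and> distinct xs \<and> set xs \<subseteq> V \<and>
     successively E xs \<and> E (last xs) (hd xs)"

definition graph_connected :: "'v set \<Rightarrow> ('v \<Rightarrow> 'v \<Rightarrow> bool) \<Rightarrow> bool" where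
  "graph_connected V E \<longleftrightarrow> V \<noteq> {} \<and>
     (\<forall>u\<in>V. \<forall>w\<in>V. \<exists>xs. xs \<noteq> [] \<and> hd xs = u \<and> last xs = w \<and> set xs \<subseteq> V \<and> successively E xs)"

definition tree_graph :: "'v set \<Rightarrow> ('v \<Rightarrow> 'v \<Rightarrow> bool) \<Rightarrow> bool" where
  "tree_graph V E \<longleftrightarrow> graph_connected V E \<and> (\<nexists>xs. graph_cycle V E xs)"

definition path_graph :: "'v set \<Rightarrow> ('v \<Rightarrow> 'v \<Rightarrow> bool) \<Rightarrow> bool" where
  "path_graph V E \<longleftrightarrow> (\<exists>xs. xs \<noteq> [] \<and> distinct xs \<and> set xs = V \<and>
     (\<forall>i<length xs. \<forall>j<length xs. E (xs ! i) (xs ! j) \<longleftrightarrow> i = Suc j \<or> j = Suc i))"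

definition loops_meet :: "'a set \<Rightarrow> 'a set \<Rightarrow> bool" where
  "loops_meet L L' \<longleftrightarrow> L \<noteq> L' \<and> L \<inter> L' \<noteq> {}"

definition tree_of_loops :: "'a::metric_space set \<Rightarrow> 'a set set \<Rightarrow> bool" where
  "tree_of_loops \<Gamma> \<L> \<longleftrightarrow>
     metric_graph \<Gamma> \<and> finite \<L> \<and> \<Gamma> = \<Union>\<L> \<and> (\<forall>L\<in>\<L>. is_loop L) \<and>
     (\<forall>L\<in>\<L>. \<forall>L'\<in>\<L>. L \<noteq> L' \<longrightarrow> (\<exists>p. L \<inter> L' \<subseteq> {p})) \<and>
     tree_graph \<L> loops_meet"

definition path_of_loops :: "'a::metric_space set \<Rightarrow> 'a set set \<Rightarrow> bool" where
  "path_of_loops \<Gamma> \<L> \<longleftrightarrow> tree_of_loops \<Gamma> \<L> \<and> path_graph \<L> loops_meet"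

text \<open>The points of \<open>L\<close> at which other loops are attached.\<close>

definition attaching_points :: "'a set set \<Rightarrow> 'a set \<Rightarrow> 'a set" where
  "attaching_points \<L> L = {p \<in> L. \<exists>L'\<in>\<L>. L' \<noteq> L \<and> p \<in> L'}"

text \<open>For \<open>s < t\<close>, the two arcs between \<open>\<gamma> s\<close> and \<open>\<gamma> t\<close> have lengths \<open>t - s\<close> and
  \<open>len - (t - s)\<close>.\<close>

definition generic_edge_lengths :: "'a::metric_space set \<Rightarrow> 'a set set \<Rightarrow> bool" where
  "generic_edge_lengths \<Gamma> \<L> \<longleftrightarrow>
     (\<forall>L\<in>\<L>. \<forall>len \<gamma> s t. loop_param L len \<gamma> \<and> 0 \<le> s \<and> s < t \<and> t < len \<and>
        \<gamma> s \<in> attaching_points \<L> L \<and> \<gamma> t \<in> attaching_points \<L> L \<longrightarrow>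
        \<not> (\<exists>m n :: nat. 0 < m \<and> 0 < n \<and> m + n \<le> 2 * genus \<Gamma> - 2 \<and>
              (t - s) / (len - (t - s)) = real m / real n))"

end

theory Submission
  imports Defs
begin

text \<open>
  A tree of loops retracts onto each of its loops, and by the Abel-Jacobi theorem two divisors of the
  same degree are equivalent iff for every loop the sums of the coordinates of their retracted points
  agree modulo the length of the loop. An effective divisor with at least one chip on a loop can take
  any value there; if it has no chip on the loop, then its coordinate is determined by the numbers of
  chips in the branches attached to that loop.

  On a path, one therefore carries chips along the path and loses a chip at each loop, except at a loop
  where the class has a particular coordinate, depending on the number of chips carried. If the rank
  is \<open>r\<close>, then \<open>r + 1\<close> distinct numbers of chips have to survive, by the genericity of the lengths at
  most one of them lingers at each loop, and so \<open>(r + 1) * (g - d + r)\<close> coordinates are determined.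
  Conversely, prescribing these coordinates in \<open>r + 1\<close> blocks gives rank \<open>r\<close>.

  If the tree is not a path, then some loop \<open>C\<close> has three neighbours. The divisors consisting of
  three chips on \<open>C\<close> and one chip on each loop other than \<open>C\<close> and these neighbours have rank at least 1
  and form a cell of dimension \<open>g - 3\<close>, whereas the expected dimension is \<open>g - 4\<close>.
\<close>

section \<open>Trees\<close>

text \<open>Rank becomes a game: an adversary removes chips, a player answers with the numbers of
  chips to be left on the loops, and only the empty loops impose conditions. The geometric obstacle
  is that the order of a function at a vertex mixes all loops through it, whereas the argument runs
  loop by loop. The two views are matched because, seen from a point \<open>p\<close>, any other
  point lies in the direction of exactly one loop through \<open>p\<close>. The constant
  \<open>2 * g - 2\<close> in the genericity condition is a bound on chip counts. If
  \<open>g - d + r\<close> is positive and the expected dimension is nonnegative, then the degree is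
  at most \<open>2 * g - 2\<close>, and counts that survive lie between 0 and the degree, so
  genericity applies to all their differences. Larger degrees occur only when emptiness is to be
  shown, and there a non-effective class of degree \<open>g - 1\<close> serves instead. Along a
  cell, the loops at which chips linger and the counts that do so may change from point to point.
  The upper bound on the dimension therefore uses only that the lingering values at each loop form a
  countable set.\<close>

definition simple_path_in :: "'v set \<Rightarrow> ('v \<Rightarrow> 'v \<Rightarrow> bool) \<Rightarrow> 'v \<Rightarrow> 'v \<Rightarrow> 'v list \<Rightarrow> bool" where
  "simple_path_in S E u w xs \<longleftrightarrow>
     xs \<noteq> [] \<and> hd xs = u \<and> last xs = w \<and> set xs \<subseteq> S \<and> distinct xs \<and> successively E xs"

lemma simple_path_in_snoc:
  assumes "simple_path_in S E u w xs" "E w z" "z \<notin> S"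
  shows "simple_path_in (insert z S) E u z (xs @ [z])"
  using assms by (auto simp: simple_path_in_def successively_append_iff)

lemma simple_path_in_Cons:
  assumes "simple_path_in S E u w xs" "E z u" "z \<notin> S"
  shows "simple_path_in (insert z S) E z w (z # xs)"
  using assms by (cases xs) (auto simp: simple_path_in_def)

lemma simple_path_in_mono:
  "simple_path_in S E u w xs \<Longrightarrow> S \<subseteq> T \<Longrightarrow> simple_path_in T E u w xs"
  by (auto simp: simple_path_in_def)

lemma successively_leaves_set:
  assumes "successively E xs" "xs \<noteq> []" "hd xs \<in> S" "last xs \<notin> S"
  shows "\<exists>u w. u \<in> S \<and> w \<notin> S \<and> E u w \<and> w \<in> set xs"
  using assms
proof (induction xs)
  case (Cons x xs)
  then show ?case
    by (cases xs; cases "hd xs \<in> S") auto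
qed auto

text \<open>A walk from inside \<open>S\<close> to the outside has to cross; this lets a part of the
  tree grow one vertex at a time.\<close>

lemma tree_graph_crossing_edge:
  assumes "tree_graph V E" "S \<subseteq> V" "S \<noteq> {}" "S \<noteq> V"
  shows "\<exists>u\<in>S. \<exists>w\<in>V - S. E u w"
proof -
  obtain u w where "u \<in> S" "w \<in> V - S" using assms(2-4) by auto
  then obtain xs where "xs \<noteq> []" "hd xs = u" "last xs = w" "set xs \<subseteq> V" "successively E xs"
    using assms(1,2) unfolding tree_graph_def graph_connected_def by blast
  then show ?thesis
    using successively_leaves_set[of E xs S] \<open>u \<in> S\<close> \<open>w \<in> V - S\<close> by blast
qed

text \<open>Two different neighbours of \<open>z\<close> that are joined by a simple path inside
  \<open>S\<close> would close up to a cycle through \<open>z\<close>.\<close>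

lemma tree_graph_unique_neighbour:
  assumes "tree_graph V E" "symp E" "S \<subseteq> V" "z \<in> V - S"
    and "u \<in> S" "w \<in> S" "E u z" "E w z" "simple_path_in S E u w xs"
  shows "u = w"
proof (rule ccontr)
  assume "u \<noteq> w"
  have "length xs \<ge> 2"
    using assms(9) \<open>u \<noteq> w\<close> by (cases xs rule: list.exhaust; cases "tl xs") (auto simp: simple_path_in_def)
  then have "graph_cycle V E (xs @ [z])"
    using assms by (auto simp: simple_path_in_def graph_cycle_def successively_append_iff dest: sympD)
  then show False using assms(1) by (auto simp: tree_graph_def)
qed

text \<open>The stretch of the path between the ends of the chord has at least three vertices, and
  the chord closes it.\<close>

lemma graph_cycle_of_chord:
  assumes "distinct xs" "successively E xs" "symp E" "set xs \<subseteq> V"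
    and "i < length xs" "j < length xs" "i + 2 \<le> j" "E (xs ! i) (xs ! j)"
  shows "\<exists>ys. graph_cycle V E ys"
proof -
  define ys where "ys = take (j - i + 1) (drop i xs)"
  have len: "length ys = j - i + 1" using assms by (auto simp: ys_def)
  have "ys \<noteq> []" using len by auto
  have hd: "hd ys = xs ! i" using assms \<open>ys \<noteq> []\<close> by (simp add: ys_def hd_drop_conv_nth)
  have last: "last ys = xs ! j" using assms \<open>ys \<noteq> []\<close> len
    by (simp add: last_conv_nth ys_def)
  have "successively E ys"
    unfolding ys_def using assms(2)
    by (metis append_take_drop_id successively_append_iff)
  moreover have "set ys \<subseteq> set xs" unfolding ys_def
    by (meson order_trans set_drop_subset set_take_subset)
  moreover have "distinct ys" using assms(1) by (simp add: ys_def)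
  ultimately have "graph_cycle V E ys"
    using assms len hd last by (auto simp: graph_cycle_def dest: sympD)
  then show ?thesis by blast
qed

text \<open>A longest simple path works. A chord would close a cycle; an edge leaving the path would
  prolong it at an end or give an inner vertex a third neighbour. By connectedness the path
  therefore visits every vertex.\<close>

lemma path_graph_of_degree_le_2:
  assumes tree: "tree_graph V E" and fin: "finite V" and sym: "symp E" and irr: "irreflp E"
    and deg: "\<And>v a b c. v \<in> V \<Longrightarrow> {a, b, c} \<subseteq> V \<Longrightarrow> E v a \<Longrightarrow> E v b \<Longrightarrow> E v c \<Longrightarrow> a = b \<or> a = c \<or> b = c"
  shows "path_graph V E"
proof -
  define P where "P xs \<longleftrightarrow> xs \<noteq> [] \<and> distinct xs \<and> set xs \<subseteq> V \<and> successively E xs" for xs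
  obtain v where "v \<in> V" using tree by (auto simp: tree_graph_def graph_connected_def)
  then have "P [v]" by (auto simp: P_def)
  moreover have "\<forall>ys. P ys \<longrightarrow> length ys \<le> card V"
    unfolding P_def using fin by (metis card_mono distinct_card)
  ultimately obtain xs where P: "P xs" and max: "\<And>ys. P ys \<Longrightarrow> length ys \<le> length xs"
    using ex_has_greatest_nat[of P "[v]" length "card V + 1"] by (metis less_Suc_eq_le Suc_eq_plus1)
  have xs: "xs \<noteq> []" "distinct xs" "set xs \<subseteq> V" "successively E xs" using P by (auto simp: P_def)
  have consec: "E (xs ! i) (xs ! Suc i)" if "Suc i < length xs" for i
    using xs(4) that by (simp add: successively_conv_nth)
  have chord: "\<not> E (xs ! i) (xs ! j)" if "i < length xs" "j < length xs" "i + 2 \<le> j" for i j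
    using graph_cycle_of_chord[OF xs(2,4) sym xs(3) that] tree by (auto simp: tree_graph_def)
  have adj: "E (xs ! i) (xs ! j) \<longleftrightarrow> i = Suc j \<or> j = Suc i" if "i < length xs" "j < length xs" for i j
  proof -
    consider "i + 2 \<le> j" | "j + 2 \<le> i" | "i = j" | "i = Suc j" | "j = Suc i" by linarith
    then show ?thesis
      by cases (use chord consec that sym irr in \<open>auto dest: sympD irreflpD\<close>)
  qed
  have closed: "w \<in> set xs" if u: "u \<in> set xs" and wV: "w \<in> V" and uw: "E u w" for u w
  proof (rule ccontr)
    assume w: "w \<notin> set xs"
    obtain i where i: "i < length xs" "xs ! i = u" using u by (metis in_set_conv_nth)
    consider "i = 0" | "i = length xs - 1" | "0 < i" "Suc i < length xs" using i by linarith
    then show False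
    proof cases
      case 1
      have "E w (hd xs)" using sympD[OF sym uw] 1 i xs(1) by (metis hd_conv_nth)
      then have "P (w # xs)" using xs w wV unfolding P_def by (simp add: successively_Cons)
      then show False using max[of "w # xs"] by simp
    next
      case 2
      then have "E (last xs) w" using uw i xs(1) by (metis last_conv_nth)
      then have "P (xs @ [w])" using xs w wV unfolding P_def by (simp add: successively_append_iff)
      then show False using max[of "xs @ [w]"] by simp
    next
      case 3
      have "E u (xs ! (i - 1))" "E u (xs ! Suc i)"
        using 3 adj[of i "i-1"] adj[of i "Suc i"] i by auto
      moreover have "xs ! (i - 1) \<in> set xs" "xs ! Suc i \<in> set xs" "xs ! (i - 1) \<noteq> xs ! Suc i"
        using 3 xs(2) by (auto simp: nth_eq_iff_index_eq)
      ultimately show False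
        using deg[of u "xs ! (i - 1)" "xs ! Suc i" w] u wV uw w xs(3) by auto
    qed
  qed
  have "set xs = V"
    using tree_graph_crossing_edge[OF tree xs(3)] xs(1) closed by auto
  then show ?thesis
    unfolding path_graph_def using xs adj by blast
qed

section \<open>Retractions onto the loops\<close>

text \<open>The loops are added to \<open>L\<close> one at a time. A new loop \<open>z\<close> meets
  the part built so far in a single point \<open>v\<close>, so sending all of \<open>z\<close> to
  the image of \<open>v\<close> is consistent with the old values.\<close>

lemma tree_retraction:
  fixes \<L> :: "'a set set"
  assumes tree: "tree_graph \<L> loops_meet" and fin: "finite \<L>"
    and meet: "\<And>L L'. L \<in> \<L> \<Longrightarrow> L' \<in> \<L> \<Longrightarrow> L \<noteq> L' \<Longrightarrow> \<exists>p. L \<inter> L' \<subseteq> {p}"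
    and L: "L \<in> \<L>" "L \<noteq> {}"
  shows "\<exists>\<rho>. (\<forall>x\<in>L. \<rho> x = x) \<and> (\<forall>M\<in>\<L>. M \<noteq> L \<longrightarrow> (\<exists>c\<in>L. \<forall>x\<in>M. \<rho> x = c))"
proof -
  have sym: "symp loops_meet" by (auto simp: symp_def loops_meet_def)
  define Q where "Q S \<rho> \<longleftrightarrow> L \<in> S \<and> S \<subseteq> \<L> \<and>
      (\<forall>u\<in>S. \<forall>w\<in>S. \<exists>xs. simple_path_in S loops_meet u w xs) \<and>
      (\<forall>x\<in>L. \<rho> x = x) \<and> (\<forall>M\<in>S. M \<noteq> L \<longrightarrow> (\<exists>c\<in>L. \<forall>x\<in>M. \<rho> x = c))" for S and \<rho> :: "'a \<Rightarrow> 'a"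
  have step: "\<exists>S \<rho>. card S = Suc k \<and> Q S \<rho>" if "Suc k \<le> card \<L>" for k
    using that
  proof (induction k)
    case 0
    have "simple_path_in {L} loops_meet L L [L]" by (auto simp: simple_path_in_def)
    then have "Q {L} id" unfolding Q_def using L by auto
    then show ?case by (metis card_1_singleton_iff One_nat_def)
  next
    case (Suc k)
    then obtain S \<rho> where S: "card S = Suc k" and Q: "Q S \<rho>" by auto
    then have SL: "S \<subseteq> \<L>" "L \<in> S"
      and Qp: "\<And>u w. u \<in> S \<Longrightarrow> w \<in> S \<Longrightarrow> \<exists>xs. simple_path_in S loops_meet u w xs"
      and Qi: "\<And>x. x \<in> L \<Longrightarrow> \<rho> x = x"
      and Qc: "\<And>M. M \<in> S \<Longrightarrow> M \<noteq> L \<Longrightarrow> \<exists>c\<in>L. \<forall>x\<in>M. \<rho> x = c"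
      unfolding Q_def by simp_all
    have "S \<noteq> \<L>" using S Suc.prems by auto
    then obtain M z where M: "M \<in> S" and z: "z \<in> \<L> - S" and Mz: "loops_meet M z"
      using tree_graph_crossing_edge[OF tree SL(1)] SL by blast
    \<comment> \<open>This is why \<open>Q\<close> carries simple paths inside \<open>S\<close>: a
      second loop of \<open>S\<close> meeting \<open>z\<close> would produce a cycle.\<close>
    have uniq: "N = M" if N: "N \<in> S" "loops_meet N z" for N
    proof -
      obtain xs where "simple_path_in S loops_meet N M xs" using Qp[OF N(1) M] by blast
      then show ?thesis
        using tree_graph_unique_neighbour[OF tree sym SL(1) z N(1) M N(2) Mz] by blast
    qed
    obtain v where v: "M \<inter> z = {v}" "M \<noteq> z"
      using meet[of M z] Mz M z SL unfolding loops_meet_def by blast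
    define \<rho>' where "\<rho>' x = (if x \<in> z then \<rho> v else \<rho> x)" for x
    have eq: "\<rho>' x = \<rho> x" if "N \<in> S" "x \<in> N" for x N
    proof (cases "x \<in> z")
      case True
      then have "loops_meet N z" using that z by (auto simp: loops_meet_def)
      then have "x = v" using uniq[OF that(1)] v that True by auto
      then show ?thesis by (simp add: \<rho>'_def)
    qed (simp add: \<rho>'_def)
    have "\<rho> v \<in> L"
    proof (cases "M = L")
      case True
      then show ?thesis using Qi[of v] v by auto
    next
      case False
      then obtain c where "c \<in> L" "\<forall>x\<in>M. \<rho> x = c" using Qc[OF M] by blast
      then show ?thesis using v by auto
    qed
    then have const: "\<exists>c\<in>L. \<forall>x\<in>z. \<rho>' x = c" by (auto simp: \<rho>'_def)
    have paths: "\<exists>xs. simple_path_in (insert z S) loops_meet u w xs" if uw: "u \<in> insert z S" "w \<in> insert z S" for u w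
    proof -
      consider "u = z" "w = z" | "u = z" "w \<in> S" | "u \<in> S" "w = z" | "u \<in> S" "w \<in> S" using uw by blast
      then show ?thesis
      proof cases
        case 1
        then have "simple_path_in (insert z S) loops_meet u w [z]" by (auto simp: simple_path_in_def)
        then show ?thesis by blast
      next
        case 2
        obtain xs where "simple_path_in S loops_meet M w xs" using Qp[OF M 2(2)] by blast
        then have "simple_path_in (insert z S) loops_meet z w (z # xs)"
          using Mz sym z by (intro simple_path_in_Cons) (auto dest: sympD)
        then show ?thesis using 2 by blast
      next
        case 3
        obtain xs where "simple_path_in S loops_meet u M xs" using Qp[OF 3(1) M] by blast
        then have "simple_path_in (insert z S) loops_meet u z (xs @ [z])"
          using Mz z by (intro simple_path_in_snoc) auto
        then show ?thesis using 3 by blast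
      next
        case 4
        then show ?thesis using Qp by (meson simple_path_in_mono subset_insertI)
      qed
    qed
    have "Q (insert z S) \<rho>'"
      unfolding Q_def
    proof (intro conjI ballI impI)
      show "L \<in> insert z S" "insert z S \<subseteq> \<L>" using SL z by auto
      show "\<exists>xs. simple_path_in (insert z S) loops_meet u w xs" if "u \<in> insert z S" "w \<in> insert z S" for u w
        using paths that .
      show "\<rho>' x = x" if "x \<in> L" for x using Qi that eq[of L x] SL(2) by auto
      show "\<exists>c\<in>L. \<forall>x\<in>N. \<rho>' x = c" if N: "N \<in> insert z S" "N \<noteq> L" for N
      proof (cases "N = z")
        case False
        then have "N \<in> S" using that by auto
        then obtain c where "c \<in> L" "\<forall>x\<in>N. \<rho> x = c" using Qc[OF _ N(2)] by blast
        then show ?thesis using eq[OF \<open>N \<in> S\<close>] by auto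
      qed (use const in auto)
    qed
    moreover have "card (insert z S) = Suc (Suc k)"
      using S z fin SL(1) by (simp add: card_insert_disjoint finite_subset)
    ultimately show ?case by blast
  qed
  have "card \<L> > 0" using L fin by (auto simp: card_gt_0_iff)
  then obtain S \<rho> where S: "card S = card \<L>" "Q S \<rho>" using step[of "card \<L> - 1"] by auto
  then have "S = \<L>" using fin by (metis Q_def card_subset_eq)
  then show ?thesis using S by (auto simp: Q_def)
qed

text \<open>The circle parametrisations are periodic maps on the whole line, so that points near a
  given one can be addressed without a case distinction at the seam.\<close>

locale loop_tree =
  fixes \<Gamma> :: "'a::metric_space set" and \<L> :: "'a set set"
    and len :: "'a set \<Rightarrow> real" and \<gamma> :: "'a set \<Rightarrow> real \<Rightarrow> 'a" and \<rho> :: "'a set \<Rightarrow> 'a \<Rightarrow> 'a"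
  assumes finite_loops: "finite \<L>" and loops_ne: "\<L> \<noteq> {}" and union: "\<Gamma> = \<Union>\<L>"
    and geodesic: "geodesic_set \<Gamma>"
    and len_pos: "L \<in> \<L> \<Longrightarrow> 0 < len L"
    and range_\<gamma>: "L \<in> \<L> \<Longrightarrow> range (\<gamma> L) = L"
    and \<gamma>_add_len: "L \<in> \<L> \<Longrightarrow> \<gamma> L (s + len L) = \<gamma> L s"
    and dist_\<gamma>: "L \<in> \<L> \<Longrightarrow> \<bar>s - t\<bar> \<le> len L / 2 \<Longrightarrow> dist (\<gamma> L s) (\<gamma> L t) = \<bar>s - t\<bar>"
    and meet: "L \<in> \<L> \<Longrightarrow> M \<in> \<L> \<Longrightarrow> L \<noteq> M \<Longrightarrow> \<exists>p. L \<inter> M \<subseteq> {p}"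
    and proj_id: "L \<in> \<L> \<Longrightarrow> x \<in> L \<Longrightarrow> \<rho> L x = x"
    and proj_const: "L \<in> \<L> \<Longrightarrow> M \<in> \<L> \<Longrightarrow> L \<noteq> M \<Longrightarrow> \<exists>c\<in>L. \<forall>x\<in>M. \<rho> L x = c"
begin

section \<open>Lifts of points of a loop to the line\<close>

lemma \<gamma>_in: "L \<in> \<L> \<Longrightarrow> \<gamma> L s \<in> L"
  using range_\<gamma> by blast

lemma loop_subset: "L \<in> \<L> \<Longrightarrow> L \<subseteq> \<Gamma>"
  using union by blast

lemma \<gamma>_add_int: 
  assumes "L \<in> \<L>" shows "\<gamma> L (s + of_int k * len L) = \<gamma> L s"
proof -
  have nat: "\<gamma> L (s + real n * len L) = \<gamma> L s" for s n
  proof (induction n)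
    case (Suc n)
    have "s + real (Suc n) * len L = (s + real n * len L) + len L" by (simp add: algebra_simps)
    then show ?case using \<gamma>_add_len[OF assms] Suc by metis
  qed auto
  show ?thesis
  proof (cases "k \<ge> 0")
    case True
    then show ?thesis using nat[of s "nat k"] by simp
  next
    case False
    then show ?thesis using nat[of "s + of_int k * len L" "nat (-k)"] by simp
  qed
qed

lemma near_lift:
  assumes "L \<in> \<L>"
  shows "\<exists>k::int. \<bar>s - (t + of_int k * len L)\<bar> \<le> len L / 2"
proof
  have "\<bar>(s - t) / len L - of_int (round ((s - t) / len L))\<bar> \<le> 1 / 2"
    using of_int_round_abs_le[of "(s - t) / len L"] by (simp add: abs_minus_commute)
  then have "\<bar>(s - t) / len L - of_int (round ((s - t) / len L))\<bar> * len L \<le> 1 / 2 * len L"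
    using len_pos[OF assms] by (intro mult_right_mono) auto
  moreover have "\<bar>(s - t) / len L - of_int (round ((s - t) / len L))\<bar> * len L
      = \<bar>s - (t + of_int (round ((s - t) / len L)) * len L)\<bar>"
  proof -
    have "s - (t + of_int (round ((s - t) / len L)) * len L)
        = ((s - t) / len L - of_int (round ((s - t) / len L))) * len L"
      using len_pos[OF assms] by (simp add: left_diff_distrib[of "(s - t) / len L"])
    then show ?thesis using len_pos[OF assms] by (simp add: abs_mult)
  qed
  ultimately show "\<bar>s - (t + of_int (round ((s - t) / len L)) * len L)\<bar> \<le> len L / 2" by simp
qed

lemma \<gamma>_eq_iff:
  assumes "L \<in> \<L>"
  shows "\<gamma> L s = \<gamma> L t \<longleftrightarrow> (\<exists>k::int. s = t + of_int k * len L)"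
proof
  assume eq: "\<gamma> L s = \<gamma> L t"
  obtain k :: int where k: "\<bar>s - (t + of_int k * len L)\<bar> \<le> len L / 2" using near_lift[OF assms] by blast
  have "\<bar>s - (t + of_int k * len L)\<bar> = 0"
    using dist_\<gamma>[OF assms k] eq \<gamma>_add_int[OF assms] by simp
  then show "\<exists>k::int. s = t + of_int k * len L" by (intro exI[of _ k]) simp
next
  assume "\<exists>k::int. s = t + of_int k * len L"
  then show "\<gamma> L s = \<gamma> L t" using \<gamma>_add_int[OF assms] by auto
qed

lemma dist_\<gamma>_le:
  assumes "L \<in> \<L>" shows "dist (\<gamma> L s) (\<gamma> L t) \<le> \<bar>s - t\<bar>"
proof (cases "\<bar>s - t\<bar> \<le> len L / 2")
  case False
  obtain k :: int where k: "\<bar>s - (t + of_int k * len L)\<bar> \<le> len L / 2" using near_lift[OF assms] by blast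
  then show ?thesis using dist_\<gamma>[OF assms k] \<gamma>_add_int[OF assms] False by simp
qed (use dist_\<gamma>[OF assms] in auto)

lemma obtain_lift:
  assumes "L \<in> \<L>" "x \<in> L"
  obtains s where "0 \<le> s" "s < len L" "\<gamma> L s = x"
proof -
  obtain t where t: "x = \<gamma> L t" using range_\<gamma>[OF assms(1)] assms(2) by blast
  define k where "k = \<lfloor>t / len L\<rfloor>"
  have l: "len L > 0" using len_pos assms by auto
  have "of_int k * len L \<le> t" "t < (of_int k + 1) * len L"
    using floor_divide_lower[OF l, of t] floor_divide_upper[OF l, of t] by (auto simp: k_def)
  then show ?thesis
    using that[of "t + of_int (-k) * len L"] t \<gamma>_add_int[OF assms(1), of t "-k"] by (simp add: algebra_simps)
qed

lemma \<gamma>_image_fundamental: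
  assumes "L \<in> \<L>" shows "\<gamma> L ` {0..<len L} = L"
proof
  show "\<gamma> L ` {0..<len L} \<subseteq> L" using \<gamma>_in[OF assms] by blast
  show "L \<subseteq> \<gamma> L ` {0..<len L}"
  proof
    fix x assume "x \<in> L"
    then obtain s where "0 \<le> s" "s < len L" "\<gamma> L s = x" using obtain_lift[OF assms] by blast
    then show "x \<in> \<gamma> L ` {0..<len L}" by auto
  qed
qed

lemma compact_loop:
  assumes "L \<in> \<L>" shows "compact L"
proof -
  have "\<gamma> L ` {0..<len L} \<subseteq> \<gamma> L ` {0..len L}" by (intro image_mono) auto
  then have "\<gamma> L ` {0..len L} = L"
    using \<gamma>_in[OF assms] \<gamma>_image_fundamental[OF assms] by blast
  moreover have "continuous_on {0..len L} (\<gamma> L)"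
  proof (rule continuous_onI)
    fix s e :: real assume "0 < e"
    have "dist (\<gamma> L t) (\<gamma> L s) \<le> e" if "dist t s < e" for t
      using dist_\<gamma>_le[OF assms, of t s] that unfolding dist_real_def by linarith
    then show "\<exists>d>0. \<forall>t\<in>{0..len L}. dist t s < d \<longrightarrow> dist (\<gamma> L t) (\<gamma> L s) \<le> e"
      using \<open>0 < e\<close> by (intro exI[of _ e]) simp
  qed
  ultimately show ?thesis using compact_continuous_image[of "{0..len L}" "\<gamma> L"] by simp
qed

lemma closed_loop: "L \<in> \<L> \<Longrightarrow> closed L"
  by (simp add: compact_imp_closed compact_loop)

lemma loop_nonempty: "L \<in> \<L> \<Longrightarrow> L \<noteq> {}"
  using \<gamma>_in by blast

lemma graph_nonempty: "\<Gamma> \<noteq> {}"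
  using loops_ne loop_nonempty union by blast

text \<open>As \<open>\<rho> L\<close> is constant on a different loop \<open>M\<close>, the choice
  of the point is immaterial: this is where the branch containing \<open>M\<close> is attached to
  \<open>L\<close>.\<close>

definition att :: "'a set \<Rightarrow> 'a set \<Rightarrow> 'a" where
  "att L M = \<rho> L (SOME x. x \<in> M)"

lemma proj_att:
  assumes "L \<in> \<L>" "M \<in> \<L>" "L \<noteq> M" "x \<in> M"
  shows "\<rho> L x = att L M"
proof -
  have "(SOME x. x \<in> M) \<in> M" using assms(4) by (metis someI)
  then show ?thesis using proj_const[OF assms(1-3)] assms(4) by (auto simp: att_def)
qed

lemma att_in: "L \<in> \<L> \<Longrightarrow> M \<in> \<L> \<Longrightarrow> L \<noteq> M \<Longrightarrow> att L M \<in> L"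
  using proj_const proj_att loop_nonempty by (metis all_not_in_conv)

lemma proj_in: "L \<in> \<L> \<Longrightarrow> x \<in> \<Gamma> \<Longrightarrow> \<rho> L x \<in> L"
  using union proj_att att_in proj_id by (metis UnionE)

lemma att_eq:
  assumes "L \<in> \<L>" "M \<in> \<L>" "L \<noteq> M" "p \<in> L" "p \<in> M" shows "att L M = p"
  using proj_att[OF assms(1-3,5)] proj_id[OF assms(1,4)] by simp

section \<open>Geodesics and projections to loops\<close>

lemma proj_continuous:
  assumes "L \<in> \<L>" shows "continuous_on \<Gamma> (\<rho> L)"
proof -
  have "continuous_on (\<Union>M\<in>\<L>. M) (\<rho> L)"
  proof (rule continuous_on_closed_Union[OF finite_loops])
    fix M assume M: "M \<in> \<L>"
    show "closed M" using closed_loop[OF M] .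
    show "continuous_on M (\<rho> L)"
    proof (cases "M = L")
      case True
      then show ?thesis using proj_id[OF assms] by (metis continuous_on_cong continuous_on_id)
    next
      case False
      then have "continuous_on M (\<rho> L) = continuous_on M (\<lambda>x. att L M)"
        using proj_att[OF assms M] by (intro continuous_on_cong) auto
      then show ?thesis by simp
    qed
  qed
  then show ?thesis by (simp add: union)
qed

lemma obtain_geodesic:
  assumes "x \<in> \<Gamma>" "y \<in> \<Gamma>"
  obtains g where "g 0 = x" "g (dist x y) = y" "g ` {0..dist x y} \<subseteq> \<Gamma>"
    "\<And>s t. s \<in> {0..dist x y} \<Longrightarrow> t \<in> {0..dist x y} \<Longrightarrow> dist (g s) (g t) = \<bar>s - t\<bar>"
    "continuous_on {0..dist x y} g"
proof -
  obtain g where g: "g 0 = x" "g (dist x y) = y" "g ` {0..dist x y} \<subseteq> \<Gamma>"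
    "\<And>s t. s \<in> {0..dist x y} \<Longrightarrow> t \<in> {0..dist x y} \<Longrightarrow> dist (g s) (g t) = \<bar>s - t\<bar>"
    using geodesic assms unfolding geodesic_set_def by metis
  have "continuous_on {0..dist x y} g"
    unfolding continuous_on_iff using g(4) by (metis dist_real_def)
  then show ?thesis using that g by blast
qed

text \<open>For \<open>y\<close> outside \<open>L\<close>, the loops attached to \<open>L\<close> at
  \<open>u\<close> form a closed set \<open>B\<close> that meets the union \<open>K\<close> of
  \<open>L\<close> and the other loops at most in \<open>u\<close>. A geodesic from \<open>x\<close>
  in \<open>K\<close> to \<open>y\<close> in \<open>B\<close> is connected and hence passes through
  \<open>u\<close>.\<close>

lemma dist_via_proj:
  assumes L: "L \<in> \<L>" "x \<in> L" and y: "y \<in> \<Gamma>"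
  shows "dist x y = dist x (\<rho> L y) + dist (\<rho> L y) y"
proof (cases "y \<in> L")
  case True
  then show ?thesis using proj_id L by auto
next
  case False
  define u where "u = \<rho> L y"
  define d where "d = dist x y"
  have x: "x \<in> \<Gamma>" using L loop_subset by blast
  obtain g where g: "g 0 = x" "g d = y" "g ` {0..d} \<subseteq> \<Gamma>"
    "\<And>s t. s \<in> {0..d} \<Longrightarrow> t \<in> {0..d} \<Longrightarrow> dist (g s) (g t) = \<bar>s - t\<bar>"
    "continuous_on {0..d} g"
    using obtain_geodesic[OF x y] unfolding d_def by blast
  have d: "0 \<le> d" by (simp add: d_def)
  define B where "B = \<Union>{M \<in> \<L>. M \<noteq> L \<and> att L M = u}"
  define K where "K = \<Union>(insert L {M \<in> \<L>. M \<noteq> L \<and> att L M \<noteq> u})"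
  have "closed B" "closed K"
    unfolding B_def K_def using finite_loops closed_loop L by (auto intro!: closed_Union closed_Un)
  have sub: "\<Gamma> \<subseteq> B \<union> K" using union by (auto simp: B_def K_def)
  have BK: "B \<inter> K \<subseteq> {u}"
  proof
    fix z assume z: "z \<in> B \<inter> K"
    then have "\<rho> L z = u" using proj_att L by (auto simp: B_def)
    moreover have "z \<in> L"
    proof (rule ccontr)
      assume "z \<notin> L"
      then obtain M where "M \<in> \<L>" "M \<noteq> L" "att L M \<noteq> u" "z \<in> M" using z by (auto simp: K_def)
      then show False using proj_att[of L M z] L \<open>\<rho> L z = u\<close> by auto
    qed
    ultimately show "z \<in> {u}" using proj_id L by auto
  qed
  obtain M where M: "M \<in> \<L>" "y \<in> M" using y union by auto
  then have "M \<noteq> L" using False by auto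
  then have "y \<in> B" using M proj_att[of L M y] L by (auto simp: B_def u_def)
  have "x \<in> K" using L by (auto simp: K_def)
  have conn: "connected (g ` {0..d})" using g(5) by (simp add: connected_continuous_image)
  have "u \<in> g ` {0..d}"
  proof (rule ccontr)
    assume "u \<notin> g ` {0..d}"
    then have "B \<inter> K \<inter> g ` {0..d} = {}" using BK by blast
    moreover have "x \<in> g ` {0..d}" "y \<in> g ` {0..d}" using g(1,2) d by force+
    moreover have "g ` {0..d} \<subseteq> B \<union> K" using sub g(3) by blast
    ultimately show False
      using conn \<open>closed B\<close> \<open>closed K\<close> \<open>y \<in> B\<close> \<open>x \<in> K\<close> unfolding connected_closed by blast
  qed
  then obtain t where t: "t \<in> {0..d}" "u = g t" by auto
  have "dist x u = t" using g(4)[of 0 t] t d g(1) by auto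
  moreover have "dist u y = d - t" using g(4)[of t d] t d g(2) by auto
  ultimately show ?thesis by (simp add: u_def d_def)
qed

text \<open>The geodesic from \<open>\<rho> L y\<close> to \<open>y\<close> avoids \<open>M\<close>.
  Outside \<open>M\<close> the map \<open>\<rho> M\<close> takes only finitely many values, so by
  continuity it is constant along the geodesic, and at the starting point, which lies on
  \<open>L\<close>, it equals \<open>att M L\<close>.\<close>

lemma proj_off_branch:
  assumes L: "L \<in> \<L>" and M: "M \<in> \<L>" and "L \<noteq> M" and y: "y \<in> \<Gamma>" and ne: "\<rho> L y \<noteq> att L M"
  shows "\<rho> M y = att M L"
proof -
  define u where "u = \<rho> L y"
  define d where "d = dist u y"
  have u: "u \<in> L" "u \<in> \<Gamma>" using proj_in[OF L y] loop_subset[OF L] by (auto simp: u_def)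
  obtain g where g: "g 0 = u" "g d = y" "g ` {0..d} \<subseteq> \<Gamma>"
    "\<And>s t. s \<in> {0..d} \<Longrightarrow> t \<in> {0..d} \<Longrightarrow> dist (g s) (g t) = \<bar>s - t\<bar>"
    "continuous_on {0..d} g"
    using obtain_geodesic[OF u(2) y] unfolding d_def by blast
  have d: "0 \<le> d" by (simp add: d_def)
  \<comment> \<open>Measuring distances through the projections of \<open>z\<close> and of
    \<open>y\<close>, the triangle inequality leaves no room for \<open>z\<close> to project
    elsewhere than to \<open>u\<close>.\<close>
  have fib: "\<rho> L (g t) = u" if t: "t \<in> {0..d}" for t
  proof -
    define z where "z = g t"
    have z: "z \<in> \<Gamma>" using g(3) t by (auto simp: z_def)
    have "dist u z = t" using g(4)[of 0 t] t d g(1) by (auto simp: z_def)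
    moreover have "dist z y = d - t" using g(4)[of t d] t d g(2) by (auto simp: z_def)
    moreover have "dist u z = dist u (\<rho> L z) + dist (\<rho> L z) z" using dist_via_proj[OF L u(1) z] .
    moreover have "dist (\<rho> L z) y = dist (\<rho> L z) u + dist u y"
      using dist_via_proj[OF L proj_in[OF L z] y] by (simp add: u_def)
    moreover have "dist (\<rho> L z) y \<le> dist (\<rho> L z) z + dist z y" by (rule dist_triangle)
    ultimately have "dist (\<rho> L z) u \<le> 0" using dist_commute[of u "\<rho> L z"] unfolding d_def by linarith
    then show ?thesis by (simp add: z_def)
  qed
  have notM: "g t \<notin> M" if "t \<in> {0..d}" for t
    using fib[OF that] proj_att[OF L M \<open>L \<noteq> M\<close>] ne by (auto simp: u_def)
  have "(\<rho> M \<circ> g) ` {0..d} \<subseteq> att M ` (\<L> - {M})"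
  proof
    fix w assume "w \<in> (\<rho> M \<circ> g) ` {0..d}"
    then obtain t where t: "t \<in> {0..d}" "w = \<rho> M (g t)" by auto
    then obtain N where N: "N \<in> \<L>" "g t \<in> N" using g(3) union by blast
    then show "w \<in> att M ` (\<L> - {M})" using notM[OF t(1)] proj_att[OF M N(1)] t(2) by auto
  qed
  then have "finite ((\<rho> M \<circ> g) ` {0..d})" using finite_loops finite_subset by blast
  moreover have "connected ((\<rho> M \<circ> g) ` {0..d})"
    using g(3,5) proj_continuous[OF M]
    by (intro connected_continuous_image continuous_on_compose) (auto intro: continuous_on_subset)
  ultimately obtain a where "(\<rho> M \<circ> g) ` {0..d} \<subseteq> {a}"
    using connected_finite_iff_sing[of "(\<rho> M \<circ> g) ` {0..d}"] by (metis empty_subsetI order_refl)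
  moreover have "\<rho> M (g 0) \<in> (\<rho> M \<circ> g) ` {0..d}" "\<rho> M (g d) \<in> (\<rho> M \<circ> g) ` {0..d}"
    using d imageI[of 0 "{0..d}" "\<rho> M \<circ> g"] imageI[of d "{0..d}" "\<rho> M \<circ> g"] by auto
  ultimately have "\<rho> M (g 0) = \<rho> M (g d)" by (metis singletonD subsetD)
  then show ?thesis using g(1,2) proj_att[OF M L _ u(1)] \<open>L \<noteq> M\<close> by simp
qed

text \<open>This is the loop on which a geodesic from \<open>p\<close> to \<open>y\<close> sets out:
  if it projected \<open>y\<close> back to \<open>p\<close>, the geodesic would have to return
  through \<open>p\<close>. A second such loop contradicts \<open>proj_off_branch\<close>.\<close>

lemma unique_loop_towards:
  assumes "p \<in> \<Gamma>" "y \<in> \<Gamma>" "y \<noteq> p"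
  shows "\<exists>!L. L \<in> \<L> \<and> p \<in> L \<and> \<rho> L y \<noteq> p"
proof (rule ex_ex1I)
  show "\<exists>L. L \<in> \<L> \<and> p \<in> L \<and> \<rho> L y \<noteq> p"
  proof (rule ccontr)
    assume neg: "\<nexists>L. L \<in> \<L> \<and> p \<in> L \<and> \<rho> L y \<noteq> p"
    define d where "d = dist p y"
    obtain g where g: "g 0 = p" "g d = y" "g ` {0..d} \<subseteq> \<Gamma>"
      "\<And>s t. s \<in> {0..d} \<Longrightarrow> t \<in> {0..d} \<Longrightarrow> dist (g s) (g t) = \<bar>s - t\<bar>"
      "continuous_on {0..d} g"
      using obtain_geodesic[OF assms(1,2)] unfolding d_def by blast
    have d: "0 < d" using assms by (simp add: d_def)
    define K where "K = \<Union>{M \<in> \<L>. p \<notin> M}"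
    have "closed K" unfolding K_def using finite_loops closed_loop by (auto intro: closed_Union)
    moreover have "p \<in> - K" by (auto simp: K_def)
    ultimately obtain e where e: "e > 0" "ball p e \<subseteq> - K"
      by (metis open_Compl open_contains_ball)
    define t where "t = min (e / 2) d"
    have t: "0 < t" "t < e" "t \<le> d" using e d by (auto simp: t_def)
    have dt: "dist p (g t) = t" "dist (g t) y = d - t"
      using g(4)[of 0 t] g(4)[of t d] t g(1,2) by auto
    then have "g t \<in> ball p e" using t by simp
    then have "g t \<notin> K" using e(2) by blast
    moreover have "g t \<in> \<Gamma>" using g(3) t by auto
    ultimately obtain L where L: "L \<in> \<L>" "p \<in> L" "g t \<in> L" by (auto simp: union K_def)
    have "dist (g t) y = dist (g t) p + dist p y"
      using dist_via_proj[OF L(1,3) assms(2)] neg L by metis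
    then show False using dt t by (simp add: d_def dist_commute)
  qed
next
  fix L M assume L: "L \<in> \<L> \<and> p \<in> L \<and> \<rho> L y \<noteq> p" and M: "M \<in> \<L> \<and> p \<in> M \<and> \<rho> M y \<noteq> p"
  then show "L = M" using proj_off_branch[of L M y] att_eq[of L M p] att_eq[of M L p] assms by metis
qed

text \<open>The coordinate on \<open>L\<close> extends to the whole tree by the retraction, so that
  a chip off \<open>L\<close> is seen at the attaching point of its branch.\<close>

definition \<theta> :: "'a set \<Rightarrow> 'a \<Rightarrow> real" where
  "\<theta> L x = (SOME s. 0 \<le> s \<and> s < len L \<and> \<gamma> L s = \<rho> L x)"

lemma \<theta>:
  assumes "L \<in> \<L>" "x \<in> \<Gamma>"
  shows "0 \<le> \<theta> L x" "\<theta> L x < len L" "\<gamma> L (\<theta> L x) = \<rho> L x"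
proof -
  have "\<exists>s. 0 \<le> s \<and> s < len L \<and> \<gamma> L s = \<rho> L x"
    using obtain_lift[OF assms(1) proj_in[OF assms]] by metis
  from someI_ex[OF this] show "0 \<le> \<theta> L x" "\<theta> L x < len L" "\<gamma> L (\<theta> L x) = \<rho> L x"
    by (auto simp: \<theta>_def)
qed

lemma \<theta>_cong: "\<rho> L x = \<rho> L y \<Longrightarrow> \<theta> L x = \<theta> L y"
  by (simp add: \<theta>_def)

lemma \<gamma>_inj_fundamental:
  assumes "L \<in> \<L>" "0 \<le> s" "s < len L" "0 \<le> t" "t < len L" "\<gamma> L s = \<gamma> L t"
  shows "s = t"
proof -
  obtain k :: int where k: "s = t + of_int k * len L" using \<gamma>_eq_iff[OF assms(1)] assms(6) by blast
  have "of_int k * len L < 1 * len L" "-1 * len L < of_int k * len L" using k assms(2-5) by linarith+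
  then have "real_of_int k < 1" "-1 < real_of_int k"
    using len_pos[OF assms(1)] mult_less_cancel_right_pos by blast+
  then have "k = 0" by linarith
  then show ?thesis using k by simp
qed

lemma \<theta>_\<gamma>:
  assumes "L \<in> \<L>" "0 \<le> s" "s < len L" shows "\<theta> L (\<gamma> L s) = s"
proof -
  have x: "\<gamma> L s \<in> L" "\<gamma> L s \<in> \<Gamma>" using \<gamma>_in loop_subset assms by blast+
  show ?thesis
    using \<theta>[OF assms(1) x(2)] proj_id[OF assms(1) x(1)] \<gamma>_inj_fundamental[OF assms(1)] assms by metis
qed

text \<open>The genericity hypothesis quantifies over such parametrisations; this makes it
  applicable to \<open>\<gamma> L\<close>.\<close>

lemma loop_param: 
  assumes "L \<in> \<L>" shows "loop_param L (len L) (\<gamma> L)"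
  unfolding loop_param_def
proof (intro conjI ballI)
  show "0 < len L" using len_pos assms .
  show "\<gamma> L ` {0..<len L} = L" using \<gamma>_image_fundamental[OF assms] .
  fix s t assume st: "s \<in> {0..<len L}" "t \<in> {0..<len L}"
  have per: "\<gamma> L (x + len L) = \<gamma> L x" for x using \<gamma>_add_len[OF assms] .
  consider "\<bar>s - t\<bar> \<le> len L / 2" | "s - t > len L / 2" | "t - s > len L / 2" by linarith
  then show "dist (\<gamma> L s) (\<gamma> L t) = min \<bar>s - t\<bar> (len L - \<bar>s - t\<bar>)"
  proof cases
    case 1
    then show ?thesis using dist_\<gamma>[OF assms 1] by auto
  next
    case 2
    then have "\<bar>s - (t + len L)\<bar> \<le> len L / 2" using st by auto
    then show ?thesis using dist_\<gamma>[OF assms, of s "t + len L"] per[of t] 2 st by auto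
  next
    case 3
    then have "\<bar>(s + len L) - t\<bar> \<le> len L / 2" using st by auto
    then show ?thesis using dist_\<gamma>[OF assms, of "s + len L" t] per[of s] 3 st by auto
  qed
qed

end

text \<open>The given parametrisation is composed with reduction modulo \<open>l\<close>. If
  \<open>s\<close> and \<open>t\<close> differ by at most \<open>l / 2\<close>, the difference of
  their reductions is \<open>s - t\<close> or differs from it by \<open>l\<close>, which the
  arc-length metric does not see.\<close>

lemma loop_param_extend:
  assumes "loop_param L l c"
  obtains c' where "range c' = L" "\<And>s. c' (s + l) = c' s"
    "\<And>s t. \<bar>s - t\<bar> \<le> l / 2 \<Longrightarrow> dist (c' s) (c' t) = \<bar>s - t\<bar>"
proof
  have l: "l > 0" and im: "c ` {0..<l} = L"
    and d: "\<And>s t. s \<in> {0..<l} \<Longrightarrow> t \<in> {0..<l} \<Longrightarrow> dist (c s) (c t) = min \<bar>s - t\<bar> (l - \<bar>s - t\<bar>)"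
    using assms by (auto simp: loop_param_def)
  define m where "m s = l * frac (s / l)" for s
  have m: "0 \<le> m s" "m s < l" for s
    using l frac_lt_1[of "s / l"] by (auto simp: m_def)
  have m_id: "m s = s" if "0 \<le> s" "s < l" for s
    using that l by (simp add: m_def frac_eq)
  have ms: "m s = s - l * of_int \<lfloor>s / l\<rfloor>" for s
    using l by (simp add: m_def frac_def field_simps)
  show "range (\<lambda>s. c (m s)) = L"
  proof
    show "range (\<lambda>s. c (m s)) \<subseteq> L" using im m by force
    show "L \<subseteq> range (\<lambda>s. c (m s))"
    proof
      fix x assume "x \<in> L"
      then obtain s where "0 \<le> s" "s < l" "c s = x" using im by auto
      then show "x \<in> range (\<lambda>s. c (m s))" using m_id by (metis rangeI)
    qed
  qed
  show "c (m (s + l)) = c (m s)" for s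
  proof -
    have "(s + l) / l = s / l + 1" using l by (simp add: field_simps)
    then show ?thesis by (simp add: m_def frac_def)
  qed
  show "dist (c (m s)) (c (m t)) = \<bar>s - t\<bar>" if st: "\<bar>s - t\<bar> \<le> l / 2" for s t
  proof -
    define k where "k = \<lfloor>s / l\<rfloor> - \<lfloor>t / l\<rfloor>"
    have eq: "m s - m t = (s - t) - l * of_int k" by (simp add: ms k_def algebra_simps)
    have "\<bar>m s - m t\<bar> < l" using m[of s] m[of t] by auto
    then have "\<bar>l * real_of_int k\<bar> < 3 / 2 * l" using eq st by linarith
    then have "l * \<bar>real_of_int k\<bar> < l * (3 / 2)" using l by (simp add: abs_mult)
    then have "\<bar>real_of_int k\<bar> < 3 / 2" using l by (simp only: mult_less_cancel_left_pos)
    then have "k = 0 \<or> k = 1 \<or> k = -1" by linarith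
    moreover have "dist (c (m s)) (c (m t)) = min \<bar>m s - m t\<bar> (l - \<bar>m s - m t\<bar>)"
      using d m by auto
    ultimately show ?thesis using eq st m[of s] m[of t] by (auto simp: min_def abs_if split: if_splits)
  qed
qed

lemma tree_of_loops_imp_loop_tree:
  assumes "tree_of_loops \<Gamma> \<L>"
  obtains len \<gamma> \<rho> where "loop_tree \<Gamma> \<L> len \<gamma> \<rho>"
proof -
  have fin: "finite \<L>" and un: "\<Gamma> = \<Union>\<L>" and loops: "\<And>L. L \<in> \<L> \<Longrightarrow> is_loop L"
    and meet: "\<And>L M. L \<in> \<L> \<Longrightarrow> M \<in> \<L> \<Longrightarrow> L \<noteq> M \<Longrightarrow> \<exists>p. L \<inter> M \<subseteq> {p}"
    and tree: "tree_graph \<L> loops_meet" and geo: "geodesic_set \<Gamma>"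
    using assms by (auto simp: tree_of_loops_def metric_graph_def)
  have "\<exists>l c. 0 < l \<and> range c = L \<and> (\<forall>s. c (s + l) = c s) \<and>
      (\<forall>s t. \<bar>s - t\<bar> \<le> l / 2 \<longrightarrow> dist (c s) (c t) = \<bar>s - t\<bar>)" if L: "L \<in> \<L>" for L
  proof -
    obtain l c where lp: "loop_param L l c" using loops[OF L] unfolding is_loop_def by blast
    obtain c' where "range c' = L" "\<And>s. c' (s + l) = c' s"
      "\<And>s t. \<bar>s - t\<bar> \<le> l / 2 \<Longrightarrow> dist (c' s) (c' t) = \<bar>s - t\<bar>"
      using loop_param_extend[OF lp] by blast
    moreover have "0 < l" using lp by (simp add: loop_param_def)
    ultimately show ?thesis by blast
  qed
  then obtain len \<gamma> where *: "\<And>L. L \<in> \<L> \<Longrightarrow> 0 < len L \<and> range (\<gamma> L) = L \<and> (\<forall>s. \<gamma> L (s + len L) = \<gamma> L s) \<and>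
      (\<forall>s t. \<bar>s - t\<bar> \<le> len L / 2 \<longrightarrow> dist (\<gamma> L s) (\<gamma> L t) = \<bar>s - t\<bar>)"
    by metis
  have "\<exists>\<rho>. (\<forall>x\<in>L. \<rho> x = x) \<and> (\<forall>M\<in>\<L>. M \<noteq> L \<longrightarrow> (\<exists>c\<in>L. \<forall>x\<in>M. \<rho> x = c))" if "L \<in> \<L>" for L
    using tree_retraction[OF tree fin meet that] *[OF that] by auto
  then obtain \<rho> where \<rho>: "\<And>L. L \<in> \<L> \<Longrightarrow> (\<forall>x\<in>L. \<rho> L x = x) \<and> (\<forall>M\<in>\<L>. M \<noteq> L \<longrightarrow> (\<exists>c\<in>L. \<forall>x\<in>M. \<rho> L x = c))"
    by metis
  have "\<L> \<noteq> {}" using tree by (auto simp: tree_graph_def graph_connected_def)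
  then have "loop_tree \<Gamma> \<L> len \<gamma> \<rho>"
    using fin un geo meet * \<rho> by unfold_locales metis+
  then show ?thesis using that by blast
qed

section \<open>Germs of functions along the loops\<close>

context loop_tree
begin

text \<open>Tangent directions at \<open>p\<close>, encoded as a loop through \<open>p\<close> with
  an orientation. They give a canonical star chart with which arbitrary ones are compared.\<close>

definition dirs :: "'a \<Rightarrow> ('a set \<times> bool) set" where
  "dirs p = {L \<in> \<L>. p \<in> L} \<times> UNIV"

definition sg :: "bool \<Rightarrow> real" where
  "sg b = (if b then 1 else -1)"

definition pt :: "'a \<Rightarrow> 'a set \<times> bool \<Rightarrow> real \<Rightarrow> 'a" where
  "pt p d t = \<gamma> (fst d) (\<theta> (fst d) p + sg (snd d) * t)"

lemma in_dirs: "(L, b) \<in> dirs p \<longleftrightarrow> L \<in> \<L> \<and> p \<in> L"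
  by (auto simp: dirs_def)

lemma dirs_imp: "d \<in> dirs p \<Longrightarrow> fst d \<in> \<L> \<and> p \<in> fst d \<and> p \<in> \<Gamma>"
  using loop_subset by (auto simp: dirs_def)

lemma finite_dirs: "finite (dirs p)"
  using finite_loops by (simp add: dirs_def)

lemma sum_dirs: "sum m (dirs p) = (\<Sum>L | L \<in> \<L> \<and> p \<in> L. m (L, True) + m (L, False))"
proof -
  have "sum m (dirs p) = (\<Sum>L | L \<in> \<L> \<and> p \<in> L. \<Sum>b\<in>UNIV. m (L, b))"
    unfolding dirs_def by (simp add: sum.cartesian_product)
  then show ?thesis by (simp add: UNIV_bool add.commute)
qed

text \<open>Frees \<open>pt\<close> from the particular lift \<open>\<theta> L p\<close>: by
  periodicity any lift of \<open>p\<close> does.\<close>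

lemma pt_lift:
  assumes "L \<in> \<L>" "\<gamma> L s = p"
  shows "pt p (L, b) t = \<gamma> L (s + sg b * t)"
proof -
  have p: "p \<in> L" "p \<in> \<Gamma>" using \<gamma>_in loop_subset assms by blast+
  have "\<gamma> L (\<theta> L p) = \<gamma> L s" using \<theta>(3)[OF assms(1) p(2)] proj_id[OF assms(1) p(1)] assms(2) by simp
  then obtain k :: int where k: "\<theta> L p = s + of_int k * len L" using \<gamma>_eq_iff[OF assms(1)] by blast
  have "\<theta> L p + sg b * t = (s + sg b * t) + of_int k * len L" using k by simp
  then show ?thesis using \<gamma>_add_int[OF assms(1), of "s + sg b * t" k] unfolding pt_def fst_conv snd_conv by metis
qed

lemma \<gamma>_\<theta>: "L \<in> \<L> \<Longrightarrow> p \<in> L \<Longrightarrow> \<gamma> L (\<theta> L p) = p"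
  using \<theta>(3) proj_id loop_subset by fastforce

lemma pt_0: "d \<in> dirs p \<Longrightarrow> pt p d 0 = p"
  using \<gamma>_\<theta> dirs_imp by (simp add: pt_def)

lemma pt_in: "d \<in> dirs p \<Longrightarrow> pt p d t \<in> fst d"
  using dirs_imp \<gamma>_in by (simp add: pt_def)

lemma pt_in_graph: "d \<in> dirs p \<Longrightarrow> pt p d t \<in> \<Gamma>"
  using pt_in dirs_imp loop_subset by blast

text \<open>A quarter of the length keeps two arms on the same loop within half a turn of each
  other, where \<open>dist_\<gamma>\<close> applies; the second bound keeps out the loops that miss
  \<open>p\<close>.\<close>

definition good_radius :: "'a \<Rightarrow> real \<Rightarrow> bool" where
  "good_radius p r \<longleftrightarrow> 0 < r \<and> (\<forall>L\<in>\<L>. p \<in> L \<longrightarrow> r \<le> len L / 4) \<and>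
     (\<forall>M\<in>\<L>. p \<notin> M \<longrightarrow> (\<forall>y\<in>M. r \<le> dist p y))"

lemma good_radius_ex: "\<exists>r. good_radius p r"
proof -
  have "\<exists>r>0. (p \<in> M \<longrightarrow> r \<le> len M / 4) \<and> (p \<notin> M \<longrightarrow> (\<forall>y\<in>M. r \<le> dist p y))" if M: "M \<in> \<L>" for M
  proof (cases "p \<in> M")
    case True
    then show ?thesis using len_pos[OF M] by (intro exI[of _ "len M / 4"]) auto
  next
    case False
    then obtain e where "e > 0" "ball p e \<subseteq> - M"
      using closed_loop[OF M] by (metis ComplI open_Compl open_contains_ball)
    then show ?thesis using False by (intro exI[of _ e]) (auto simp: subset_iff not_less)
  qed
  then obtain R where R: "\<And>M. M \<in> \<L> \<Longrightarrow> R M > 0 \<and> (p \<in> M \<longrightarrow> R M \<le> len M / 4) \<and>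
      (p \<notin> M \<longrightarrow> (\<forall>y\<in>M. R M \<le> dist p y))" by metis
  define r where "r = Min (R ` \<L>)"
  have le: "r \<le> R M" if "M \<in> \<L>" for M using that finite_loops by (simp add: r_def)
  have "r > 0" using R finite_loops loops_ne by (simp add: r_def)
  then have "good_radius p r" unfolding good_radius_def using R le by (meson order_trans)
  then show ?thesis by blast
qed

lemma good_radius_mono: "good_radius p r \<Longrightarrow> 0 < r' \<Longrightarrow> r' \<le> r \<Longrightarrow> good_radius p r'"
  unfolding good_radius_def by (meson order_trans)

text \<open>Arms on the same loop are compared on the circle; between arms on different loops the
  distance is additive, because one end projects to \<open>p\<close> on the loop of the
  other.\<close>

lemma dist_pt:
  assumes r: "good_radius p r" and d: "d \<in> dirs p" "d' \<in> dirs p"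
    and st: "0 \<le> s" "s < r" "0 \<le> t" "t < r"
  shows "dist (pt p d s) (pt p d' t) = (if d = d' then \<bar>s - t\<bar> else s + t)"
proof -
  obtain L b L' b' where db: "d = (L, b)" "d' = (L', b')" by (metis surj_pair)
  have L: "L \<in> \<L>" "p \<in> L" "L' \<in> \<L>" "p \<in> L'" using d db by (auto simp: in_dirs)
  have rl: "r \<le> len L / 4" "r \<le> len L' / 4" using r L by (auto simp: good_radius_def)
  show ?thesis
  proof (cases "L = L'")
    case True
    have "\<bar>(\<theta> L p + sg b * s) - (\<theta> L p + sg b' * t)\<bar> = (if b = b' then \<bar>s - t\<bar> else s + t)"
      using st by (auto simp: sg_def)
    moreover have "\<bar>s - t\<bar> \<le> len L / 2" "s + t \<le> len L / 2" using st rl by linarith+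
    ultimately show ?thesis using dist_\<gamma>[OF L(1), of "\<theta> L p + sg b * s" "\<theta> L p + sg b' * t"] db True
      by (auto simp: pt_def)
  next
    case False
    define x y where "x = pt p d s" and "y = pt p d' t"
    have xL: "x \<in> L" using pt_in[OF d(1), of s] db by (simp add: x_def)
    have "\<bar>(\<theta> L p + sg b * s) - \<theta> L p\<bar> = s" using st by (simp add: sg_def)
    moreover from this have "dist (\<gamma> L (\<theta> L p + sg b * s)) (\<gamma> L (\<theta> L p)) = \<bar>(\<theta> L p + sg b * s) - \<theta> L p\<bar>"
      using st rl by (intro dist_\<gamma>[OF L(1)]) linarith
    ultimately have "dist x p = s" using \<gamma>_\<theta>[OF L(1,2)] by (simp add: x_def db pt_def)
    note x = xL this
    have yL: "y \<in> L'" using pt_in[OF d(2), of t] db by (simp add: y_def)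
    have "\<bar>(\<theta> L' p + sg b' * t) - \<theta> L' p\<bar> = t" using st by (simp add: sg_def)
    moreover from this have "dist (\<gamma> L' (\<theta> L' p + sg b' * t)) (\<gamma> L' (\<theta> L' p)) = \<bar>(\<theta> L' p + sg b' * t) - \<theta> L' p\<bar>"
      using st rl by (intro dist_\<gamma>[OF L(3)]) linarith
    ultimately have "dist y p = t" using \<gamma>_\<theta>[OF L(3,4)] by (simp add: y_def db pt_def)
    note y = yL this
    have "\<rho> L y = p" using proj_att[OF L(1,3) False y(1)] att_eq[OF L(1,3) False L(2,4)] by simp
    then have "dist x y = s + t"
      using dist_via_proj[OF L(1) x(1), of y] y x pt_in_graph[OF d(2), of t] by (simp add: y_def dist_commute)
    then show ?thesis using False db by (simp add: x_def y_def)
  qed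
qed

lemma dist_center_pt:
  assumes "good_radius p r" "d \<in> dirs p" "0 \<le> t" "t < r"
  shows "dist p (pt p d t) = t"
  using dist_pt[OF assms(1,2,2), of 0 t] pt_0[OF assms(2)] assms(3,4) by simp

lemma pt_surj:
  assumes r: "good_radius p r" and y: "y \<in> \<Gamma>" "dist p y < r"
  shows "\<exists>d\<in>dirs p. y = pt p d (dist p y)"
proof -
  obtain L where L: "L \<in> \<L>" "y \<in> L" using y union by auto
  have p: "p \<in> L" using r L y unfolding good_radius_def by force
  obtain s where s: "\<gamma> L s = y" using range_\<gamma>[OF L(1)] L(2) by (metis imageE)
  obtain k :: int where k: "\<bar>\<theta> L p - (s + of_int k * len L)\<bar> \<le> len L / 2" using near_lift[OF L(1)] by blast
  define s' where "s' = s + of_int k * len L"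
  have s': "\<gamma> L s' = y" using \<gamma>_add_int[OF L(1)] s by (simp add: s'_def)
  have "dist p y = \<bar>\<theta> L p - s'\<bar>" using dist_\<gamma>[OF L(1) k] s' \<gamma>_\<theta>[OF L(1) p] by (simp add: s'_def)
  then have "y = pt p (L, \<theta> L p \<le> s') (dist p y)"
    using s' by (auto simp: pt_def sg_def abs_if)
  moreover have "(L, \<theta> L p \<le> s') \<in> dirs p" using L p by (simp add: in_dirs)
  ultimately show ?thesis by blast
qed

lemma star_chart_pt:
  assumes r: "good_radius p r" and p: "p \<in> \<Gamma>" and e: "bij_betw e {..<n} (dirs p)"
  shows "star_chart \<Gamma> p n r (\<lambda>k. pt p (e k))"
proof -
  have ed: "e k \<in> dirs p" if "k < n" for k using e that by (auto simp: bij_betw_def)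
  have inj: "e k = e l \<longleftrightarrow> k = l" if "k < n" "l < n" for k l
    using e that by (auto simp: bij_betw_def inj_on_def)
  show ?thesis
    unfolding star_chart_def
  proof (intro conjI allI impI ballI)
    show "0 < r" using r by (simp add: good_radius_def)
    show "pt p (e k) 0 = p" if "k < n" for k using pt_0[OF ed[OF that]] .
    show "dist (pt p (e k) s) (pt p (e l) t) = (if k = l then \<bar>s - t\<bar> else s + t)"
      if "k < n" "l < n" "s \<in> {0..<r}" "t \<in> {0..<r}" for k l s t
      using dist_pt[OF r ed[OF that(1)] ed[OF that(2)]] that(3,4) inj[OF that(1,2)] by simp
    show "\<Gamma> \<inter> ball p r = insert p (\<Union>k<n. pt p (e k) ` {0..<r})"
    proof (intro equalityI subsetI)
      fix y assume "y \<in> \<Gamma> \<inter> ball p r"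
      then have y: "y \<in> \<Gamma>" "dist p y < r" by auto
      obtain d where d: "d \<in> dirs p" "y = pt p d (dist p y)" using pt_surj[OF r y] by blast
      have "d \<in> e ` {..<n}" using e d(1) by (simp add: bij_betw_def)
      then obtain k where "k < n" "e k = d" by blast
      then have "y \<in> pt p (e k) ` {0..<r}" using d y by auto
      then show "y \<in> insert p (\<Union>k<n. pt p (e k) ` {0..<r})" using \<open>k < n\<close> by blast
    next
      fix y assume "y \<in> insert p (\<Union>k<n. pt p (e k) ` {0..<r})"
      then consider "y = p" | k t where "k < n" "0 \<le> t" "t < r" "y = pt p (e k) t" by auto
      then show "y \<in> \<Gamma> \<inter> ball p r"
      proof cases
        case 1
        then show ?thesis using p r by (simp add: good_radius_def)
      next
        case 2
        then show ?thesis using dist_center_pt[OF r ed] pt_in_graph[OF ed] by simp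
      qed
    qed
  qed
qed

end

section \<open>Comparison of star charts\<close>

lemma chart_dist_center:
  assumes "star_chart \<Gamma> p n r a" "k < n" "0 \<le> t" "t < r"
  shows "dist p (a k t) = t" "a k t \<in> \<Gamma>"
proof -
  have "dist (a k 0) (a k t) = t" using assms unfolding star_chart_def by force
  then show "dist p (a k t) = t" using assms unfolding star_chart_def by auto
  have "a k t \<in> insert p (\<Union>k<n. a k ` {0..<r})" using assms by force
  then show "a k t \<in> \<Gamma>" using assms(1) unfolding star_chart_def by blast
qed

text \<open>Each point of the ray lies on some arm. Two points on different arms would have distance
  \<open>s + t\<close> instead of \<open>\<bar>s - t\<bar>\<close>, so the ray stays on one
  arm.\<close>

lemma chart_contains_ray:
  assumes a: "star_chart \<Gamma> p n r a" and r': "0 < r'" "r' \<le> r"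
    and b: "\<And>s t. s \<in> {0..<r'} \<Longrightarrow> t \<in> {0..<r'} \<Longrightarrow> dist (b s) (b t) = \<bar>s - t\<bar>"
    and b0: "b 0 = p" and bG: "\<And>t. t \<in> {0..<r'} \<Longrightarrow> b t \<in> \<Gamma>"
  shows "\<exists>k<n. \<forall>t\<in>{0..<r'}. b t = a k t"
proof -
  have arm: "\<exists>k<n. b t = a k t" if t: "0 < t" "t < r'" for t
  proof -
    have dt: "dist p (b t) = t" using b[of 0 t] b0 t by simp
    then have "b t \<in> \<Gamma> \<inter> ball p r" "b t \<noteq> p" using bG t r' by auto
    then obtain k s where k: "k < n" "0 \<le> s" "s < r" "b t = a k s"
      using a unfolding star_chart_def by auto
    then have "s = t" using chart_dist_center(1)[OF a k(1-3)] dt by simp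
    then show ?thesis using k by blast
  qed
  define t0 where "t0 = r' / 2"
  have t0: "0 < t0" "t0 < r'" using r' by (auto simp: t0_def)
  obtain k where k: "k < n" "b t0 = a k t0" using arm[OF t0] by blast
  have "b t = a k t" if t: "t \<in> {0..<r'}" for t
  proof (cases "t = 0")
    case True
    then show ?thesis using b0 a k by (auto simp: star_chart_def)
  next
    case False
    then obtain l where l: "l < n" "b t = a l t" using arm[of t] t by auto
    have "dist (a l t) (a k t0) = \<bar>t - t0\<bar>" using b[of t t0] t t0 k l by simp
    moreover have "dist (a l t) (a k t0) = (if l = k then \<bar>t - t0\<bar> else t + t0)"
      using a k l t t0 r' unfolding star_chart_def by simp
    ultimately have "l = k" using t t0 False by (auto split: if_splits)
    then show ?thesis using l by simp
  qed
  then show ?thesis using k by blast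
qed

context loop_tree
begin

text \<open>Every canonical ray follows one arm, different rays separate at once, and each arm
  contains a point of some ray. Slopes thus do not depend on the chart up to a permutation.\<close>

lemma chart_pt_bij:
  assumes a: "star_chart \<Gamma> p n r a" and p: "p \<in> \<Gamma>"
  shows "\<exists>\<pi> r'. bij_betw \<pi> (dirs p) {..<n} \<and> good_radius p r' \<and> r' \<le> r \<and>
    (\<forall>d\<in>dirs p. \<forall>t\<in>{0..<r'}. pt p d t = a (\<pi> d) t)"
proof -
  obtain r0 where r0: "good_radius p r0" using good_radius_ex by blast
  define r' where "r' = min r0 r"
  have "0 < r" using a by (simp add: star_chart_def)
  then have r': "0 < r'" "r' \<le> r" "good_radius p r'"
    using r0 good_radius_mono[OF r0, of r'] by (auto simp: r'_def good_radius_def)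
  have "\<exists>k<n. \<forall>t\<in>{0..<r'}. pt p d t = a k t" if d: "d \<in> dirs p" for d
    using chart_contains_ray[OF a r'(1,2), of "pt p d"] dist_pt[OF r'(3) d d] pt_0[OF d] pt_in_graph[OF d]
    by simp
  then obtain \<pi> where \<pi>: "\<And>d. d \<in> dirs p \<Longrightarrow> \<pi> d < n \<and> (\<forall>t\<in>{0..<r'}. pt p d t = a (\<pi> d) t)" by metis
  define h where "h = r' / 2"
  have h: "0 < h" "h < r'" using r' by (auto simp: h_def)
  have "inj_on \<pi> (dirs p)"
  proof (rule inj_onI, rule ccontr)
    fix d d' assume d: "d \<in> dirs p" "d' \<in> dirs p" "\<pi> d = \<pi> d'" "d \<noteq> d'"
    have "pt p d h = pt p d' h" using \<pi>[OF d(1)] \<pi>[OF d(2)] d(3) h by simp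
    then show False using dist_pt[OF r'(3) d(1,2), of h h] d(4) h by simp
  qed
  moreover have "\<pi> ` dirs p = {..<n}"
  proof
    show "\<pi> ` dirs p \<subseteq> {..<n}" using \<pi> by auto
    show "{..<n} \<subseteq> \<pi> ` dirs p"
    proof
      fix k assume k: "k \<in> {..<n}"
      have "dist p (a k h) = h" "a k h \<in> \<Gamma>" using chart_dist_center[OF a, of k h] k h r' by auto
      then obtain d where d: "d \<in> dirs p" "a k h = pt p d h"
        using pt_surj[OF r'(3), of "a k h"] h by auto
      then have eq: "a k h = a (\<pi> d) h" using \<pi>[OF d(1)] h by simp
      have "\<pi> d < n" using \<pi>[OF d(1)] by blast
      then have "dist (a k h) (a (\<pi> d) h) = (if k = \<pi> d then \<bar>h - h\<bar> else h + h)"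
        using a k h r' unfolding star_chart_def by simp
      then have "k = \<pi> d" using eq h by (auto split: if_splits)
      then show "k \<in> \<pi> ` dirs p" using d by blast
    qed
  qed
  ultimately show ?thesis using r' \<pi> by (intro exI[of _ \<pi>] exI[of _ r']) (auto simp: bij_betw_def)
qed

text \<open>Indexing the slopes by the fixed set \<open>dirs p\<close> instead of by the arms of
  some chart allows slopes of different functions to be compared and added.\<close>

definition has_dslopes :: "('a \<Rightarrow> real) \<Rightarrow> 'a \<Rightarrow> ('a set \<times> bool \<Rightarrow> real) \<Rightarrow> bool" where
  "has_dslopes f p m \<longleftrightarrow> (\<exists>r>0. \<forall>d\<in>dirs p. \<forall>t\<in>{0..<r}. f (pt p d t) = f p + m d * t)"

lemma local_slopes_of_dslopes:
  assumes p: "p \<in> \<Gamma>" and m: "has_dslopes f p m"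
  shows "\<exists>n m'. local_slopes \<Gamma> f p n m' \<and> m' ` {..<n} \<subseteq> m ` dirs p \<and> (\<Sum>k<n. m' k) = sum m (dirs p)"
proof -
  obtain r1 where r1: "r1 > 0" "\<And>d t. d \<in> dirs p \<Longrightarrow> t \<in> {0..<r1} \<Longrightarrow> f (pt p d t) = f p + m d * t"
    using m unfolding has_dslopes_def by blast
  obtain r0 where r0: "good_radius p r0" using good_radius_ex by blast
  define r where "r = min r0 r1"
  have r: "good_radius p r" using good_radius_mono[OF r0] r0 r1 by (auto simp: r_def good_radius_def)
  define n where "n = card (dirs p)"
  obtain e where e: "bij_betw e {..<n} (dirs p)"
    using finite_dirs[of p] unfolding n_def by (metis ex_bij_betw_nat_finite lessThan_atLeast0)
  have ed: "e k \<in> dirs p" if "k < n" for k using e that by (auto simp: bij_betw_def)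
  have "local_slopes \<Gamma> f p n (m \<circ> e)"
    unfolding local_slopes_def
    using star_chart_pt[OF r p e] r1(2) ed by (intro exI[of _ r] exI[of _ "\<lambda>k. pt p (e k)"]) (auto simp: r_def)
  moreover have "(\<Sum>k<n. (m \<circ> e) k) = sum m (dirs p)" using sum.reindex_bij_betw[OF e, of m] by simp
  moreover have "(m \<circ> e) ` {..<n} \<subseteq> m ` dirs p" using ed by auto
  ultimately show ?thesis by blast
qed

lemma dslopes_of_local_slopes:
  assumes p: "p \<in> \<Gamma>" and m': "local_slopes \<Gamma> f p n m'"
  shows "\<exists>m. has_dslopes f p m \<and> m ` dirs p \<subseteq> m' ` {..<n} \<and> (\<Sum>k<n. m' k) = sum m (dirs p)"
proof -
  obtain r a where a: "star_chart \<Gamma> p n r a" "\<And>k t. k < n \<Longrightarrow> t \<in> {0..<r} \<Longrightarrow> f (a k t) = f p + m' k * t"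
    using m' unfolding local_slopes_def by blast
  obtain \<pi> r' where \<pi>: "bij_betw \<pi> (dirs p) {..<n}" and r': "good_radius p r'" "r' \<le> r"
    and eq: "\<And>d t. d \<in> dirs p \<Longrightarrow> t \<in> {0..<r'} \<Longrightarrow> pt p d t = a (\<pi> d) t"
    using chart_pt_bij[OF a(1) p] by blast
  have pd: "\<pi> d < n" if "d \<in> dirs p" for d using \<pi> that by (auto simp: bij_betw_def)
  have "has_dslopes f p (m' \<circ> \<pi>)"
    unfolding has_dslopes_def
    using r' eq pd a(2) by (intro exI[of _ r']) (auto simp: good_radius_def)
  moreover have "(\<Sum>k<n. m' k) = sum (m' \<circ> \<pi>) (dirs p)" using sum.reindex_bij_betw[OF \<pi>, of m'] by simp
  moreover have "(m' \<circ> \<pi>) ` dirs p \<subseteq> m' ` {..<n}" using pd by auto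
  ultimately show ?thesis by blast
qed

lemma dslopes_unique:
  assumes "has_dslopes f p m" "has_dslopes f p m'" "d \<in> dirs p"
  shows "m d = m' d"
proof -
  obtain r where r: "r > 0" "\<And>t. t \<in> {0..<r} \<Longrightarrow> f (pt p d t) = f p + m d * t"
    using assms unfolding has_dslopes_def by blast
  obtain r' where r': "r' > 0" "\<And>t. t \<in> {0..<r'} \<Longrightarrow> f (pt p d t) = f p + m' d * t"
    using assms unfolding has_dslopes_def by blast
  define t where "t = min r r' / 2"
  have "0 < t" "t < r" "t < r'" using r r' by (auto simp: t_def)
  then show ?thesis using r(2)[of t] r'(2)[of t] by simp
qed

text \<open>All charts yield the same sum of slopes, so the definite description is well
  defined.\<close>

lemma ord_at_dslopes:
  assumes p: "p \<in> \<Gamma>" and m: "has_dslopes f p m"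
  shows "ord_at \<Gamma> f p = - sum m (dirs p)"
  unfolding ord_at_def
proof (rule the_equality)
  show "\<exists>n m'. local_slopes \<Gamma> f p n m' \<and> - sum m (dirs p) = - (\<Sum>k<n. m' k)"
    using local_slopes_of_dslopes[OF assms] by force
  fix j assume "\<exists>n m'. local_slopes \<Gamma> f p n m' \<and> j = - (\<Sum>k<n. m' k)"
  then obtain n m' where m': "local_slopes \<Gamma> f p n m'" "j = - (\<Sum>k<n. m' k)" by blast
  obtain m2 where m2: "has_dslopes f p m2" "(\<Sum>k<n. m' k) = sum m2 (dirs p)"
    using dslopes_of_local_slopes[OF p m'(1)] by blast
  have "sum m2 (dirs p) = sum m (dirs p)" using dslopes_unique[OF m2(1) m] by (intro sum.cong) auto
  then show "j = - sum m (dirs p)" using m' m2 by simp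
qed

text \<open>Reduces every germ condition at \<open>p\<close> to finitely many one-sided conditions
  along the arms.\<close>

lemma eventually_near:
  assumes p: "p \<in> \<Gamma>"
  shows "(\<forall>\<^sub>F q in at p within \<Gamma>. P q) \<longleftrightarrow> (\<exists>r>0. \<forall>d\<in>dirs p. \<forall>t. 0 < t \<and> t < r \<longrightarrow> P (pt p d t))"
proof
  obtain r0 where r0: "good_radius p r0" using good_radius_ex by blast
  then have "0 < r0" by (simp add: good_radius_def)
  {
    assume "\<forall>\<^sub>F q in at p within \<Gamma>. P q"
    then obtain e where e: "e > 0" "\<And>x. x \<in> \<Gamma> \<Longrightarrow> x \<noteq> p \<Longrightarrow> dist x p < e \<Longrightarrow> P x"
      unfolding eventually_at by blast
    have "P (pt p d t)" if d: "d \<in> dirs p" and t: "0 < t" "t < min r0 e" for d t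
    proof -
      have "dist p (pt p d t) = t" using dist_center_pt[OF r0 d, of t] t by simp
      moreover from this have "pt p d t \<noteq> p" using t by auto
      ultimately show ?thesis using e(2)[of "pt p d t"] pt_in_graph[OF d] t by (simp add: dist_commute)
    qed
    then show "\<exists>r>0. \<forall>d\<in>dirs p. \<forall>t. 0 < t \<and> t < r \<longrightarrow> P (pt p d t)"
      using \<open>0 < r0\<close> e(1) by (intro exI[of _ "min r0 e"]) auto
  }
  {
    assume "\<exists>r>0. \<forall>d\<in>dirs p. \<forall>t. 0 < t \<and> t < r \<longrightarrow> P (pt p d t)"
    then obtain r where r: "r > 0" "\<And>d t. d \<in> dirs p \<Longrightarrow> 0 < t \<Longrightarrow> t < r \<Longrightarrow> P (pt p d t)" by blast
    have "P x" if x: "x \<in> \<Gamma>" "x \<noteq> p" "dist x p < min r0 r" for x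
    proof -
      have "dist p x < r0" using x(3) by (simp add: dist_commute)
      then obtain d where d: "d \<in> dirs p" "x = pt p d (dist p x)" using pt_surj[OF r0 x(1)] by blast
      have "0 < dist p x" "dist p x < r" using x by (simp_all add: dist_commute)
      then have "P (pt p d (dist p x))" using r(2)[OF d(1)] by blast
      then show ?thesis using d(2) by simp
    qed
    then show "\<forall>\<^sub>F q in at p within \<Gamma>. P q"
      unfolding eventually_at using \<open>0 < r0\<close> r(1) by (intro exI[of _ "min r0 r"]) auto
  }
qed

text \<open>Another loop through the new point would be too close to miss \<open>p\<close>; but then
  it meets \<open>L\<close> in \<open>p\<close> only.\<close>

lemma dirs_pt:
  assumes r: "good_radius p r" and d: "(L, b) \<in> dirs p" and t: "0 < t" "t < r"
  shows "dirs (pt p (L, b) t) = {L} \<times> UNIV"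
proof -
  define q where "q = pt p (L, b) t"
  have q: "q \<in> L" "dist p q = t" using pt_in[OF d] dist_center_pt[OF r d] t by (auto simp: q_def)
  have L: "L \<in> \<L>" "p \<in> L" using d by (auto simp: in_dirs)
  have "M = L" if M: "M \<in> \<L>" "q \<in> M" for M
  proof (rule ccontr)
    assume "M \<noteq> L"
    have "p \<in> M" using r M q t unfolding good_radius_def by force
    then have "p = q" using meet[OF M(1) L(1) \<open>M \<noteq> L\<close>] L M q by blast
    then show False using q t by simp
  qed
  then show ?thesis using L q by (auto simp: dirs_def q_def)
qed

lemma continuous_of_dslopes:
  assumes "\<And>p. p \<in> \<Gamma> \<Longrightarrow> \<exists>m. has_dslopes f p m"
  shows "continuous_on \<Gamma> f"
  unfolding continuous_on_def
proof (intro ballI tendstoI)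
  fix p and e :: real assume p: "p \<in> \<Gamma>" and e: "0 < e"
  obtain m where "has_dslopes f p m" using assms p by blast
  then obtain r where r: "r > 0" "\<And>d t. d \<in> dirs p \<Longrightarrow> t \<in> {0..<r} \<Longrightarrow> f (pt p d t) = f p + m d * t"
    unfolding has_dslopes_def by blast
  define K where "K = 1 + (\<Sum>d\<in>dirs p. \<bar>m d\<bar>)"
  have K: "\<bar>m d\<bar> < K" if "d \<in> dirs p" for d
    using member_le_sum[OF that, of "\<lambda>d. \<bar>m d\<bar>"] finite_dirs[of p] by (simp add: K_def)
  have "K > 0" by (simp add: K_def sum_nonneg add_pos_nonneg)
  have "dist (f (pt p d t)) (f p) < e" if d: "d \<in> dirs p" and t: "0 < t" "t < min r (e / K)" for d t
  proof -
    have "dist (f (pt p d t)) (f p) = \<bar>m d\<bar> * t" using r(2)[OF d, of t] t by (simp add: dist_real_def abs_mult)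
    also have "\<dots> < K * t" using K[OF d] t by simp
    also have "\<dots> < e" using t \<open>K > 0\<close> by (simp add: field_simps)
    finally show ?thesis .
  qed
  then show "\<forall>\<^sub>F x in at p within \<Gamma>. dist (f x) (f p) < e"
    unfolding eventually_near[OF p] using r(1) e \<open>K > 0\<close> by (intro exI[of _ "min r (e / K)"]) auto
qed

end

section \<open>Flows on a circle\<close>

text \<open>\<open>mp s\<close> and \<open>mm s\<close> are the slopes at \<open>s\<close> in the positive and in the negative direction.\<close>

definition flow :: "(real \<Rightarrow> real) \<Rightarrow> (real \<Rightarrow> real) \<Rightarrow> bool" where
  "flow mp mm \<longleftrightarrow> (\<forall>s. \<exists>r>0. \<forall>t. 0 < t \<and> t < r \<longrightarrow>
     mp (s + t) = mp s \<and> mm (s + t) = - mp s \<and> mp (s - t) = - mm s \<and> mm (s - t) = mm s)"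

definition has_slopes :: "(real \<Rightarrow> real) \<Rightarrow> real \<Rightarrow> real \<Rightarrow> real \<Rightarrow> bool" where
  "has_slopes F s a b \<longleftrightarrow> (\<exists>r>0. \<forall>t. 0 \<le> t \<and> t < r \<longrightarrow> F (s + t) = F s + a * t \<and> F (s - t) = F s + b * t)"

text \<open>Every point has a punctured neighbourhood free of jumps, so the jumps cannot accumulate
  in a compact interval.\<close>

lemma flow_finite_jumps:
  assumes "flow mp mm"
  shows "finite {s \<in> {a..b}. mp s + mm s \<noteq> 0}"
proof -
  have "\<not> x islimpt {s \<in> {a..b}. mp s + mm s \<noteq> 0}" for x
  proof
    assume lim: "x islimpt {s \<in> {a..b}. mp s + mm s \<noteq> 0}"
    obtain r where r: "r > 0" "\<And>t. 0 < t \<Longrightarrow> t < r \<Longrightarrow>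
        mp (x + t) = mp x \<and> mm (x + t) = - mp x \<and> mp (x - t) = - mm x \<and> mm (x - t) = mm x"
      using assms unfolding flow_def by metis
    obtain y where y: "mp y + mm y \<noteq> 0" "y \<noteq> x" "dist y x < r"
      using lim r(1) unfolding islimpt_approachable by blast
    define t where "t = \<bar>y - x\<bar>"
    have "0 < t" "t < r" "y = x + t \<or> y = x - t" using y by (auto simp: t_def dist_real_def)
    then show False using r(2)[of t] y(1) by auto
  qed
  then show ?thesis
    using finite_not_islimpt_in_compact[of "{a..b}" "{s \<in> {a..b}. mp s + mm s \<noteq> 0}"]
    by (simp add: Int_absorb1 subset_iff)
qed

lemma sum_if_mult:
  fixes w :: "'b \<Rightarrow> real"
  assumes "finite P"
  shows "(\<Sum>p\<in>P. if C p then w p * t else 0) = (\<Sum>p | p \<in> P \<and> C p. w p) * t"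
proof -
  have "(\<Sum>p\<in>P. if C p then w p * t else 0) = (\<Sum>p | p \<in> P \<and> C p. w p * t)"
    using sum.inter_filter[OF assms, of "\<lambda>p. w p * t" C] by simp
  then show ?thesis by (simp add: sum_distrib_right)
qed

lemma sum_le_locally_constant:
  fixes A :: "real set" and w :: "real \<Rightarrow> real"
  assumes "finite A"
  shows "\<exists>r>0. \<forall>t. 0 < t \<and> t < r \<longrightarrow>
    (\<Sum>a | a \<in> A \<and> a \<le> s + t. w a) = (\<Sum>a | a \<in> A \<and> a \<le> s. w a) \<and>
    (\<Sum>a | a \<in> A \<and> a \<le> s - t. w a) = (\<Sum>a | a \<in> A \<and> a < s. w a)"
proof -
  obtain r where r: "r > 0" "\<And>x. x \<in> A \<Longrightarrow> x \<noteq> s \<Longrightarrow> r \<le> dist s x"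
    using finite_set_avoid[OF assms, of s] by blast
  have "{a. a \<in> A \<and> a \<le> s + t} = {a. a \<in> A \<and> a \<le> s}" "{a. a \<in> A \<and> a \<le> s - t} = {a. a \<in> A \<and> a < s}"
    if "0 < t" "t < r" for t
    using r(2) that by (fastforce simp: dist_real_def)+
  then show ?thesis using r(1) by (intro exI[of _ r]) auto
qed

lemma sum_le_less:
  fixes A :: "real set" and w :: "real \<Rightarrow> real"
  assumes "finite A" and "s \<notin> A \<Longrightarrow> w s = 0"
  shows "(\<Sum>a | a \<in> A \<and> a \<le> s. w a) = (\<Sum>a | a \<in> A \<and> a < s. w a) + w s"
proof (cases "s \<in> A")
  case True
  then have "{a. a \<in> A \<and> a \<le> s} = insert s {a. a \<in> A \<and> a < s}" by auto
  then show ?thesis using assms(1) by simp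
next
  case False
  then have "{a. a \<in> A \<and> a \<le> s} = {a. a \<in> A \<and> a < s}" by (auto simp: order_le_less)
  then show ?thesis using assms(2) False by simp
qed

lemma real_local_const:
  fixes G :: "real \<Rightarrow> real"
  assumes "\<And>s. s \<in> S \<Longrightarrow> \<exists>r>0. \<forall>t. 0 < t \<and> t < r \<longrightarrow> (s + t \<in> S \<longrightarrow> G (s + t) = G s) \<and> (s - t \<in> S \<longrightarrow> G (s - t) = G s)"
    and "connected S" "x \<in> S" "y \<in> S"
  shows "G x = G y"
proof (rule connected_local_const[OF assms(2-4)], intro ballI)
  fix s assume s: "s \<in> S"
  obtain r where r: "r > 0" "\<And>t. 0 < t \<Longrightarrow> t < r \<Longrightarrow> (s + t \<in> S \<longrightarrow> G (s + t) = G s) \<and> (s - t \<in> S \<longrightarrow> G (s - t) = G s)"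
    using assms(1)[OF s] by blast
  have "G s = G b" if b: "b \<in> S" "b \<noteq> s" "dist b s < r" for b
  proof -
    define t where "t = \<bar>b - s\<bar>"
    have "0 < t" "t < r" "b = s + t \<or> b = s - t" using b by (auto simp: t_def dist_real_def)
    then show ?thesis using r(2)[of t] b(1) by auto
  qed
  then show "\<forall>\<^sub>F b in at s within S. G s = G b" unfolding eventually_at using r(1) by blast
qed

text \<open>After subtraction of the jumps passed so far the slope is locally constant. The second
  formula reads the slope from the left and so still holds at \<open>s = l\<close>, where
  periodicity enters.\<close>

lemma flow_step:
  assumes fl: "flow mp mm" and A: "A = {s \<in> {0<..<l}. mp s + mm s \<noteq> 0}" and l: "0 < l"
  shows "\<And>s. 0 \<le> s \<Longrightarrow> s < l \<Longrightarrow> mp s = mp 0 + (\<Sum>a | a \<in> A \<and> a \<le> s. mp a + mm a)"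
    and "\<And>s. 0 < s \<Longrightarrow> s \<le> l \<Longrightarrow> - mm s = mp 0 + (\<Sum>a | a \<in> A \<and> a < s. mp a + mm a)"
proof -
  define w where "w a = mp a + mm a" for a
  have fin: "finite A" using flow_finite_jumps[OF fl, of 0 l] by (rule finite_subset[rotated]) (auto simp: A)
  have fl': "\<exists>r>0. \<forall>t. 0 < t \<and> t < r \<longrightarrow> mp (s + t) = mp s \<and> mp (s - t) = - mm s \<and>
     (\<Sum>a | a \<in> A \<and> a \<le> s + t. w a) = (\<Sum>a | a \<in> A \<and> a \<le> s. w a) \<and>
     (\<Sum>a | a \<in> A \<and> a \<le> s - t. w a) = (\<Sum>a | a \<in> A \<and> a < s. w a)" for s
  proof -
    obtain r where r: "r > 0" "\<And>t. 0 < t \<Longrightarrow> t < r \<Longrightarrow> mp (s + t) = mp s \<and> mp (s - t) = - mm s"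
      using fl unfolding flow_def by metis
    obtain r' where r': "r' > 0" "\<And>t. 0 < t \<Longrightarrow> t < r' \<Longrightarrow> (\<Sum>a | a \<in> A \<and> a \<le> s + t. w a) = (\<Sum>a | a \<in> A \<and> a \<le> s. w a) \<and>
     (\<Sum>a | a \<in> A \<and> a \<le> s - t. w a) = (\<Sum>a | a \<in> A \<and> a < s. w a)"
      using sum_le_locally_constant[OF fin, where s = s and w = w] by blast
    show ?thesis using r r' by (intro exI[of _ "min r r'"]) auto
  qed
  define G where "G s = mp s - (\<Sum>a | a \<in> A \<and> a \<le> s. w a)" for s
  have G: "G 0 = G s" if "0 \<le> s" "s < l" for s
  proof (rule real_local_const[of "{0..<l}" G])
    fix s assume s: "s \<in> {0..<l}"
    obtain r where r: "r > 0" "\<And>t. 0 < t \<Longrightarrow> t < r \<Longrightarrow> mp (s + t) = mp s \<and> mp (s - t) = - mm s \<and>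
     (\<Sum>a | a \<in> A \<and> a \<le> s + t. w a) = (\<Sum>a | a \<in> A \<and> a \<le> s. w a) \<and>
     (\<Sum>a | a \<in> A \<and> a \<le> s - t. w a) = (\<Sum>a | a \<in> A \<and> a < s. w a)" using fl' by blast
    have "G (s + t) = G s \<and> (s - t \<in> {0..<l} \<longrightarrow> G (s - t) = G s)" if t: "0 < t" "t < r" for t
    proof -
      have "G (s - t) = G s" if "s - t \<in> {0..<l}"
      proof -
        have "0 < s" using that t by auto
        then have "(\<Sum>a | a \<in> A \<and> a \<le> s. w a) = (\<Sum>a | a \<in> A \<and> a < s. w a) + w s"
          using s by (intro sum_le_less[OF fin]) (auto simp: A w_def)
        then show ?thesis using r(2)[OF t] by (simp add: G_def w_def)
      qed
      then show ?thesis using r(2)[OF t] by (simp add: G_def)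
    qed
    then show "\<exists>r>0. \<forall>t. 0 < t \<and> t < r \<longrightarrow> (s + t \<in> {0..<l} \<longrightarrow> G (s + t) = G s) \<and> (s - t \<in> {0..<l} \<longrightarrow> G (s - t) = G s)"
      using r(1) by blast
  qed (use that l in auto)
  have "(\<Sum>a | a \<in> A \<and> a \<le> 0. w a) = 0" by (intro sum.neutral) (auto simp: A)
  then have G0: "G 0 = mp 0" by (simp add: G_def)
  show 1: "mp s = mp 0 + (\<Sum>a | a \<in> A \<and> a \<le> s. mp a + mm a)" if "0 \<le> s" "s < l" for s
    using G[OF that] G0 by (simp add: G_def w_def)
  show "- mm s = mp 0 + (\<Sum>a | a \<in> A \<and> a < s. mp a + mm a)" if s: "0 < s" "s \<le> l" for s
  proof -
    obtain r where r: "r > 0" "\<And>t. 0 < t \<Longrightarrow> t < r \<Longrightarrow> mp (s + t) = mp s \<and> mp (s - t) = - mm s \<and>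
     (\<Sum>a | a \<in> A \<and> a \<le> s + t. w a) = (\<Sum>a | a \<in> A \<and> a \<le> s. w a) \<and>
     (\<Sum>a | a \<in> A \<and> a \<le> s - t. w a) = (\<Sum>a | a \<in> A \<and> a < s. w a)" using fl' by blast
    define t where "t = min r s / 2"
    have t: "0 < t" "t < r" "t < s" using r s by (auto simp: t_def)
    then show ?thesis using r(2)[OF t(1,2)] 1[of "s - t"] s by (simp add: w_def)
  qed
qed

text \<open>One turn around the circle. The slope returns to its initial value, so the jumps cancel;
  a discrete integration by parts then expresses their first moment by the slope at the base point
  and the total increase of a primitive. For integral slopes this is the origin of the congruences
  modulo the length.\<close>

lemma flow_on_circle:
  assumes fl: "flow mp mm" and l: "0 < l" and per: "mm l = mm 0"
    and J: "J = {s \<in> {0..<l}. mp s + mm s \<noteq> 0}"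
  shows "finite J" "(\<Sum>s\<in>J. mp s + mm s) = 0"
    and "(\<And>s. 0 \<le> s \<Longrightarrow> s \<le> l \<Longrightarrow> has_slopes F s (mp s) (mm s)) \<Longrightarrow>
      (\<Sum>s\<in>J. (mp s + mm s) * s) = - (l * mm 0) - (F l - F 0)"
proof -
  show finJ: "finite J" using flow_finite_jumps[OF fl, of 0 l] by (rule finite_subset[rotated]) (auto simp: J)
  define A where "A = {s \<in> {0<..<l}. mp s + mm s \<noteq> 0}"
  have AJ: "A = J - {0}" using l by (auto simp: A_def J)
  have fin: "finite A" using finJ AJ by simp
  note step = flow_step[OF fl A_def l]
  have Al: "{a. a \<in> A \<and> a < l} = A" by (auto simp: A_def)
  have SA: "(\<Sum>a\<in>A. mp a + mm a) = - mp 0 - mm 0" using step(2)[of l] l per by (simp add: Al)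
  \<comment> \<open>The base point needs separate treatment, since \<open>A\<close> contains the
    interior jumps only.\<close>
  have split: "(\<Sum>s\<in>J. (mp s + mm s) * u s) = (mp 0 + mm 0) * u 0 + (\<Sum>s\<in>A. (mp s + mm s) * u s)" for u
  proof (cases "0 \<in> J")
    case True
    then show ?thesis using finJ AJ by (simp add: sum.remove)
  next
    case False
    then have "mp 0 + mm 0 = 0" "A = J" using l AJ by (auto simp: J)
    then show ?thesis by simp
  qed
  show "(\<Sum>s\<in>J. mp s + mm s) = 0" using split[of "\<lambda>_. 1"] SA by simp
  assume F: "\<And>s. 0 \<le> s \<Longrightarrow> s \<le> l \<Longrightarrow> has_slopes F s (mp s) (mm s)"
  define w where "w a = mp a + mm a" for a
  \<comment> \<open>A piecewise linear function with the same interior jumps as \<open>F\<close>.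
    Subtracting it and the linear function of slope \<open>mp 0\<close> from \<open>F\<close> leaves
    a locally constant function.\<close>
  define H where "H s = (\<Sum>a\<in>A. w a * max 0 (s - a))" for s
  define G where "G s = F s - mp 0 * s - H s" for s
  have H: "\<exists>r>0. \<forall>t. 0 < t \<and> t < r \<longrightarrow> H (s + t) = H s + (\<Sum>a | a \<in> A \<and> a \<le> s. w a) * t \<and>
      H (s - t) = H s - (\<Sum>a | a \<in> A \<and> a < s. w a) * t" for s
  proof -
    obtain r where r: "r > 0" "\<And>x. x \<in> A \<Longrightarrow> x \<noteq> s \<Longrightarrow> r \<le> dist s x"
      using finite_set_avoid[OF fin, of s] by blast
    have "H (s + t) = H s + (\<Sum>a | a \<in> A \<and> a \<le> s. w a) * t \<and> H (s - t) = H s - (\<Sum>a | a \<in> A \<and> a < s. w a) * t"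
      if t: "0 < t" "t < r" for t
    proof
      have "H (s + t) = (\<Sum>a\<in>A. w a * max 0 (s - a) + (if a \<le> s then w a * t else 0))"
        unfolding H_def
      proof (rule sum.cong[OF refl])
        fix a assume "a \<in> A"
        then show "w a * max 0 (s + t - a) = w a * max 0 (s - a) + (if a \<le> s then w a * t else 0)"
          using r(2)[of a] t by (cases "a = s") (auto simp: dist_real_def max_def algebra_simps)
      qed
      then show "H (s + t) = H s + (\<Sum>a | a \<in> A \<and> a \<le> s. w a) * t"
        using fin by (simp add: sum.distrib H_def sum_if_mult)
      have "H (s - t) = (\<Sum>a\<in>A. w a * max 0 (s - a) - (if a < s then w a * t else 0))"
        unfolding H_def
      proof (rule sum.cong[OF refl])
        fix a assume "a \<in> A"
        then show "w a * max 0 (s - t - a) = w a * max 0 (s - a) - (if a < s then w a * t else 0)"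
          using r(2)[of a] t by (cases "a = s") (auto simp: dist_real_def max_def algebra_simps)
      qed
      then show "H (s - t) = H s - (\<Sum>a | a \<in> A \<and> a < s. w a) * t"
        using fin by (simp add: sum_subtractf H_def sum_if_mult)
    qed
    then show ?thesis using r(1) by blast
  qed
  have "G 0 = G l"
  proof (rule real_local_const[of "{0..l}" G])
    fix s assume s: "s \<in> {0..l}"
    obtain r where r: "r > 0" "\<And>t. 0 < t \<Longrightarrow> t < r \<Longrightarrow> H (s + t) = H s + (\<Sum>a | a \<in> A \<and> a \<le> s. w a) * t \<and>
      H (s - t) = H s - (\<Sum>a | a \<in> A \<and> a < s. w a) * t" using H by blast
    obtain r' where r': "r' > 0" "\<And>t. 0 \<le> t \<Longrightarrow> t < r' \<Longrightarrow> F (s + t) = F s + mp s * t \<and> F (s - t) = F s + mm s * t"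
      using F[of s] s unfolding has_slopes_def by auto
    have "(s + t \<in> {0..l} \<longrightarrow> G (s + t) = G s) \<and> (s - t \<in> {0..l} \<longrightarrow> G (s - t) = G s)"
      if t: "0 < t" "t < min r r'" for t
    proof (intro conjI impI)
      have Hs: "H (s + t) = H s + (\<Sum>a | a \<in> A \<and> a \<le> s. w a) * t" "H (s - t) = H s - (\<Sum>a | a \<in> A \<and> a < s. w a) * t"
        using r(2)[of t] t by auto
      have Fs: "F (s + t) = F s + mp s * t" "F (s - t) = F s + mm s * t" using r'(2)[of t] t by auto
      show "G (s + t) = G s" if "s + t \<in> {0..l}"
      proof -
        have "mp s = mp 0 + (\<Sum>a | a \<in> A \<and> a \<le> s. w a)" using step(1)[of s] that s t by (simp add: w_def)
        then show ?thesis unfolding G_def Hs Fs by (simp add: algebra_simps)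
      qed
      show "G (s - t) = G s" if "s - t \<in> {0..l}"
      proof -
        have "- mm s = mp 0 + (\<Sum>a | a \<in> A \<and> a < s. w a)" using step(2)[of s] that s t by (simp add: w_def)
        then have "(mm s + mp 0 + (\<Sum>a | a \<in> A \<and> a < s. w a)) * t = 0" by simp
        then show ?thesis unfolding G_def Hs Fs by (simp add: algebra_simps)
      qed
    qed
    then show "\<exists>r>0. \<forall>t. 0 < t \<and> t < r \<longrightarrow> (s + t \<in> {0..l} \<longrightarrow> G (s + t) = G s) \<and> (s - t \<in> {0..l} \<longrightarrow> G (s - t) = G s)"
      using r(1) r'(1) by (intro exI[of _ "min r r'"]) simp
  qed (use l in auto)
  moreover have "H 0 = 0" unfolding H_def by (intro sum.neutral) (auto simp: A_def)
  moreover have "H l = (\<Sum>a\<in>A. w a * l - w a * a)"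
    unfolding H_def by (intro sum.cong) (auto simp: A_def algebra_simps)
  ultimately have "F l - F 0 = mp 0 * l + (\<Sum>a\<in>A. w a) * l - (\<Sum>a\<in>A. w a * a)"
    by (simp add: G_def sum_subtractf sum_distrib_right)
  also have "(\<Sum>a\<in>A. w a) = - mp 0 - mm 0" using SA by (simp add: w_def)
  finally show "(\<Sum>s\<in>J. (mp s + mm s) * s) = - (l * mm 0) - (F l - F 0)"
    using split[of "\<lambda>s. s"] by (simp add: w_def algebra_simps)
qed

lemma hinge_slopes:
  fixes \<tau> :: "'b \<Rightarrow> real" and w :: "'b \<Rightarrow> real"
  assumes "finite P"
  shows "has_slopes (\<lambda>s. (\<Sum>p\<in>P. w p * max 0 (s - \<tau> p))) s
    (\<Sum>p | p \<in> P \<and> \<tau> p \<le> s. w p) (- (\<Sum>p | p \<in> P \<and> \<tau> p < s. w p))"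
proof -
  obtain r where r: "r > 0" "\<And>x. x \<in> \<tau> ` P \<Longrightarrow> x \<noteq> s \<Longrightarrow> r \<le> dist s x"
    using finite_set_avoid[of "\<tau> ` P" s] assms by blast
  have "(\<Sum>p\<in>P. w p * max 0 (s + t - \<tau> p)) = (\<Sum>p\<in>P. w p * max 0 (s - \<tau> p)) + (\<Sum>p | p \<in> P \<and> \<tau> p \<le> s. w p) * t \<and>
      (\<Sum>p\<in>P. w p * max 0 (s - t - \<tau> p)) = (\<Sum>p\<in>P. w p * max 0 (s - \<tau> p)) + (- (\<Sum>p | p \<in> P \<and> \<tau> p < s. w p)) * t"
    if t: "0 \<le> t" "t < r" for t
  proof
    have "(\<Sum>p\<in>P. w p * max 0 (s + t - \<tau> p)) = (\<Sum>p\<in>P. w p * max 0 (s - \<tau> p) + (if \<tau> p \<le> s then w p * t else 0))"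
    proof (rule sum.cong[OF refl])
      fix p assume "p \<in> P"
      then show "w p * max 0 (s + t - \<tau> p) = w p * max 0 (s - \<tau> p) + (if \<tau> p \<le> s then w p * t else 0)"
        using r(2)[of "\<tau> p"] t by (cases "\<tau> p = s") (auto simp: dist_real_def max_def algebra_simps)
    qed
    then show "(\<Sum>p\<in>P. w p * max 0 (s + t - \<tau> p)) = (\<Sum>p\<in>P. w p * max 0 (s - \<tau> p)) + (\<Sum>p | p \<in> P \<and> \<tau> p \<le> s. w p) * t"
      using assms by (simp add: sum.distrib sum_if_mult)
    have "(\<Sum>p\<in>P. w p * max 0 (s - t - \<tau> p)) = (\<Sum>p\<in>P. w p * max 0 (s - \<tau> p) - (if \<tau> p < s then w p * t else 0))"
    proof (rule sum.cong[OF refl])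
      fix p assume "p \<in> P"
      then show "w p * max 0 (s - t - \<tau> p) = w p * max 0 (s - \<tau> p) - (if \<tau> p < s then w p * t else 0)"
        using r(2)[of "\<tau> p"] t by (cases "\<tau> p = s") (auto simp: dist_real_def max_def algebra_simps)
    qed
    then show "(\<Sum>p\<in>P. w p * max 0 (s - t - \<tau> p)) = (\<Sum>p\<in>P. w p * max 0 (s - \<tau> p)) + (- (\<Sum>p | p \<in> P \<and> \<tau> p < s. w p)) * t"
      using assms by (simp add: sum_subtractf sum_if_mult)
  qed
  then show ?thesis unfolding has_slopes_def using r(1) by blast
qed

text \<open>The converse of \<open>flow_on_circle\<close>. Hinges at the points
  \<open>\<tau> p\<close> produce the slope changes \<open>- D p\<close>, and degree zero makes the
  slopes at the two ends of the period match, so the function continues quasi-periodically. The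
  additional slope \<open>- N\<close> changes the increase per turn by \<open>N\<close> times
  \<open>l\<close>, which is the freedom left by a congruence.\<close>

lemma flow_on_circle_exists:
  fixes \<tau> :: "'b \<Rightarrow> real" and D :: "'b \<Rightarrow> int" and N :: int
  assumes fin: "finite P" and \<tau>: "\<And>p. p \<in> P \<Longrightarrow> 0 \<le> \<tau> p \<and> \<tau> p < l" and l: "0 < l"
    and deg: "(\<Sum>p\<in>P. D p) = 0"
  shows "\<exists>F. (\<forall>s. F (s + l) = F s + ((\<Sum>p\<in>P. of_int (D p) * \<tau> p) - of_int N * l)) \<and>
    (\<forall>s. 0 \<le> s \<and> s < l \<longrightarrow> (\<exists>a b :: int. has_slopes F s (of_int a) (of_int b) \<and>
       a + b = - (\<Sum>p | p \<in> P \<and> \<tau> p = s. D p)))"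
proof -
  define X where "X = (\<Sum>p\<in>P. of_int (D p) * \<tau> p) - of_int N * l"
  define F0 where "F0 s = - (\<Sum>p\<in>P. of_int (D p) * max 0 (s - \<tau> p)) - of_int N * s" for s
  define F where "F s = F0 (l * frac (s / l)) + of_int \<lfloor>s / l\<rfloor> * X" for s
  have per: "F (s + l) = F s + X" for s
  proof -
    have "(s + l) / l = s / l + 1" using l by (simp add: field_simps)
    then show ?thesis by (simp add: F_def frac_def algebra_simps)
  qed
  have F0_eq: "F s = F0 s" if "0 \<le> s" "s < l" for s
  proof -
    have "\<lfloor>s / l\<rfloor> = 0" using that l by (simp add: floor_eq_iff)
    then show ?thesis using that l by (simp add: F_def frac_def)
  qed
  have degr: "(\<Sum>p\<in>P. real_of_int (D p)) = 0" using deg by (metis of_int_0 of_int_sum)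
  have F00: "F0 0 = 0" unfolding F0_def using \<tau> by (auto intro!: sum.neutral)
  have "(\<Sum>p\<in>P. of_int (D p) * max 0 (l - \<tau> p)) = (\<Sum>p\<in>P. of_int (D p) * l - of_int (D p) * \<tau> p)"
    using \<tau> by (intro sum.cong) (auto simp: algebra_simps dest: less_imp_le)
  then have F0l: "F0 l = X"
    using degr by (simp add: F0_def X_def sum_subtractf sum_distrib_right[symmetric])
  have sl: "\<exists>r>0. \<forall>t. 0 \<le> t \<and> t < r \<longrightarrow>
      F0 (s + t) = F0 s + of_int (- (\<Sum>p | p \<in> P \<and> \<tau> p \<le> s. D p) - N) * t \<and>
      F0 (s - t) = F0 s + of_int ((\<Sum>p | p \<in> P \<and> \<tau> p < s. D p) + N) * t" for s
  proof -
    obtain r where "r > 0" "\<And>t. 0 \<le> t \<Longrightarrow> t < r \<Longrightarrow>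
      (\<Sum>p\<in>P. of_int (D p) * max 0 (s + t - \<tau> p)) = (\<Sum>p\<in>P. of_int (D p) * max 0 (s - \<tau> p)) + (\<Sum>p | p \<in> P \<and> \<tau> p \<le> s. of_int (D p)) * t \<and>
      (\<Sum>p\<in>P. of_int (D p) * max 0 (s - t - \<tau> p)) = (\<Sum>p\<in>P. of_int (D p) * max 0 (s - \<tau> p)) + (- (\<Sum>p | p \<in> P \<and> \<tau> p < s. real_of_int (D p))) * t"
      using hinge_slopes[OF fin, of "\<lambda>p. of_int (D p)" \<tau> s] unfolding has_slopes_def by blast
    then show ?thesis by (intro exI[of _ r]) (simp add: F0_def algebra_simps)
  qed
  have "\<exists>a b :: int. has_slopes F s (of_int a) (of_int b) \<and> a + b = - (\<Sum>p | p \<in> P \<and> \<tau> p = s. D p)"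
    if s: "0 \<le> s" "s < l" for s
  proof -
    obtain r1 where r1: "r1 > 0" "\<And>t. 0 \<le> t \<Longrightarrow> t < r1 \<Longrightarrow>
      F0 (s + t) = F0 s + of_int (- (\<Sum>p | p \<in> P \<and> \<tau> p \<le> s. D p) - N) * t \<and>
      F0 (s - t) = F0 s + of_int ((\<Sum>p | p \<in> P \<and> \<tau> p < s. D p) + N) * t" using sl by blast
    show ?thesis
    proof (cases "s = 0")
      case False
      define r where "r = min r1 (min s (l - s))"
      have "has_slopes F s (of_int (- (\<Sum>p | p \<in> P \<and> \<tau> p \<le> s. D p) - N)) (of_int ((\<Sum>p | p \<in> P \<and> \<tau> p < s. D p) + N))"
        unfolding has_slopes_def
      proof (intro exI[of _ r] conjI allI impI)
        show "0 < r" using r1 s False by (simp add: r_def)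
        fix t assume t: "0 \<le> t \<and> t < r"
        then have "F (s + t) = F0 (s + t)" "F (s - t) = F0 (s - t)" "F s = F0 s"
          using s by (auto intro!: F0_eq simp: r_def)
        then show "F (s + t) = F s + of_int (- (\<Sum>p | p \<in> P \<and> \<tau> p \<le> s. D p) - N) * t"
          "F (s - t) = F s + of_int ((\<Sum>p | p \<in> P \<and> \<tau> p < s. D p) + N) * t"
          using r1(2)[of t] t by (auto simp: r_def)
      qed
      moreover
      have "(\<Sum>p | p \<in> P \<and> \<tau> p \<le> s. D p) = (\<Sum>p | p \<in> P \<and> \<tau> p < s. D p) + (\<Sum>p | p \<in> P \<and> \<tau> p = s. D p)"
        using fin by (subst sum.union_disjoint[symmetric]) (auto intro!: sum.cong)
      then have "(- (\<Sum>p | p \<in> P \<and> \<tau> p \<le> s. D p) - N) + ((\<Sum>p | p \<in> P \<and> \<tau> p < s. D p) + N)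
          = - (\<Sum>p | p \<in> P \<and> \<tau> p = s. D p)" by simp
      ultimately show ?thesis by blast
    next
      case True
      \<comment> \<open>To the left of the seam the values are those to the left of
        \<open>l\<close>, lowered by the increase \<open>X\<close> of one turn.\<close>
      obtain r2 where r2: "r2 > 0" "\<And>t. 0 \<le> t \<Longrightarrow> t < r2 \<Longrightarrow>
        F0 (l - t) = F0 l + of_int ((\<Sum>p | p \<in> P \<and> \<tau> p < l. D p) + N) * t" using sl by blast
      have "{p. p \<in> P \<and> \<tau> p < l} = P" using \<tau> by auto
      then have r2': "\<And>t. 0 \<le> t \<Longrightarrow> t < r2 \<Longrightarrow> F0 (l - t) = X + of_int N * t"
        using r2(2) deg F0l by simp
      define r where "r = min (min r1 r2) l"
      have F0': "F 0 = 0" using F0_eq[of 0] l F00 by simp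
      have "has_slopes F s (of_int (- (\<Sum>p | p \<in> P \<and> \<tau> p \<le> s. D p) - N)) (of_int N)"
        unfolding has_slopes_def
      proof (intro exI[of _ r] conjI allI impI)
        show "0 < r" using r1 r2 l by (simp add: r_def)
        fix t assume t: "0 \<le> t \<and> t < r"
        then have "F (s + t) = F0 (s + t)" using True by (intro F0_eq) (auto simp: r_def)
        then show "F (s + t) = F s + of_int (- (\<Sum>p | p \<in> P \<and> \<tau> p \<le> s. D p) - N) * t"
          using r1(2)[of t] t True F0' F00 by (auto simp: r_def)
        show "F (s - t) = F s + of_int N * t"
        proof (cases "t = 0")
          case False
          have "F (s - t) = F (l - t) - X" using per[of "- t"] True by (simp add: algebra_simps)
          also have "F (l - t) = F0 (l - t)" using t False by (intro F0_eq) (auto simp: r_def)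
          finally show ?thesis using r2'[of t] t True F0' by (simp add: r_def)
        qed simp
      qed
      moreover have "{p. p \<in> P \<and> \<tau> p \<le> s} = {p. p \<in> P \<and> \<tau> p = s}" using \<tau> True by force
      then have "(- (\<Sum>p | p \<in> P \<and> \<tau> p \<le> s. D p) - N) + N = - (\<Sum>p | p \<in> P \<and> \<tau> p = s. D p)" by simp
      ultimately show ?thesis by blast
    qed
  qed
  then show ?thesis using per unfolding X_def by blast
qed

text \<open>Gaussian elimination: the equation for \<open>L\<close> is solved for an unknown
  \<open>j\<close> with nonzero coefficient, which is then substituted into the remaining
  equations.\<close>

lemma underdetermined_system:
  fixes w :: "'i \<Rightarrow> 's \<Rightarrow> real"
  assumes "finite S" "finite I" "card S < card I"
  shows "\<exists>x. (\<exists>i\<in>I. x i \<noteq> 0) \<and> (\<forall>M\<in>S. (\<Sum>i\<in>I. x i * w i M) = 0)"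
  using assms
proof (induction S arbitrary: I w rule: finite_induct)
  case empty
  then obtain i where "i \<in> I" by fastforce
  then show ?case by (intro exI[of _ "\<lambda>_. 1"]) auto
next
  case (insert L S)
  show ?case
  proof (cases "\<forall>i\<in>I. w i L = 0")
    case True
    obtain x where "\<exists>i\<in>I. x i \<noteq> 0" "\<forall>M\<in>S. (\<Sum>i\<in>I. x i * w i M) = 0"
      using insert.IH[of I w] insert.prems insert.hyps by auto
    then show ?thesis using True by (intro exI[of _ x]) auto
  next
    case False
    then obtain j where j: "j \<in> I" "w j L \<noteq> 0" by blast
    define w' where "w' i M = w i M - w i L / w j L * w j M" for i M
    have "card S < card (I - {j})" using insert.prems insert.hyps j by (simp add: card_Diff_singleton)
    then obtain x where x: "\<exists>i\<in>I-{j}. x i \<noteq> 0" "\<forall>M\<in>S. (\<Sum>i\<in>I-{j}. x i * w' i M) = 0"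
      using insert.IH[of "I - {j}" w'] insert.prems by auto
    define y where "y = - (\<Sum>i\<in>I-{j}. x i * w i L) / w j L"
    define x' where "x' = x(j := y)"
    have sum: "(\<Sum>i\<in>I. x' i * w i M) = y * w j M + (\<Sum>i\<in>I-{j}. x i * w i M)" for M
    proof -
      have "(\<Sum>i\<in>I. x' i * w i M) = x' j * w j M + (\<Sum>i\<in>I-{j}. x' i * w i M)"
        using insert.prems(1) j(1) by (rule sum.remove)
      also have "(\<Sum>i\<in>I-{j}. x' i * w i M) = (\<Sum>i\<in>I-{j}. x i * w i M)"
        by (intro sum.cong) (auto simp: x'_def)
      finally show ?thesis by (simp add: x'_def)
    qed
    have "(\<Sum>i\<in>I. x' i * w i L) = 0" unfolding sum y_def using j by simp
    moreover have "(\<Sum>i\<in>I. x' i * w i M) = 0" if "M \<in> S" for M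
    proof -
      have "0 = (\<Sum>i\<in>I-{j}. x i * w i M - x i * w i L * (w j M / w j L))"
        using x(2) that by (simp add: w'_def algebra_simps)
      also have "\<dots> = (\<Sum>i\<in>I-{j}. x i * w i M) - (\<Sum>i\<in>I-{j}. x i * w i L) * (w j M / w j L)"
        by (simp add: sum_subtractf sum_distrib_right sum_divide_distrib)
      finally show ?thesis unfolding sum y_def by simp
    qed
    moreover have "\<exists>i\<in>I. x' i \<noteq> 0" using x(1) by (auto simp: x'_def)
    ultimately show ?thesis by (intro exI[of _ x']) auto
  qed
qed

section \<open>Chains and cycles on a tree of loops\<close>

context loop_tree
begin

lemma uniform_radius:
  assumes "finite S" "\<And>d. d \<in> S \<Longrightarrow> \<exists>r>0. \<forall>t. 0 < t \<and> t < r \<longrightarrow> Q d t"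
  shows "\<exists>r>(0::real). \<forall>d\<in>S. \<forall>t. 0 < t \<and> t < r \<longrightarrow> Q d t"
  using assms
proof (induction S rule: finite_induct)
  case empty
  then show ?case by (intro exI[of _ 1]) auto
next
  case (insert d S)
  obtain r where r: "r > 0" "\<forall>d\<in>S. \<forall>t. 0 < t \<and> t < r \<longrightarrow> Q d t" using insert by blast
  obtain r' where r': "r' > 0" "\<forall>t. 0 < t \<and> t < r' \<longrightarrow> Q d t" using insert.prems by blast
  show ?case using r r' by (intro exI[of _ "min r r'"]) auto
qed

lemma has_dslopesI:
  assumes "\<And>d. d \<in> dirs p \<Longrightarrow> \<exists>r>0. \<forall>t. 0 < t \<and> t < r \<longrightarrow> f (pt p d t) = f p + m d * t"
  shows "has_dslopes f p m"
proof -
  obtain r where r: "r > 0" "\<And>d t. d \<in> dirs p \<Longrightarrow> 0 < t \<Longrightarrow> t < r \<Longrightarrow> f (pt p d t) = f p + m d * t"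
    using uniform_radius[OF finite_dirs, of p "\<lambda>d t. f (pt p d t) = f p + m d * t"] assms by blast
  have "f (pt p d t) = f p + m d * t" if "d \<in> dirs p" "t \<in> {0..<r}" for d t
    using r(2)[OF that(1), of t] that pt_0[OF that(1)] by (cases "t = 0") auto
  then show ?thesis unfolding has_dslopes_def using r(1) by blast
qed

lemma eventually_nearI:
  assumes p: "p \<in> \<Gamma>" and "\<And>d. d \<in> dirs p \<Longrightarrow> \<exists>r>0. \<forall>t. 0 < t \<and> t < r \<longrightarrow> P (pt p d t)"
  shows "\<forall>\<^sub>F q in at p within \<Gamma>. P q"
proof -
  have "\<exists>r>0. \<forall>t. 0 < t \<and> t < r \<longrightarrow> (\<lambda>d t. P (pt p d t)) d t" if "d \<in> dirs p" for d
    using assms(2)[OF that] by simp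
  from uniform_radius[OF finite_dirs this] show ?thesis unfolding eventually_near[OF p] by simp
qed

lemma has_dslopes_cong:
  assumes "has_dslopes f p m" "\<And>d. d \<in> dirs p \<Longrightarrow> m d = m' d"
  shows "has_dslopes f p m'"
  using assms unfolding has_dslopes_def by metis

definition chain_slopes :: "'a chain \<Rightarrow> ('a \<Rightarrow> 'a set \<times> bool \<Rightarrow> real) \<Rightarrow> bool" where
  "chain_slopes c \<mu> \<longleftrightarrow> (\<forall>p\<in>\<Gamma>. c p p = 0 \<and> has_dslopes (c p) p (\<mu> p))"

lemma real_chain_slopes:
  assumes "real_chain \<Gamma> c" shows "\<exists>\<mu>. chain_slopes c \<mu>"
proof -
  have "\<exists>m. has_dslopes (c p) p m" if "p \<in> \<Gamma>" for p
    using assms dslopes_of_local_slopes[OF that] that unfolding real_chain_def by metis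
  then obtain \<mu> where "\<And>p. p \<in> \<Gamma> \<Longrightarrow> has_dslopes (c p) p (\<mu> p)" by metis
  then show ?thesis using assms unfolding chain_slopes_def real_chain_def by blast
qed

lemma integer_chain_slopes:
  assumes "integer_chain \<Gamma> c" shows "\<exists>\<mu>. chain_slopes c \<mu> \<and> (\<forall>p\<in>\<Gamma>. \<forall>d\<in>dirs p. \<mu> p d \<in> \<int>)"
proof -
  have "\<exists>m. has_dslopes (c p) p m \<and> (\<forall>d\<in>dirs p. m d \<in> \<int>)" if p: "p \<in> \<Gamma>" for p
  proof -
    obtain n m' where m': "local_slopes \<Gamma> (c p) p n m'" "\<forall>k<n. m' k \<in> \<int>"
      using assms p unfolding integer_chain_def by blast
    obtain m where "has_dslopes (c p) p m" "m ` dirs p \<subseteq> m' ` {..<n}"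
      using dslopes_of_local_slopes[OF p m'(1)] by blast
    then show ?thesis using m'(2) by (metis image_subset_iff imageE lessThan_iff)
  qed
  then obtain \<mu> where "\<And>p. p \<in> \<Gamma> \<Longrightarrow> has_dslopes (c p) p (\<mu> p) \<and> (\<forall>d\<in>dirs p. \<mu> p d \<in> \<int>)" by metis
  then show ?thesis using assms unfolding chain_slopes_def integer_chain_def real_chain_def by blast
qed

text \<open>The compatibility condition of a chain says that its germs at nearby points differ by
  constants. The slope therefore persists along an arm, and the slope back towards \<open>p\<close>
  is its negative.\<close>

lemma chain_transport:
  assumes c: "real_chain \<Gamma> c" and \<mu>: "chain_slopes c \<mu>" and d: "(L, b) \<in> dirs p"
  shows "\<exists>r>0. \<forall>t. 0 < t \<and> t < r \<longrightarrow> \<mu> (pt p (L, b) t) (L, b) = \<mu> p (L, b) \<and>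
    \<mu> (pt p (L, b) t) (L, \<not> b) = - \<mu> p (L, b)"
proof -
  have L: "L \<in> \<L>" "p \<in> L" and p: "p \<in> \<Gamma>" using d dirs_imp[OF d] by auto
  obtain r0 where r0: "good_radius p r0" using good_radius_ex by blast
  have cp: "c p p = 0" using \<mu> p by (simp add: chain_slopes_def)
  obtain r1 where r1: "r1 > 0" "\<And>t. 0 \<le> t \<Longrightarrow> t < r1 \<Longrightarrow> c p (pt p (L, b) t) = \<mu> p (L, b) * t"
    using \<mu> p d cp unfolding chain_slopes_def has_dslopes_def by fastforce
  have "\<forall>\<^sub>F q in at p within \<Gamma>. \<forall>\<^sub>F x in at q within \<Gamma>. c q x = c p x - c p q"
    using c p unfolding real_chain_def by blast
  then obtain r2 where r2: "r2 > 0" "\<And>t. 0 < t \<Longrightarrow> t < r2 \<Longrightarrow>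
      \<forall>\<^sub>F x in at (pt p (L, b) t) within \<Gamma>. c (pt p (L, b) t) x = c p x - c p (pt p (L, b) t)"
    unfolding eventually_near[OF p] using d by blast
  define r where "r = min r0 (min r1 r2)"
  have "0 < r" using r0 r1 r2 by (simp add: r_def good_radius_def)
  moreover have "\<mu> (pt p (L, b) t) (L, b) = \<mu> p (L, b) \<and> \<mu> (pt p (L, b) t) (L, \<not> b) = - \<mu> p (L, b)"
    if t: "0 < t" "t < r" for t
  proof -
    define q where "q = pt p (L, b) t"
    have q: "q \<in> \<Gamma>" using pt_in_graph[OF d] by (simp add: q_def)
    have dq: "dirs q = {L} \<times> UNIV" using dirs_pt[OF r0 d] t by (simp add: q_def r_def)
    have "\<forall>\<^sub>F x in at q within \<Gamma>. c q x = c p x - c p q" using r2(2)[of t] t by (simp add: q_def r_def)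
    then obtain r3 where r3: "r3 > 0" "\<And>e u. e \<in> dirs q \<Longrightarrow> 0 < u \<Longrightarrow> u < r3 \<Longrightarrow> c q (pt q e u) = c p (pt q e u) - c p q"
      unfolding eventually_near[OF q] by blast
    obtain r4 where r4: "r4 > 0" "\<And>e u. e \<in> dirs q \<Longrightarrow> 0 \<le> u \<Longrightarrow> u < r4 \<Longrightarrow> c q (pt q e u) = c q q + \<mu> q e * u"
      using \<mu> q unfolding chain_slopes_def has_dslopes_def by fastforce
    have cq: "c q q = 0" using \<mu> q by (simp add: chain_slopes_def)
    define u where "u = min (min r3 r4) (min t (r - t)) / 2"
    have "0 < 2 * u" "2 * u \<le> r3" "2 * u \<le> r4" "2 * u \<le> t" "2 * u \<le> r - t"
      unfolding u_def using r3(1) r4(1) t by auto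
    then have u: "0 < u" "u < r3" "u < r4" "u < t" "t + u < r" by linarith+
    have lift: "pt q (L, b') u = \<gamma> L (\<theta> L p + sg b * t + sg b' * u)" for b'
      using pt_lift[OF L(1), of "\<theta> L p + sg b * t" q b' u] by (simp add: q_def pt_def)
    have "pt q (L, b) u = pt p (L, b) (t + u)" unfolding lift unfolding pt_def by (simp add: algebra_simps)
    then have "\<mu> q (L, b) * u = \<mu> p (L, b) * (t + u) - \<mu> p (L, b) * t"
      using r3(2)[of "(L, b)" u] r4(2)[of "(L, b)" u] r1(2)[of "t + u"] r1(2)[of t] u t dq cq
      by (simp add: q_def r_def)
    then have "\<mu> q (L, b) * u = \<mu> p (L, b) * u" by (simp add: algebra_simps)
    moreover have "pt q (L, \<not> b) u = pt p (L, b) (t - u)" unfolding lift unfolding pt_def by (simp add: sg_def algebra_simps)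
    then have "\<mu> q (L, \<not> b) * u = \<mu> p (L, b) * (t - u) - \<mu> p (L, b) * t"
      using r3(2)[of "(L, \<not> b)" u] r4(2)[of "(L, \<not> b)" u] r1(2)[of "t - u"] r1(2)[of t] u t dq cq
      by (simp add: q_def r_def)
    then have "(\<mu> q (L, \<not> b) + \<mu> p (L, b)) * u = 0" by (simp add: algebra_simps)
    then have "\<mu> q (L, \<not> b) = - \<mu> p (L, b)" using u(1) by simp
    ultimately show ?thesis using u by (simp add: q_def)
  qed
  ultimately show ?thesis by blast
qed

lemma chain_flow:
  assumes c: "real_chain \<Gamma> c" and \<mu>: "chain_slopes c \<mu>" and L: "L \<in> \<L>"
  shows "flow (\<lambda>s. \<mu> (\<gamma> L s) (L, True)) (\<lambda>s. \<mu> (\<gamma> L s) (L, False))"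
  unfolding flow_def
proof
  fix s
  have d: "(L, b) \<in> dirs (\<gamma> L s)" for b using L \<gamma>_in by (simp add: in_dirs)
  have lift: "pt (\<gamma> L s) (L, b) t = \<gamma> L (s + sg b * t)" for b t using pt_lift[OF L refl] .
  obtain r where r: "r > 0" "\<And>t. 0 < t \<Longrightarrow> t < r \<Longrightarrow> \<mu> (\<gamma> L (s + t)) (L, True) = \<mu> (\<gamma> L s) (L, True) \<and>
     \<mu> (\<gamma> L (s + t)) (L, False) = - \<mu> (\<gamma> L s) (L, True)"
    using chain_transport[OF c \<mu> d[of True]] unfolding lift by (auto simp: sg_def)
  obtain r' where r': "r' > 0" "\<And>t. 0 < t \<Longrightarrow> t < r' \<Longrightarrow> \<mu> (\<gamma> L (s - t)) (L, False) = \<mu> (\<gamma> L s) (L, False) \<and>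
     \<mu> (\<gamma> L (s - t)) (L, True) = - \<mu> (\<gamma> L s) (L, False)"
    using chain_transport[OF c \<mu> d[of False]] unfolding lift by (auto simp: sg_def)
  show "\<exists>r>0. \<forall>t. 0 < t \<and> t < r \<longrightarrow> \<mu> (\<gamma> L (s + t)) (L, True) = \<mu> (\<gamma> L s) (L, True) \<and>
    \<mu> (\<gamma> L (s + t)) (L, False) = - \<mu> (\<gamma> L s) (L, True) \<and>
    \<mu> (\<gamma> L (s - t)) (L, True) = - \<mu> (\<gamma> L s) (L, False) \<and>
    \<mu> (\<gamma> L (s - t)) (L, False) = \<mu> (\<gamma> L s) (L, False)"
    using r r' by (intro exI[of _ "min r r'"]) auto
qed

text \<open>Minus the contribution of the loop \<open>L\<close> to the order at
  \<open>p\<close>.\<close>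

definition jump :: "('a \<Rightarrow> 'a set \<times> bool \<Rightarrow> real) \<Rightarrow> 'a set \<Rightarrow> 'a \<Rightarrow> real" where
  "jump \<mu> L p = \<mu> p (L, True) + \<mu> p (L, False)"

definition jumps :: "('a \<Rightarrow> 'a set \<times> bool \<Rightarrow> real) \<Rightarrow> 'a set \<Rightarrow> 'a set" where
  "jumps \<mu> L = {p \<in> L. jump \<mu> L p \<noteq> 0}"

lemma \<gamma>_inj_on: "L \<in> \<L> \<Longrightarrow> inj_on (\<gamma> L) {0..<len L}"
  using \<gamma>_inj_fundamental by (auto simp: inj_on_def)

lemma chain_jumps:
  assumes c: "real_chain \<Gamma> c" and \<mu>: "chain_slopes c \<mu>" and L: "L \<in> \<L>"
  shows "finite (jumps \<mu> L)" "(\<Sum>p\<in>jumps \<mu> L. jump \<mu> L p) = 0"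
    and "(\<And>s. has_slopes F s (\<mu> (\<gamma> L s) (L, True)) (\<mu> (\<gamma> L s) (L, False))) \<Longrightarrow>
      (\<Sum>p\<in>jumps \<mu> L. jump \<mu> L p * \<theta> L p) = - (len L * \<mu> (\<gamma> L 0) (L, False)) - (F (len L) - F 0)"
proof -
  define J where "J = {s \<in> {0..<len L}. \<mu> (\<gamma> L s) (L, True) + \<mu> (\<gamma> L s) (L, False) \<noteq> 0}"
  have JK: "jumps \<mu> L = \<gamma> L ` J"
  proof
    show "\<gamma> L ` J \<subseteq> jumps \<mu> L" using \<gamma>_in[OF L] by (auto simp: jumps_def jump_def J_def)
    show "jumps \<mu> L \<subseteq> \<gamma> L ` J"
    proof
      fix x assume x: "x \<in> jumps \<mu> L"
      then have "x \<in> L" by (simp add: jumps_def)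
      then obtain s where "0 \<le> s" "s < len L" "\<gamma> L s = x" using obtain_lift[OF L] by blast
      then show "x \<in> \<gamma> L ` J" using x by (intro image_eqI[of _ _ s]) (auto simp: jumps_def jump_def J_def)
    qed
  qed
  have inj: "inj_on (\<gamma> L) J" using \<gamma>_inj_on[OF L] by (rule inj_on_subset) (auto simp: J_def)
  have per: "\<mu> (\<gamma> L (len L)) (L, False) = \<mu> (\<gamma> L 0) (L, False)" using \<gamma>_add_len[OF L, of 0] by simp
  note circ = flow_on_circle[OF chain_flow[OF c \<mu> L] len_pos[OF L] per J_def]
  show "finite (jumps \<mu> L)" using circ(1) JK by simp
  show "(\<Sum>p\<in>jumps \<mu> L. jump \<mu> L p) = 0"
    using circ(2) unfolding JK by (simp add: sum.reindex[OF inj] jump_def)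
  assume "\<And>s. has_slopes F s (\<mu> (\<gamma> L s) (L, True)) (\<mu> (\<gamma> L s) (L, False))"
  then have "(\<Sum>s\<in>J. (\<mu> (\<gamma> L s) (L, True) + \<mu> (\<gamma> L s) (L, False)) * s) = - (len L * \<mu> (\<gamma> L 0) (L, False)) - (F (len L) - F 0)"
    using circ(3) by blast
  moreover have "(\<Sum>s\<in>J. (\<mu> (\<gamma> L s) (L, True) + \<mu> (\<gamma> L s) (L, False)) * s) = (\<Sum>s\<in>J. jump \<mu> L (\<gamma> L s) * \<theta> L (\<gamma> L s))"
    using \<theta>_\<gamma>[OF L] by (intro sum.cong) (auto simp: J_def jump_def)
  ultimately show "(\<Sum>p\<in>jumps \<mu> L. jump \<mu> L p * \<theta> L p) = - (len L * \<mu> (\<gamma> L 0) (L, False)) - (F (len L) - F 0)"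
    unfolding JK by (simp add: sum.reindex[OF inj])
qed

lemma ord_chain:
  assumes "chain_slopes c \<mu>" "p \<in> \<Gamma>"
  shows "ord_at \<Gamma> (c p) p = - (\<Sum>L | L \<in> \<L> \<and> p \<in> L. jump \<mu> L p)"
  using ord_at_dslopes[of p "c p" "\<mu> p"] assms by (simp add: chain_slopes_def sum_dirs jump_def)

lemma sum_over_loops:
  assumes "finite K" "\<And>L. L \<in> T \<Longrightarrow> jumps \<mu> L \<subseteq> K" "T \<subseteq> \<L>"
  shows "(\<Sum>p\<in>K. (\<Sum>L | L \<in> T \<and> p \<in> L. jump \<mu> L p * u p)) = (\<Sum>L\<in>T. \<Sum>p\<in>jumps \<mu> L. jump \<mu> L p * u p)"
proof -
  have finT: "finite T" using assms(3) finite_loops finite_subset by blast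
  have "(\<Sum>p\<in>K. (\<Sum>L | L \<in> T \<and> p \<in> L. jump \<mu> L p * u p)) = (\<Sum>L\<in>T. \<Sum>p | p \<in> K \<and> p \<in> L. jump \<mu> L p * u p)"
    using sum.swap_restrict[OF assms(1) finT, of "\<lambda>p L. jump \<mu> L p * u p" "\<lambda>p L. p \<in> L"] .
  also have "\<dots> = (\<Sum>L\<in>T. \<Sum>p\<in>jumps \<mu> L. jump \<mu> L p * u p)"
    using assms(1,2) by (intro sum.cong sum.mono_neutral_right) (auto simp: jumps_def)
  finally show ?thesis .
qed

text \<open>Exchanging the summation over points with that over loops pairs a test function with the
  divisor loop by loop, so that the identities on a circle apply.\<close>

lemma chain_pairing:
  fixes D :: "'a \<Rightarrow>\<^sub>0 int"
  assumes c: "real_chain \<Gamma> c" and \<mu>: "chain_slopes c \<mu>" and D: "Poly_Mapping.keys D \<subseteq> \<Gamma>"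
    and ord: "\<And>p. p \<in> \<Gamma> \<Longrightarrow> of_int (Poly_Mapping.lookup D p) = ord_at \<Gamma> (c p) p"
  shows "(\<Sum>p\<in>Poly_Mapping.keys D. of_int (Poly_Mapping.lookup D p) * u p) =
    - (\<Sum>L\<in>\<L>. \<Sum>p\<in>jumps \<mu> L. jump \<mu> L p * u p)"
proof -
  define K where "K = Poly_Mapping.keys D \<union> (\<Union>L\<in>\<L>. jumps \<mu> L)"
  have fin: "finite K" using finite_loops chain_jumps(1)[OF c \<mu>] by (simp add: K_def)
  have KG: "K \<subseteq> \<Gamma>" using D union by (auto simp: K_def jumps_def)
  have "(\<Sum>p\<in>Poly_Mapping.keys D. of_int (Poly_Mapping.lookup D p) * u p) = (\<Sum>p\<in>K. of_int (Poly_Mapping.lookup D p) * u p)"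
    using fin by (intro sum.mono_neutral_left) (auto simp: K_def in_keys_iff)
  also have "\<dots> = (\<Sum>p\<in>K. - (\<Sum>L | L \<in> \<L> \<and> p \<in> L. jump \<mu> L p * u p))"
    using KG ord ord_chain[OF \<mu>] by (intro sum.cong) (auto simp: sum_distrib_right subset_iff)
  also have "\<dots> = - (\<Sum>L\<in>\<L>. \<Sum>p\<in>jumps \<mu> L. jump \<mu> L p * u p)"
    using sum_over_loops[OF fin, of \<L> \<mu> u] by (simp add: sum_negf K_def UN_upper le_supI2)
  finally show ?thesis .
qed

text \<open>The cycle condition only makes the jumps of all loops through \<open>p\<close> cancel.
  Summing it over the branches \<open>T\<close> attached to \<open>L\<close> at \<open>p\<close>,
  and using that the jumps on each loop add up to zero, isolates the jump on
  \<open>L\<close>.\<close>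

lemma cycle_jump:
  assumes h: "real_cycle \<Gamma> h" and \<mu>: "chain_slopes h \<mu>" and L: "L \<in> \<L>" "p \<in> L"
  shows "jump \<mu> L p = 0"
proof -
  have rc: "real_chain \<Gamma> h" using h by (simp add: real_cycle_def)
  have ord: "(\<Sum>N | N \<in> \<L> \<and> q \<in> N. jump \<mu> N q) = 0" if "q \<in> \<Gamma>" for q
    using ord_chain[OF \<mu> that] h that by (simp add: real_cycle_def)
  define T where "T = {M \<in> \<L>. M \<noteq> L \<and> att L M = p}"
  define K where "K = insert p (\<Union>M\<in>T. jumps \<mu> M)"
  have T: "T \<subseteq> \<L>" "finite T" using finite_loops by (auto simp: T_def)
  have fin: "finite K" using T chain_jumps(1)[OF rc \<mu>] by (auto simp: K_def)
  have p: "p \<in> \<Gamma>" using L loop_subset by blast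
  \<comment> \<open>A point of these branches other than \<open>p\<close> lies on loops of
    \<open>T\<close> only, so the full cycle condition at \<open>q\<close> is a sum over
    \<open>T\<close>.\<close>
  have other: "(\<Sum>M | M \<in> T \<and> q \<in> M. jump \<mu> M q) = 0" if q: "q \<in> K - {p}" for q
  proof -
    obtain M where M: "M \<in> T" "q \<in> M" using q by (auto simp: K_def jumps_def)
    then have M': "M \<in> \<L>" "M \<noteq> L" "att L M = p" by (auto simp: T_def)
    have rq: "\<rho> L q = p" using proj_att[OF L(1) M'(1) _ M(2)] M' by simp
    then have "q \<notin> L" using proj_id[OF L(1)] q by auto
    have "N \<in> T" if "N \<in> \<L>" "q \<in> N" for N
    proof -
      have "N \<noteq> L" using that \<open>q \<notin> L\<close> by blast
      then show ?thesis using proj_att[OF L(1) that(1) _ that(2)] rq that by (simp add: T_def)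
    qed
    then have "{M. M \<in> T \<and> q \<in> M} = {N. N \<in> \<L> \<and> q \<in> N}" using T(1) by blast
    then show ?thesis using ord[of q] M M' loop_subset by auto
  qed
  have "{M. M \<in> \<L> \<and> p \<in> M} = insert L {M. M \<in> T \<and> p \<in> M}"
    using L att_eq[OF L(1)] by (auto simp: T_def)
  moreover have "L \<notin> T" by (auto simp: T_def)
  ultimately have at_p: "(\<Sum>M | M \<in> T \<and> p \<in> M. jump \<mu> M p) = - jump \<mu> L p"
    using ord[OF p] T by simp
  have "(\<Sum>q\<in>K. (\<Sum>M | M \<in> T \<and> q \<in> M. jump \<mu> M q)) = (\<Sum>M\<in>T. \<Sum>q\<in>jumps \<mu> M. jump \<mu> M q)"
    using sum_over_loops[OF fin _ T(1), of \<mu> "\<lambda>_. 1"] by (auto simp: K_def)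
  also have "\<dots> = 0" using chain_jumps(2)[OF rc \<mu>] T by (intro sum.neutral) auto
  finally have "(\<Sum>M | M \<in> T \<and> p \<in> M. jump \<mu> M p) + (\<Sum>q\<in>K-{p}. (\<Sum>M | M \<in> T \<and> q \<in> M. jump \<mu> M q)) = 0"
    using fin by (subst (asm) sum.remove[of K p]) (auto simp: K_def)
  then show ?thesis using other at_p by simp
qed

text \<open>Says that \<open>h\<close> is the combination of the oriented loops with coefficients
  \<open>x L\<close>; in this way the first homology is identified with the functions on
  \<open>\<L>\<close>.\<close>

definition coefs :: "'a chain \<Rightarrow> ('a set \<Rightarrow> real) \<Rightarrow> bool" where
  "coefs h x \<longleftrightarrow> chain_slopes h (\<lambda>p d. sg (snd d) * x (fst d))"

lemma cycle_coefs:
  assumes h: "real_cycle \<Gamma> h" shows "\<exists>x. coefs h x"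
proof -
  have rc: "real_chain \<Gamma> h" using h by (simp add: real_cycle_def)
  obtain \<mu> where \<mu>: "chain_slopes h \<mu>" using real_chain_slopes[OF rc] by blast
  define x where "x L = \<mu> (\<gamma> L 0) (L, True)" for L
  have "\<mu> p d = sg (snd d) * x (fst d)" if d: "d \<in> dirs p" for p d
  proof -
    obtain L b where db: "d = (L, b)" by (metis surj_pair)
    have L: "L \<in> \<L>" "p \<in> L" using d db by (auto simp: in_dirs)
    have z: "jump \<mu> L (\<gamma> L s) = 0" for s using cycle_jump[OF h \<mu> L(1) \<gamma>_in[OF L(1)]] .
    obtain s where s: "0 \<le> s" "s < len L" "\<gamma> L s = p" using obtain_lift[OF L] by blast
    have "{s \<in> {0<..<len L}. \<mu> (\<gamma> L s) (L, True) + \<mu> (\<gamma> L s) (L, False) \<noteq> 0} = {}"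
      using z by (auto simp: jump_def)
    then have "\<mu> (\<gamma> L s) (L, True) = x L"
      using flow_step(1)[OF chain_flow[OF rc \<mu> L(1)] refl len_pos[OF L(1)] s(1,2)] by (simp add: x_def)
    then show ?thesis using z[of s] s(3) db by (cases b) (auto simp: sg_def jump_def)
  qed
  then have "coefs h x" using \<mu> unfolding coefs_def chain_slopes_def by (auto intro: has_dslopes_cong)
  then show ?thesis by blast
qed

lemma chain_slopes_lin_comb:
  assumes "\<And>i. i < k \<Longrightarrow> chain_slopes (v i) (\<mu> i)"
  shows "chain_slopes (lin_comb k x v) (\<lambda>p d. \<Sum>i<k. x i * \<mu> i p d)"
  unfolding chain_slopes_def
proof (intro ballI conjI)
  fix p assume p: "p \<in> \<Gamma>"
  show "lin_comb k x v p p = 0" using assms p by (simp add: lin_comb_def chain_slopes_def)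
  have "\<exists>r>0. \<forall>i\<in>{..<k}. \<forall>t. 0 < t \<and> t < r \<longrightarrow> (\<forall>d\<in>dirs p. v i p (pt p d t) = v i p p + \<mu> i p d * t)"
  proof (intro uniform_radius)
    fix i assume "i \<in> {..<k}"
    then have "has_dslopes (v i p) p (\<mu> i p)" using assms[of i] p by (auto simp: chain_slopes_def)
    then show "\<exists>r>0. \<forall>t. 0 < t \<and> t < r \<longrightarrow> (\<forall>d\<in>dirs p. v i p (pt p d t) = v i p p + \<mu> i p d * t)"
      unfolding has_dslopes_def by fastforce
  qed simp
  then obtain r where r: "r > 0" "\<And>i t d. i < k \<Longrightarrow> 0 < t \<Longrightarrow> t < r \<Longrightarrow> d \<in> dirs p \<Longrightarrow> v i p (pt p d t) = v i p p + \<mu> i p d * t"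
    by (metis lessThan_iff)
  show "has_dslopes (lin_comb k x v p) p (\<lambda>d. \<Sum>i<k. x i * \<mu> i p d)"
  proof (rule has_dslopesI)
    fix d assume d: "d \<in> dirs p"
    have "lin_comb k x v p (pt p d t) = lin_comb k x v p p + (\<Sum>i<k. x i * \<mu> i p d) * t" if "0 < t" "t < r" for t
    proof -
      have "lin_comb k x v p (pt p d t) = (\<Sum>i<k. x i * v i p p + x i * \<mu> i p d * t)"
        unfolding lin_comb_def using r(2)[OF _ that d] by (intro sum.cong) (auto simp: algebra_simps)
      then show ?thesis by (simp add: lin_comb_def sum.distrib sum_distrib_right)
    qed
    then show "\<exists>r>0. \<forall>t. 0 < t \<and> t < r \<longrightarrow> lin_comb k x v p (pt p d t) = lin_comb k x v p p + (\<Sum>i<k. x i * \<mu> i p d) * t"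
      using r(1) by blast
  qed
qed

lemma coefs_lin_comb:
  assumes "\<And>i. i < k \<Longrightarrow> coefs (v i) (w i)"
  shows "coefs (lin_comb k x v) (\<lambda>L. \<Sum>i<k. x i * w i L)"
proof -
  have "(\<lambda>p d. \<Sum>i<k. x i * (sg (snd d) * w i (fst d))) = (\<lambda>(p::'a) d. sg (snd d) * (\<Sum>i<k. x i * w i (fst d)))"
    by (auto simp: fun_eq_iff sum_distrib_left algebra_simps)
  then show ?thesis
    using chain_slopes_lin_comb[of k v "\<lambda>i p d. sg (snd d) * w i (fst d)" x] assms unfolding coefs_def by simp
qed

lemma zero_chain_iff:
  assumes "coefs h x" shows "zero_chain \<Gamma> h \<longleftrightarrow> (\<forall>L\<in>\<L>. x L = 0)"
proof
  assume z: "zero_chain \<Gamma> h"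
  show "\<forall>L\<in>\<L>. x L = 0"
  proof
    fix L assume L: "L \<in> \<L>"
    define p where "p = \<gamma> L 0"
    have p: "p \<in> \<Gamma>" "(L, True) \<in> dirs p" using L \<gamma>_in loop_subset by (auto simp: p_def in_dirs)
    have "\<forall>\<^sub>F q in at p within \<Gamma>. h p q = 0" using z p by (simp add: zero_chain_def)
    then obtain r where r: "r > 0" "\<And>t. 0 < t \<Longrightarrow> t < r \<Longrightarrow> h p (pt p (L, True) t) = 0"
      unfolding eventually_near[OF p(1)] using p(2) by blast
    have hp: "h p p = 0" "has_dslopes (h p) p (\<lambda>d. sg (snd d) * x (fst d))"
      using assms p by (auto simp: coefs_def chain_slopes_def)
    then obtain r' where r': "r' > 0" "\<And>t. t \<in> {0..<r'} \<Longrightarrow> h p (pt p (L, True) t) = h p p + sg True * x L * t"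
      using p(2) unfolding has_dslopes_def by fastforce
    define t where "t = min r r' / 2"
    have "0 < t" "t < r" "t < r'" using r r' by (auto simp: t_def)
    then show "x L = 0" using r(2)[of t] r'(2)[of t] hp by (simp add: sg_def)
  qed
next
  assume x: "\<forall>L\<in>\<L>. x L = 0"
  show "zero_chain \<Gamma> h"
    unfolding zero_chain_def
  proof
    fix p assume p: "p \<in> \<Gamma>"
    have hp: "h p p = 0" "has_dslopes (h p) p (\<lambda>d. sg (snd d) * x (fst d))"
      using assms p by (auto simp: coefs_def chain_slopes_def)
    then obtain r' where r': "r' > 0" "\<And>d t. d \<in> dirs p \<Longrightarrow> t \<in> {0..<r'} \<Longrightarrow> h p (pt p d t) = h p p + sg (snd d) * x (fst d) * t"
      unfolding has_dslopes_def by fastforce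
    then show "\<forall>\<^sub>F q in at p within \<Gamma>. h p q = 0"
      unfolding eventually_near[OF p] using hp(1) x dirs_imp by (intro exI[of _ r']) force
  qed
qed

section \<open>Chains from quasi-periodic functions on the loops\<close>

definition \<delta> :: "'a set \<Rightarrow> 'a \<Rightarrow> 'a \<Rightarrow> real" where
  "\<delta> L p q = (\<theta> L q - \<theta> L p) - len L * of_int (round ((\<theta> L q - \<theta> L p) / len L))"

text \<open>A function on the line that changes by a constant over each period has well defined
  local increments on the circle, although it has no values there; this produces chains that are not
  gradients. Here \<open>\<delta> L p q\<close> is the shortest signed displacement between the
  projections of \<open>p\<close> and \<open>q\<close> to \<open>L\<close>.\<close>

definition increments :: "('a set \<Rightarrow> real \<Rightarrow> real) \<Rightarrow> 'a chain" where
  "increments F p q = (\<Sum>L\<in>\<L>. F L (\<theta> L p + \<delta> L p q) - F L (\<theta> L p))"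

lemma \<theta>_const:
  assumes "L \<in> \<L>" "M \<in> \<L>" "L \<noteq> M" "p \<in> M" "q \<in> M" shows "\<theta> L p = \<theta> L q"
  using assms proj_att by (metis \<theta>_cong)

lemma quasi_periodic_int:
  fixes F :: "real \<Rightarrow> real"
  assumes "\<And>s. F (s + l) = F s + (X::real)"
  shows "F (s + of_int k * l) = F s + of_int k * X"
proof -
  have nat: "F (s + real n * l) = F s + real n * X" for s n
  proof (induction n)
    case (Suc n)
    have "s + real (Suc n) * l = (s + real n * l) + l" by (simp add: algebra_simps)
    then have "F (s + real (Suc n) * l) = F (s + real n * l) + X" using assms by metis
    then show ?case using Suc by (simp add: algebra_simps)
  qed auto
  show ?thesis
  proof (cases "k \<ge> 0")
    case True
    then show ?thesis using nat[of s "nat k"] by simp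
  next
    case False
    then show ?thesis using nat[of "s + of_int k * l" "nat (-k)"] by simp
  qed
qed

text \<open>The other loops contribute nothing, because both points project to the same point of
  each of them; on \<open>L\<close> the choice of the lift is immaterial by
  quasi-periodicity.\<close>

lemma increments_eq:
  assumes per: "\<And>L s. L \<in> \<L> \<Longrightarrow> F L (s + len L) = F L s + X L" and L: "L \<in> \<L>" and \<tau>: "\<bar>\<tau>\<bar> < len L / 2"
  shows "increments F (\<gamma> L s) (\<gamma> L (s + \<tau>)) = F L (s + \<tau>) - F L s"
proof -
  define p q where "p = \<gamma> L s" and "q = \<gamma> L (s + \<tau>)"
  have pq: "p \<in> L" "q \<in> L" using \<gamma>_in[OF L] by (auto simp: p_def q_def)
  have l: "0 < len L" using len_pos[OF L] .
  have "F M (\<theta> M p + \<delta> M p q) - F M (\<theta> M p) = 0" if "M \<in> \<L> - {L}" for M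
    using \<theta>_const[of M L p q] that L pq by (simp add: \<delta>_def)
  then have "increments F p q = F L (\<theta> L p + \<delta> L p q) - F L (\<theta> L p)"
    unfolding increments_def using finite_loops L by (simp add: sum.remove)
  moreover obtain k :: int where k: "\<theta> L p = s + of_int k * len L"
    using \<gamma>_\<theta>[OF L pq(1)] \<gamma>_eq_iff[OF L] by (metis p_def)
  moreover obtain k' :: int where k': "\<theta> L q = s + \<tau> + of_int k' * len L"
    using \<gamma>_\<theta>[OF L pq(2)] \<gamma>_eq_iff[OF L] by (metis q_def)
  moreover have "\<delta> L p q = \<tau>"
  proof -
    have "(\<theta> L q - \<theta> L p) / len L = \<tau> / len L + of_int (k' - k)"
      using l k k' by (simp add: field_simps)
    moreover have "\<bar>\<tau> / len L\<bar> < 1 / 2" using \<tau> l by (simp add: abs_divide field_simps)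
    ultimately have r: "round ((\<theta> L q - \<theta> L p) / len L) = k' - k" by (intro round_unique') simp
    show ?thesis unfolding \<delta>_def r using k k' by (simp add: algebra_simps)
  qed
  moreover have "F L (s + of_int k * len L + \<tau>) = F L (s + \<tau>) + of_int k * X L"
    using quasi_periodic_int[of "F L" "len L" "X L" "s + \<tau>" k] per[OF L] by (simp add: algebra_simps)
  moreover have "F L (s + of_int k * len L) = F L s + of_int k * X L"
    using quasi_periodic_int[of "F L" "len L" "X L" s k] per[OF L] by simp
  ultimately show ?thesis by (simp add: p_def q_def)
qed

lemma increments_chain:
  assumes per: "\<And>L s. L \<in> \<L> \<Longrightarrow> F L (s + len L) = F L s + X L"
    and sl: "\<And>L s. L \<in> \<L> \<Longrightarrow> 0 \<le> s \<Longrightarrow> s < len L \<Longrightarrow> has_slopes (F L) s (m L True s) (m L False s)"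
  shows "real_chain \<Gamma> (increments F)" "chain_slopes (increments F) (\<lambda>p d. m (fst d) (snd d) (\<theta> (fst d) p))"
proof -
  define c where "c = increments F"
  have inc: "c (\<gamma> L s) (\<gamma> L (s + \<tau>)) = F L (s + \<tau>) - F L s" if "L \<in> \<L>" "\<bar>\<tau>\<bar> < len L / 2" for L s \<tau>
    using increments_eq[of F X L \<tau> s] per that by (simp add: c_def)
  have c0: "c p p = 0" if p: "p \<in> \<Gamma>" for p by (simp add: c_def increments_def \<delta>_def)
  have near: "c p (pt p (L, b) t) = F L (\<theta> L p + sg b * t) - F L (\<theta> L p)"
    if "(L, b) \<in> dirs p" "\<bar>t\<bar> < len L / 2" for p L b t
  proof -
    have L: "L \<in> \<L>" "p \<in> L" using that by (auto simp: in_dirs)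
    have "\<bar>sg b * t\<bar> < len L / 2" using that(2) by (simp add: sg_def)
    then show ?thesis using inc[OF L(1), of "sg b * t" "\<theta> L p"] \<gamma>_\<theta>[OF L] by (simp add: pt_def)
  qed
  show cs: "chain_slopes (increments F) (\<lambda>p d. m (fst d) (snd d) (\<theta> (fst d) p))"
    unfolding chain_slopes_def c_def[symmetric]
  proof (intro ballI conjI c0 has_dslopesI)
    fix p d assume p: "p \<in> \<Gamma>" and d: "d \<in> dirs p"
    obtain L b where db: "d = (L, b)" by (metis surj_pair)
    have L: "L \<in> \<L>" "p \<in> L" using d db by (auto simp: in_dirs)
    obtain r where r: "r > 0" "\<And>t. 0 \<le> t \<Longrightarrow> t < r \<Longrightarrow> F L (\<theta> L p + t) = F L (\<theta> L p) + m L True (\<theta> L p) * t \<and>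
        F L (\<theta> L p - t) = F L (\<theta> L p) + m L False (\<theta> L p) * t"
      using sl[OF L(1) \<theta>(1,2)[OF L(1) p]] unfolding has_slopes_def by blast
    have l: "0 < len L" using len_pos[OF L(1)] .
    have "c p (pt p d t) = c p p + m (fst d) (snd d) (\<theta> (fst d) p) * t" if t: "0 < t" "t < min r (len L / 2)" for t
      using near[of L b p t] d db t r(2)[of t] c0[OF p] by (cases b) (auto simp: sg_def)
    then show "\<exists>r>0. \<forall>t. 0 < t \<and> t < r \<longrightarrow> c p (pt p d t) = c p p + m (fst d) (snd d) (\<theta> (fst d) p) * t"
      using r(1) l by (intro exI[of _ "min r (len L / 2)"]) auto
  qed
  show "real_chain \<Gamma> (increments F)"
    unfolding real_chain_def
  proof (intro ballI conjI)
    fix p assume p: "p \<in> \<Gamma>"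
    show "increments F p p = 0" using c0[OF p] by (simp add: c_def)
    have "has_dslopes (increments F p) p (\<lambda>d. m (fst d) (snd d) (\<theta> (fst d) p))"
      using cs p by (simp add: chain_slopes_def)
    then show "\<exists>n m. local_slopes \<Gamma> (increments F p) p n m" using local_slopes_of_dslopes[OF p] by blast
    obtain r where r: "good_radius p r" using good_radius_ex by blast
    show "\<forall>\<^sub>F q in at p within \<Gamma>. \<forall>\<^sub>F x in at q within \<Gamma>. increments F q x = increments F p x - increments F p q"
    proof (rule eventually_nearI[OF p])
      fix d assume d: "d \<in> dirs p"
      obtain L b where db: "d = (L, b)" by (metis surj_pair)
      have L: "L \<in> \<L>" "p \<in> L" using d db by (auto simp: in_dirs)
      have rl: "r \<le> len L / 4" "0 < r" using r L by (auto simp: good_radius_def)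
      have "\<forall>\<^sub>F x in at q within \<Gamma>. c q x = c p x - c p q" if t: "0 < t" "t < r" and q: "q = pt p d t" for q t
      proof (rule eventually_nearI)
        show "q \<in> \<Gamma>" using pt_in_graph[OF d] q by simp
        fix e assume "e \<in> dirs q"
        then obtain b' where e: "e = (L, b')" using dirs_pt[of p r L b t] r d db t q by auto
        have ql: "q = \<gamma> L (\<theta> L p + sg b * t)" by (simp add: q db pt_def)
        have "c q (pt q e u) = c p (pt q e u) - c p q" if u: "0 < u" "u < r" for u
        proof -
          define s where "s = \<theta> L p + sg b * t"
          have x: "pt q e u = \<gamma> L (s + sg b' * u)" using pt_lift[OF L(1), of s q b' u] ql by (simp add: e s_def)
          have "c q (pt q e u) = F L (s + sg b' * u) - F L s"
            unfolding x unfolding ql s_def[symmetric] using u rl by (intro inc[OF L(1)]) (auto simp: sg_def)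
          moreover have "c p q = F L s - F L (\<theta> L p)"
            using near[of L b p t] d db t rl q by (simp add: s_def)
          moreover have "c (\<gamma> L (\<theta> L p)) (\<gamma> L (\<theta> L p + (sg b * t + sg b' * u))) = F L (\<theta> L p + (sg b * t + sg b' * u)) - F L (\<theta> L p)"
            using u t rl by (intro inc[OF L(1)]) (auto simp: sg_def abs_if)
          then have "c p (pt q e u) = F L (s + sg b' * u) - F L (\<theta> L p)"
            using \<gamma>_\<theta>[OF L] unfolding x s_def by (simp add: add.assoc)
          ultimately show ?thesis by simp
        qed
        then show "\<exists>r>0. \<forall>u. 0 < u \<and> u < r \<longrightarrow> c q (pt q e u) = c p (pt q e u) - c p q"
          using rl(2) by blast
      qed
      then show "\<exists>r>0. \<forall>t. 0 < t \<and> t < r \<longrightarrow> (\<forall>\<^sub>F x in at (pt p d t) within \<Gamma>.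
          increments F (pt p d t) x = increments F p x - increments F p (pt p d t))"
        using rl(2) unfolding c_def by blast
    qed
  qed
qed

lemma cycle_exists:
  "\<exists>h. real_cycle \<Gamma> h \<and> coefs h x"
proof -
  define h where "h = increments (\<lambda>L s. x L * s)"
  have per: "x L * (s + len L) = x L * s + x L * len L" for L s by (simp add: algebra_simps)
  have sl: "has_slopes ((*) (x L)) s (sg True * x L) (sg False * x L)" for L s
    unfolding has_slopes_def by (intro exI[of _ 1]) (simp add: sg_def algebra_simps)
  have h: "real_chain \<Gamma> h" "chain_slopes h (\<lambda>p d. sg (snd d) * x (fst d))"
    using increments_chain[of "\<lambda>L s. x L * s" "\<lambda>L. x L * len L" "\<lambda>L b s. sg b * x L", OF per sl]
    by (simp_all add: h_def)
  have "ord_at \<Gamma> (h p) p = 0" if "p \<in> \<Gamma>" for p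
    using ord_chain[OF h(2) that] by (simp add: jump_def sg_def)
  then show ?thesis using h by (intro exI[of _ h]) (auto simp: real_cycle_def coefs_def)
qed

lemma independent_cycles_iff:
  assumes "\<And>i. i < k \<Longrightarrow> real_cycle \<Gamma> (v i) \<and> coefs (v i) (w i)"
  shows "independent_cycles \<Gamma> k v \<longleftrightarrow>
    (\<forall>x. (\<forall>L\<in>\<L>. (\<Sum>i<k. x i * w i L) = 0) \<longrightarrow> (\<forall>i<k. x i = 0))"
proof -
  have "zero_chain \<Gamma> (lin_comb k x v) \<longleftrightarrow> (\<forall>L\<in>\<L>. (\<Sum>i<k. x i * w i L) = 0)" for x
    using zero_chain_iff[OF coefs_lin_comb[of k v w x]] assms by blast
  then show ?thesis using assms by (simp add: independent_cycles_def)
qed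

lemma independent_cycles_le:
  assumes "independent_cycles \<Gamma> k v" shows "k \<le> card \<L>"
proof (rule ccontr)
  assume "\<not> k \<le> card \<L>"
  have "\<forall>i<k. \<exists>w. real_cycle \<Gamma> (v i) \<and> coefs (v i) w"
    using assms cycle_coefs by (auto simp: independent_cycles_def)
  then obtain w where w: "\<And>i. i < k \<Longrightarrow> real_cycle \<Gamma> (v i) \<and> coefs (v i) (w i)" by metis
  obtain x where "\<exists>i\<in>{..<k}. x i \<noteq> 0" "\<forall>L\<in>\<L>. (\<Sum>i<k. x i * w i L) = 0"
    using underdetermined_system[OF finite_loops, of "{..<k}" w] \<open>\<not> k \<le> card \<L>\<close> by auto
  moreover have "(\<forall>L\<in>\<L>. (\<Sum>i<k. y i * w i L) = 0) \<Longrightarrow> \<forall>i<k. y i = 0" for y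
    using assms independent_cycles_iff[of k v w] w by blast
  ultimately show False by blast
qed

lemma loop_cycles_independent:
  assumes e: "bij_betw e {..<k} T" "T \<subseteq> \<L>"
  shows "\<exists>v. independent_cycles \<Gamma> k v \<and> (\<forall>i<k. coefs (v i) (\<lambda>L. if L = e i then 1 else 0))"
proof -
  obtain v where v: "\<And>i. real_cycle \<Gamma> (v i) \<and> coefs (v i) (\<lambda>L. if L = e i then 1 else 0)"
    using choice[of "\<lambda>i h. real_cycle \<Gamma> h \<and> coefs h (\<lambda>L. if L = e i then 1 else 0)"] cycle_exists by blast
  have "independent_cycles \<Gamma> k v"
    unfolding independent_cycles_iff[OF v]
  proof (intro allI impI)
    fix x :: "nat \<Rightarrow> real" and i assume x: "\<forall>L\<in>\<L>. (\<Sum>i<k. x i * (if L = e i then 1 else 0)) = 0" and i: "i < k"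
    have "e i \<in> \<L>" using e i by (auto simp: bij_betw_def)
    then have "(\<Sum>j<k. x j * (if e i = e j then 1 else 0)) = 0" using x by blast
    moreover have "(\<Sum>j<k. x j * (if e i = e j then 1 else 0)) = (\<Sum>j<k. if j = i then x j else 0)"
      using e i by (intro sum.cong) (auto simp: bij_betw_def inj_on_def)
    ultimately show "x i = 0" using i by simp
  qed
  then show ?thesis using v by blast
qed

lemma genus_eq: "genus \<Gamma> = card \<L>"
  unfolding genus_def
proof (rule Greatest_equality)
  obtain e where "bij_betw e {..<card \<L>} \<L>"
    using ex_bij_betw_nat_finite[OF finite_loops] by (auto simp: lessThan_atLeast0)
  then show "\<exists>v. independent_cycles \<Gamma> (card \<L>) v" using loop_cycles_independent by blast
qed (use independent_cycles_le in blast)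

end

section \<open>Pairing divisors with functions\<close>

text \<open>Integration of a function against a divisor. The degree and the Abel-Jacobi coordinates
  are both of this form, which makes their additivity one fact.\<close>

definition pairing :: "('a \<Rightarrow> real) \<Rightarrow> ('a \<Rightarrow>\<^sub>0 int) \<Rightarrow> real" where
  "pairing u D = (\<Sum>p\<in>Poly_Mapping.keys D. of_int (Poly_Mapping.lookup D p) * u p)"

lemma pairing_superset:
  assumes "finite K" "Poly_Mapping.keys D \<subseteq> K"
  shows "pairing u D = (\<Sum>p\<in>K. of_int (Poly_Mapping.lookup D p) * u p)"
  unfolding pairing_def using assms by (intro sum.mono_neutral_left) (auto simp: in_keys_iff)

lemma pairing_add: "pairing u (D + E) = pairing u D + pairing u E"
proof -
  define K where "K = Poly_Mapping.keys D \<union> Poly_Mapping.keys E"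
  have K: "finite K" "Poly_Mapping.keys D \<subseteq> K" "Poly_Mapping.keys E \<subseteq> K" "Poly_Mapping.keys (D + E) \<subseteq> K"
    using keys_add[of D E] by (auto simp: K_def)
  show ?thesis unfolding pairing_superset[OF K(1,2)] pairing_superset[OF K(1,3)] pairing_superset[OF K(1,4)]
    by (simp add: lookup_add sum.distrib algebra_simps)
qed

lemma pairing_diff: "pairing u (D - E) = pairing u D - pairing u E"
  using pairing_add[of u "D - E" E] by simp

lemma pairing_0: "pairing u 0 = 0"
  by (simp add: pairing_def)

lemma pairing_single: "pairing u (Poly_Mapping.single p n) = of_int n * u p"
  by (cases "n = 0") (auto simp: pairing_def)

lemma pairing_sum: "pairing u (\<Sum>i\<in>I. f i) = (\<Sum>i\<in>I. pairing u (f i))"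
  by (induction I rule: infinite_finite_induct) (auto simp: pairing_0 pairing_add)

lemma pairing_one: "pairing (\<lambda>_. 1) D = of_int (div_degree D)"
  by (simp add: pairing_def div_degree_def)

lemma div_degree_add: "div_degree (D + E) = div_degree D + div_degree E"
  using pairing_add[of "\<lambda>_. 1" D E] unfolding pairing_one by linarith

lemma div_degree_diff: "div_degree (D - E) = div_degree D - div_degree E"
  using pairing_diff[of "\<lambda>_. 1" D E] unfolding pairing_one by linarith

lemma div_degree_single: "div_degree (Poly_Mapping.single p n) = n"
  using pairing_single[of "\<lambda>_. 1" p n] unfolding pairing_one by simp

lemma div_degree_sum:
  fixes f :: "'a \<Rightarrow> ('b \<Rightarrow>\<^sub>0 int)"
  shows "div_degree (\<Sum>i\<in>I. f i) = (\<Sum>i\<in>I. div_degree (f i))"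
proof -
  have "div_degree (0 :: 'b \<Rightarrow>\<^sub>0 int) = 0" by (simp add: div_degree_def)
  then show ?thesis by (induction I rule: infinite_finite_induct) (simp_all add: div_degree_add)
qed

lemma keys_sum_subset:
  assumes "\<And>i. i \<in> I \<Longrightarrow> Poly_Mapping.keys (f i) \<subseteq> S"
  shows "Poly_Mapping.keys (\<Sum>i\<in>I. f i) \<subseteq> S"
  using assms
proof (induction I rule: infinite_finite_induct)
  case (insert i I)
  then show ?case using keys_add[of "f i" "sum f I"] by auto
qed auto

lemma keys_diff_subset:
  fixes D E :: "'a \<Rightarrow>\<^sub>0 int"
  assumes "Poly_Mapping.keys D \<subseteq> S" "Poly_Mapping.keys E \<subseteq> S"
  shows "Poly_Mapping.keys (D - E) \<subseteq> S"
  using assms keys_diff[of D E] by blast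

lemma keys_add_subset:
  fixes D E :: "'a \<Rightarrow>\<^sub>0 int"
  assumes "Poly_Mapping.keys D \<subseteq> S" "Poly_Mapping.keys E \<subseteq> S"
  shows "Poly_Mapping.keys (D + E) \<subseteq> S"
  using assms keys_add[of D E] by blast

lemma effective_add: "effective D \<Longrightarrow> effective E \<Longrightarrow> effective (D + E)"
  by (auto simp: effective_def lookup_add)

lemma effective_single: "0 \<le> n \<Longrightarrow> effective (Poly_Mapping.single p n)"
  by (auto simp: effective_def lookup_single when_def)

lemma effective_sum: "(\<And>i. i \<in> I \<Longrightarrow> effective (f i)) \<Longrightarrow> effective (\<Sum>i\<in>I. f i)"
proof (induction I rule: infinite_finite_induct)
  case (insert i I)
  then show ?case by (simp add: effective_add)
qed (auto simp: effective_def)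

lemma effective_degree_0:
  assumes "effective E" "div_degree E = 0" shows "E = 0"
proof -
  have "Poly_Mapping.lookup E p = 0" if "p \<in> Poly_Mapping.keys E" for p
    using sum_nonneg_eq_0_iff[of "Poly_Mapping.keys E" "Poly_Mapping.lookup E"] assms that
    by (auto simp: effective_def div_degree_def)
  then show ?thesis by (metis in_keys_iff keys_eq_empty all_not_in_conv)
qed

section \<open>The Abel-Jacobi map of a tree of loops\<close>

context loop_tree
begin

text \<open>The \<open>L\<close>-component of the Abel-Jacobi map; its residue modulo
  \<open>len L\<close> is an invariant of the divisor class.\<close>

definition \<Phi> :: "'a set \<Rightarrow> ('a \<Rightarrow>\<^sub>0 int) \<Rightarrow> real" where
  "\<Phi> L D = pairing (\<theta> L) D"

definition eqm :: "'a set \<Rightarrow> real \<Rightarrow> real \<Rightarrow> bool" where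
  "eqm L a b \<longleftrightarrow> (\<exists>k::int. a - b = of_int k * len L)"

lemma eqm_refl [simp]: "eqm L a a"
  unfolding eqm_def by (intro exI[of _ 0]) simp

lemma eqm_sym: "eqm L a b \<Longrightarrow> eqm L b a"
  unfolding eqm_def by (metis minus_diff_eq mult_minus_left of_int_minus)

lemma eqm_add: "eqm L a b \<Longrightarrow> eqm L c d \<Longrightarrow> eqm L (a + c) (b + d)"
proof -
  assume "eqm L a b" "eqm L c d"
  then obtain k l :: int where "a - b = of_int k * len L" "c - d = of_int l * len L" unfolding eqm_def by blast
  then show ?thesis unfolding eqm_def by (intro exI[of _ "k + l"]) (simp add: algebra_simps)
qed

lemma eqm_diff: "eqm L a b \<Longrightarrow> eqm L c d \<Longrightarrow> eqm L (a - c) (b - d)"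
proof -
  assume "eqm L a b" "eqm L c d"
  then obtain k l :: int where "a - b = of_int k * len L" "c - d = of_int l * len L" unfolding eqm_def by blast
  then show ?thesis unfolding eqm_def by (intro exI[of _ "k - l"]) (simp add: algebra_simps)
qed

lemma eqm_trans: "eqm L a b \<Longrightarrow> eqm L b c \<Longrightarrow> eqm L a c"
  using eqm_add[of L a b b c] eqm_diff[of L "a + b" "b + c" b b] by simp

lemma obtain_point:
  assumes "L \<in> \<L>" obtains c where "c \<in> L" "eqm L (\<theta> L c) y"
proof -
  have "\<gamma> L (\<theta> L (\<gamma> L y)) = \<gamma> L y" using \<gamma>_\<theta> \<gamma>_in assms by blast
  then obtain k :: int where "\<theta> L (\<gamma> L y) = y + of_int k * len L" using \<gamma>_eq_iff[OF assms] by blast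
  then have "eqm L (\<theta> L (\<gamma> L y)) y" unfolding eqm_def by (intro exI[of _ k]) simp
  then show ?thesis using that \<gamma>_in[OF assms] by blast
qed

text \<open>If \<open>y\<close> is not \<open>p\<close>, exactly one loop through \<open>p\<close>
  projects \<open>y\<close> elsewhere, by \<open>unique_loop_towards\<close>. This deficit of one is
  what recovers the coefficient at \<open>p\<close> from the pushed-forward divisors.\<close>

lemma card_loops_towards:
  assumes "p \<in> \<Gamma>" "y \<in> \<Gamma>"
  shows "int (card {L \<in> \<L>. p \<in> L \<and> \<rho> L y = p}) = int (card {L \<in> \<L>. p \<in> L}) - (if y = p then 0 else 1)"
proof (cases "y = p")
  case True
  then have "{L \<in> \<L>. p \<in> L \<and> \<rho> L y = p} = {L \<in> \<L>. p \<in> L}" using proj_id by auto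
  then show ?thesis using True by simp
next
  case False
  obtain M where M: "M \<in> \<L>" "p \<in> M" "\<rho> M y \<noteq> p" "\<And>L. L \<in> \<L> \<Longrightarrow> p \<in> L \<Longrightarrow> \<rho> L y \<noteq> p \<Longrightarrow> L = M"
    using unique_loop_towards[OF assms False] by blast
  have eq: "{L \<in> \<L>. p \<in> L} = insert M {L \<in> \<L>. p \<in> L \<and> \<rho> L y = p}" using M by blast
  have "finite {L \<in> \<L>. p \<in> L \<and> \<rho> L y = p}" using finite_loops by simp
  then have "card {L \<in> \<L>. p \<in> L} = Suc (card {L \<in> \<L>. p \<in> L \<and> \<rho> L y = p})"
    unfolding eq using M(3) by (subst card_insert_disjoint) auto
  then show ?thesis using False by simp
qed

text \<open>Along \<open>L\<close> the chain \<open>c\<close> has the primitive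
  \<open>f + x L * s\<close>, where \<open>f\<close> is a potential of \<open>c - h\<close>; it
  increases by \<open>x L * len L\<close> per turn. The moment formula of
  \<open>flow_on_circle\<close> gives the coordinate, and the integral slope at the base point
  contributes the multiple of \<open>len L\<close>.\<close>

lemma jacobian_class_imp:
  assumes h: "real_cycle \<Gamma> h" and x: "coefs h x" and D: "D \<in> jacobian_class \<Gamma> h"
  shows "Poly_Mapping.keys D \<subseteq> \<Gamma> \<and> div_degree D = 0 \<and> (\<forall>L\<in>\<L>. eqm L (\<Phi> L D) (x L * len L))"
proof -
  obtain c where c: "integer_chain \<Gamma> c"
    and ord: "\<And>p. p \<in> \<Gamma> \<Longrightarrow> of_int (Poly_Mapping.lookup D p) = ord_at \<Gamma> (c p) p"
    and grad: "gradient_chain \<Gamma> (\<lambda>p q. c p q - h p q)" and keys: "Poly_Mapping.keys D \<subseteq> \<Gamma>"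
    using D unfolding jacobian_class_def by auto
  have rc: "real_chain \<Gamma> c" using c by (simp add: integer_chain_def)
  obtain \<mu> where \<mu>: "chain_slopes c \<mu>" and int: "\<And>p d. p \<in> \<Gamma> \<Longrightarrow> d \<in> dirs p \<Longrightarrow> \<mu> p d \<in> \<int>"
    using integer_chain_slopes[OF c] by blast
  obtain f where f: "\<And>p. p \<in> \<Gamma> \<Longrightarrow> \<forall>\<^sub>F q in at p within \<Gamma>. c p q - h p q = f q - f p"
    using grad unfolding gradient_chain_def by blast
  have pair: "pairing u D = - (\<Sum>L\<in>\<L>. \<Sum>p\<in>jumps \<mu> L. jump \<mu> L p * u p)" for u
    unfolding pairing_def by (rule chain_pairing[OF rc \<mu> keys ord])
  have "real_of_int (div_degree D) = 0"
    using pair[of "\<lambda>_. 1"] chain_jumps(2)[OF rc \<mu>] by (simp add: pairing_one)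
  then have deg: "div_degree D = 0" by simp
  have "eqm L (\<Phi> L D) (x L * len L)" if L: "L \<in> \<L>" for L
  proof -
    \<comment> \<open>On a loop \<open>M\<close> other than \<open>L\<close> the function
      \<open>\<theta> L\<close> is constant, and the jumps on \<open>M\<close> cancel.\<close>
    have "(\<Sum>p\<in>jumps \<mu> M. jump \<mu> M p * \<theta> L p) = 0" if M: "M \<in> \<L> - {L}" for M
    proof -
      have "(\<Sum>p\<in>jumps \<mu> M. jump \<mu> M p * \<theta> L p) = (\<Sum>p\<in>jumps \<mu> M. jump \<mu> M p * \<theta> L (\<gamma> M 0))"
        using \<theta>_const[OF L, of M] M \<gamma>_in[of M] by (intro sum.cong) (auto simp: jumps_def)
      also have "\<dots> = 0" using chain_jumps(2)[OF rc \<mu>, of M] M by (simp add: sum_distrib_right[symmetric])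
      finally show ?thesis .
    qed
    then have 1: "\<Phi> L D = - (\<Sum>p\<in>jumps \<mu> L. jump \<mu> L p * \<theta> L p)"
      unfolding \<Phi>_def pair using finite_loops L by (simp add: sum.remove)
    define F where "F s = f (\<gamma> L s) + x L * s" for s
    have sl: "has_slopes F s (\<mu> (\<gamma> L s) (L, True)) (\<mu> (\<gamma> L s) (L, False))" for s
    proof -
      define p where "p = \<gamma> L s"
      have p: "p \<in> \<Gamma>" "\<And>b. (L, b) \<in> dirs p" using L \<gamma>_in loop_subset by (auto simp: p_def in_dirs)
      obtain r1 where r1: "r1 > 0" "\<And>d t. d \<in> dirs p \<Longrightarrow> 0 < t \<Longrightarrow> t < r1 \<Longrightarrow>
          c p (pt p d t) - h p (pt p d t) = f (pt p d t) - f p"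
        using f[OF p(1)] unfolding eventually_near[OF p(1)] by blast
      have "c p p = 0" "has_dslopes (c p) p (\<mu> p)" using \<mu> p by (auto simp: chain_slopes_def)
      then obtain r2 where r2: "r2 > 0" "\<And>d t. d \<in> dirs p \<Longrightarrow> 0 \<le> t \<Longrightarrow> t < r2 \<Longrightarrow> c p (pt p d t) = \<mu> p d * t"
        unfolding has_dslopes_def by fastforce
      have "h p p = 0" "has_dslopes (h p) p (\<lambda>d. sg (snd d) * x (fst d))"
        using x p by (auto simp: coefs_def chain_slopes_def)
      then obtain r3 where r3: "r3 > 0" "\<And>d t. d \<in> dirs p \<Longrightarrow> 0 \<le> t \<Longrightarrow> t < r3 \<Longrightarrow> h p (pt p d t) = sg (snd d) * x (fst d) * t"
        unfolding has_dslopes_def by fastforce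
      have lift: "pt p (L, b) t = \<gamma> L (s + sg b * t)" for b t using pt_lift[OF L] by (simp add: p_def)
      define r where "r = min r1 (min r2 r3)"
      have key: "f (\<gamma> L (s + sg b * t)) = f p + \<mu> p (L, b) * t - sg b * x L * t" if "0 < t" "t < r" for t b
        using r1(2)[OF p(2)[of b], of t] r2(2)[OF p(2)[of b], of t] r3(2)[OF p(2)[of b], of t] that
        by (simp add: lift r_def)
      have "F (s + t) = F s + \<mu> p (L, True) * t \<and> F (s - t) = F s + \<mu> p (L, False) * t" if t: "0 \<le> t" "t < r" for t
      proof (cases "t = 0")
        case False
        then have "0 < t" using t by simp
        then show ?thesis using key[of t True] key[of t False] t by (simp add: F_def p_def sg_def algebra_simps)
      qed simp
      moreover have "r > 0" using r1 r2 r3 by (simp add: r_def)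
      ultimately show ?thesis unfolding has_slopes_def p_def by blast
    qed
    have F: "F (len L) - F 0 = x L * len L" using \<gamma>_add_len[OF L, of 0] by (simp add: F_def)
    have 2: "(\<Sum>p\<in>jumps \<mu> L. jump \<mu> L p * \<theta> L p) = - (len L * \<mu> (\<gamma> L 0) (L, False)) - (F (len L) - F 0)"
      using chain_jumps(3)[OF rc \<mu> L sl] .
    have "\<gamma> L 0 \<in> \<Gamma>" "(L, False) \<in> dirs (\<gamma> L 0)" using L \<gamma>_in loop_subset by (auto simp: in_dirs)
    then obtain k :: int where "\<mu> (\<gamma> L 0) (L, False) = of_int k" using int by (metis Ints_cases)
    then show ?thesis using 1 2 F unfolding eqm_def by (intro exI[of _ k]) simp
  qed
  then show ?thesis using keys deg by blast
qed

text \<open>The converse: a divisor with prescribed image is the boundary of the chain of increments of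
  piecewise linear functions, one on each loop, whose jumps are given by the divisor pushed
  forward to that loop. The contributions of all loops through a point \<open>p\<close> add up to the
  coefficient of \<open>p\<close>, since a point other than \<open>p\<close> is projected away from \<open>p\<close> by exactly one of
  these loops.\<close>

lemma jacobian_class_if:
  assumes h: "real_cycle \<Gamma> h" and x: "coefs h x"
    and D: "Poly_Mapping.keys D \<subseteq> \<Gamma>" "div_degree D = 0" "\<And>L. L \<in> \<L> \<Longrightarrow> eqm L (\<Phi> L D) (x L * len L)"
  shows "D \<in> jacobian_class \<Gamma> h"
proof -
  define P where "P = Poly_Mapping.keys D"
  define w where "w = Poly_Mapping.lookup D"
  have fin: "finite P" by (simp add: P_def)
  have PG: "p \<in> \<Gamma>" if "p \<in> P" for p using D(1) that by (auto simp: P_def)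
  have deg: "(\<Sum>p\<in>P. w p) = 0" using D(2) by (simp add: div_degree_def P_def w_def)
  \<comment> \<open>The integer hidden in the congruence becomes the additional slope in
    \<open>flow_on_circle_exists\<close>, so that the increase per turn is exactly
    \<open>x L * len L\<close>.\<close>
  have "\<exists>N::int. (\<Sum>p\<in>P. of_int (w p) * \<theta> L p) - of_int N * len L = x L * len L" if "L \<in> \<L>" for L
    using D(3)[OF that] unfolding eqm_def \<Phi>_def pairing_def P_def w_def by (metis add_diff_cancel_left' diff_add_cancel)
  then obtain N :: "'a set \<Rightarrow> int" where N: "\<And>L. L \<in> \<L> \<Longrightarrow> (\<Sum>p\<in>P. of_int (w p) * \<theta> L p) - of_int (N L) * len L = x L * len L"
    by metis
  define QF where "QF L F \<longleftrightarrow> (\<forall>s. F (s + len L) = F s + x L * len L) \<and>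
    (\<forall>s. 0 \<le> s \<and> s < len L \<longrightarrow> (\<exists>a b :: int. has_slopes F s (of_int a) (of_int b) \<and>
       a + b = - (\<Sum>p | p \<in> P \<and> \<theta> L p = s. w p)))" for L F
  have "\<exists>F. QF L F" if L: "L \<in> \<L>" for L
    using flow_on_circle_exists[OF fin _ len_pos[OF L] deg, of "\<theta> L" "N L"] \<theta>(1,2)[OF L PG] N[OF L]
    unfolding QF_def by simp
  then obtain F where F: "\<And>L. L \<in> \<L> \<Longrightarrow> QF L (F L)" by metis
  have per: "F L (s + len L) = F L s + x L * len L" if "L \<in> \<L>" for L s
    using F[OF that] unfolding QF_def by blast
  define QS where "QS L s a b \<longleftrightarrow> has_slopes (F L) s (of_int a) (of_int b) \<and>
       a + b = - (\<Sum>p | p \<in> P \<and> \<theta> L p = s. w p)" for L s and a b :: int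
  have "\<exists>a b. QS L s a b" if "L \<in> \<L>" "0 \<le> s" "s < len L" for L s
    using F[OF that(1)] that unfolding QF_def QS_def by blast
  then obtain a b :: "'a set \<Rightarrow> real \<Rightarrow> int" where
    "\<And>L s. L \<in> \<L> \<Longrightarrow> 0 \<le> s \<Longrightarrow> s < len L \<Longrightarrow> QS L s (a L s) (b L s)" by metis
  then have ab: "has_slopes (F L) s (of_int (a L s)) (of_int (b L s)) \<and>
       a L s + b L s = - (\<Sum>p | p \<in> P \<and> \<theta> L p = s. w p)" if "L \<in> \<L>" "0 \<le> s" "s < len L" for L s
    using that unfolding QS_def by blast
  define m where "m L c s = real_of_int (if c then a L s else b L s)" for L c s
  define c where "c = increments F"
  define \<mu> where "\<mu> p d = m (fst d) (snd d) (\<theta> (fst d) p)" for p :: 'a and d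
  have sl': "has_slopes (F L) s (m L True s) (m L False s)" if "L \<in> \<L>" "0 \<le> s" "s < len L" for L s
    using ab[OF that] by (simp add: m_def)
  have rc: "real_chain \<Gamma> c" and \<mu>: "chain_slopes c \<mu>"
    unfolding c_def \<mu>_def by (rule increments_chain[OF per sl']; assumption)+
  have ic: "integer_chain \<Gamma> c"
    unfolding integer_chain_def
  proof (intro conjI rc ballI)
    fix p assume p: "p \<in> \<Gamma>"
    have "has_dslopes (c p) p (\<mu> p)" using \<mu> p by (simp add: chain_slopes_def)
    then obtain n m' where m': "local_slopes \<Gamma> (c p) p n m'" "m' ` {..<n} \<subseteq> \<mu> p ` dirs p"
      using local_slopes_of_dslopes[OF p] by blast
    have "\<mu> p d \<in> \<int>" for d by (simp add: \<mu>_def m_def)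
    then have "\<forall>k<n. m' k \<in> \<int>" using m'(2) by (force simp: image_subset_iff)
    then show "\<exists>n m. local_slopes \<Gamma> (c p) p n m \<and> (\<forall>k<n. m k \<in> \<int>)" using m'(1) by blast
  qed
  have ord: "of_int (w p) = ord_at \<Gamma> (c p) p" if p: "p \<in> \<Gamma>" for p
  proof -
    define S where "S = {L \<in> \<L>. p \<in> L}"
    have finS: "finite S" using finite_loops by (simp add: S_def)
    have j: "jump \<mu> L p = - of_int (\<Sum>q | q \<in> P \<and> \<rho> L q = p. w q)" if L: "L \<in> S" for L
    proof -
      have L': "L \<in> \<L>" "p \<in> L" using L by (auto simp: S_def)
      have "{q. q \<in> P \<and> \<theta> L q = \<theta> L p} = {q. q \<in> P \<and> \<rho> L q = p}"
        using \<theta>(3)[OF L'(1)] \<theta>_cong[of L] PG p proj_id[OF L'] by (metis (no_types, lifting))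
      moreover have "jump \<mu> L p = of_int (a L (\<theta> L p) + b L (\<theta> L p))" by (simp add: jump_def \<mu>_def m_def)
      ultimately show ?thesis using ab[OF L'(1) \<theta>(1,2)[OF L'(1) p]] by simp
    qed
    have "ord_at \<Gamma> (c p) p = - (\<Sum>L\<in>S. jump \<mu> L p)" using ord_chain[OF \<mu> p] by (simp add: S_def)
    also have "\<dots> = of_int (\<Sum>L\<in>S. \<Sum>q | q \<in> P \<and> \<rho> L q = p. w q)" using j by (simp add: sum_negf)
    also have "(\<Sum>L\<in>S. \<Sum>q | q \<in> P \<and> \<rho> L q = p. w q) = (\<Sum>q\<in>P. \<Sum>L | L \<in> S \<and> \<rho> L q = p. w q)"
      using sum.swap_restrict[OF finS fin, of "\<lambda>L q. w q" "\<lambda>L q. \<rho> L q = p"] .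
    also have "\<dots> = (\<Sum>q\<in>P. w q * int (card S) - (if q = p then 0 else w q))"
    proof (intro sum.cong refl)
      fix q assume q: "q \<in> P"
      have "{L. L \<in> S \<and> \<rho> L q = p} = {L \<in> \<L>. p \<in> L \<and> \<rho> L q = p}" by (auto simp: S_def)
      then have "int (card {L. L \<in> S \<and> \<rho> L q = p}) = int (card S) - (if q = p then 0 else 1)"
        using card_loops_towards[OF p PG[OF q]] by (simp add: S_def)
      then have "(\<Sum>L | L \<in> S \<and> \<rho> L q = p. w q) = w q * (int (card S) - (if q = p then 0 else 1))" by simp
      then show "(\<Sum>L | L \<in> S \<and> \<rho> L q = p. w q) = w q * int (card S) - (if q = p then 0 else w q)"
        by (simp add: right_diff_distrib)
    qed
    also have "\<dots> = (\<Sum>q\<in>P. w q) * int (card S) - (\<Sum>q\<in>P. w q - (if q = p then w q else 0))"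
    proof -
      have "(\<Sum>q\<in>P. if q = p then 0 else w q) = (\<Sum>q\<in>P. w q - (if q = p then w q else 0))"
        by (intro sum.cong) auto
      then show ?thesis by (simp add: sum_subtractf sum_distrib_right)
    qed
    also have "\<dots> = (\<Sum>q\<in>P. if q = p then w q else 0)" using deg by (simp add: sum_subtractf)
    also have "\<dots> = w p" using fin by (simp add: w_def P_def in_keys_iff)
    finally show ?thesis by simp
  qed
  have grad: "gradient_chain \<Gamma> (\<lambda>p q. c p q - h p q)"
    unfolding gradient_chain_def
  proof (intro exI ballI)
    \<comment> \<open>\<open>F L\<close> and the linear function of slope \<open>x L\<close>
      increase equally per turn, so their difference descends to the circle. Added up over all
      loops, these differences form a potential of \<open>c - h\<close>.\<close>
    define f where "f q = (\<Sum>L\<in>\<L>. F L (\<theta> L q) - x L * \<theta> L q)" for q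
    fix p assume p: "p \<in> \<Gamma>"
    have hp: "h p p = 0" "has_dslopes (h p) p (\<lambda>d. sg (snd d) * x (fst d))"
      using x p by (auto simp: coefs_def chain_slopes_def)
    obtain r where r: "r > 0" "\<And>d t. d \<in> dirs p \<Longrightarrow> t \<in> {0..<r} \<Longrightarrow> h p (pt p d t) = h p p + sg (snd d) * x (fst d) * t"
      using hp(2) unfolding has_dslopes_def by auto
    show "\<forall>\<^sub>F q in at p within \<Gamma>. c p q - h p q = f q - f p"
    proof (rule eventually_nearI[OF p])
      fix d assume d: "d \<in> dirs p"
      obtain L e where de: "d = (L, e)" by (metis surj_pair)
      have L: "L \<in> \<L>" "p \<in> L" using d de by (auto simp: in_dirs)
      have l: "0 < len L" using len_pos[OF L(1)] .
      have "c p (pt p d t) - h p (pt p d t) = f (pt p d t) - f p" if t: "0 < t" "t < min r (len L / 2)" for t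
      proof -
        define s where "s = \<theta> L p"
        define q where "q = pt p d t"
        have q: "q = \<gamma> L (s + sg e * t)" by (simp add: q_def de pt_def s_def)
        have qL: "q \<in> L" using \<gamma>_in[OF L(1)] q by simp
        have "increments F (\<gamma> L s) (\<gamma> L (s + sg e * t)) = F L (s + sg e * t) - F L s"
          using t increments_eq[of F "\<lambda>L. x L * len L" L "sg e * t" s] per L(1) by (simp add: sg_def)
        then have cq: "c p q = F L (s + sg e * t) - F L s" using \<gamma>_\<theta>[OF L] q by (simp add: c_def s_def)
        have hq: "h p q = sg e * x L * t" using r(2)[OF d, of t] t hp(1) by (simp add: q_def de)
        have "f q - f p = (\<Sum>M\<in>\<L>. (F M (\<theta> M q) - x M * \<theta> M q) - (F M (\<theta> M p) - x M * \<theta> M p))"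
          by (simp add: f_def sum_subtractf)
        also have "\<dots> = (F L (\<theta> L q) - x L * \<theta> L q) - (F L s - x L * s)"
          using finite_loops L(1) \<theta>_const[OF _ L(1) _ qL L(2)] by (simp add: sum.remove s_def)
        also have "F L (\<theta> L q) - x L * \<theta> L q = F L (s + sg e * t) - x L * (s + sg e * t)"
        proof -
          obtain k :: int where k: "\<theta> L q = s + sg e * t + of_int k * len L"
            using \<gamma>_\<theta>[OF L(1) qL] \<gamma>_eq_iff[OF L(1)] q by metis
          show ?thesis unfolding k quasi_periodic_int[of "F L", OF per[OF L(1)]] by (simp add: algebra_simps)
        qed
        finally show ?thesis using cq hq by (simp add: q_def algebra_simps)
      qed
      then show "\<exists>r>0. \<forall>t. 0 < t \<and> t < r \<longrightarrow> c p (pt p d t) - h p (pt p d t) = f (pt p d t) - f p"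
        using r(1) l by (intro exI[of _ "min r (len L / 2)"]) auto
    qed
  qed
  show ?thesis
    unfolding jacobian_class_def using D(1) ic ord grad by (auto simp: w_def)
qed

lemma jacobian_class_iff:
  assumes "real_cycle \<Gamma> h" "coefs h x"
  shows "D \<in> jacobian_class \<Gamma> h \<longleftrightarrow>
    Poly_Mapping.keys D \<subseteq> \<Gamma> \<and> div_degree D = 0 \<and> (\<forall>L\<in>\<L>. eqm L (\<Phi> L D) (x L * len L))"
  using jacobian_class_imp[OF assms] jacobian_class_if[OF assms] by blast

lemma zero_cycle: "real_cycle \<Gamma> (\<lambda>_ _. 0)" "coefs (\<lambda>_ _. 0) (\<lambda>_. 0)"
proof -
  have z: "has_dslopes (\<lambda>_. 0) p (\<lambda>_. 0)" for p unfolding has_dslopes_def by (intro exI[of _ 1]) simp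
  then show "coefs (\<lambda>_ _. 0) (\<lambda>_. 0)" by (simp add: coefs_def chain_slopes_def)
  have "ord_at \<Gamma> (\<lambda>_. 0) p = 0" if "p \<in> \<Gamma>" for p using ord_at_dslopes[OF that z] by simp
  moreover have "\<exists>n m. local_slopes \<Gamma> (\<lambda>_. 0) p n m" if "p \<in> \<Gamma>" for p
    using local_slopes_of_dslopes[OF that z] by blast
  ultimately show "real_cycle \<Gamma> (\<lambda>_ _. 0)" by (simp add: real_cycle_def real_chain_def)
qed

text \<open>A principal divisor is the boundary of the integral chain of differences of its
  function; conversely, a potential of an integral chain inherits the slopes of the chain.\<close>

lemma principal_iff_jacobian_class: "principal \<Gamma> D \<longleftrightarrow> D \<in> jacobian_class \<Gamma> (\<lambda>_ _. 0)"
proof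
  assume "principal \<Gamma> D"
  then obtain f where f: "D \<in> Div \<Gamma>" "pl_integer \<Gamma> f" "\<And>p. p \<in> \<Gamma> \<Longrightarrow> of_int (Poly_Mapping.lookup D p) = ord_at \<Gamma> f p"
    unfolding principal_def by blast
  define c where "c p q = f q - f p" for p q
  have shift: "local_slopes \<Gamma> (c p) p n m \<longleftrightarrow> local_slopes \<Gamma> f p n m" for p n m
    unfolding local_slopes_def by (simp add: c_def diff_eq_eq add.commute)
  have "integer_chain \<Gamma> c"
  proof -
    have "\<exists>n m. local_slopes \<Gamma> (c p) p n m \<and> (\<forall>k<n. m k \<in> \<int>)" if "p \<in> \<Gamma>" for p
      using f(2) that unfolding pl_integer_def shift by blast
    then show ?thesis unfolding integer_chain_def real_chain_def by (simp add: c_def) blast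
  qed
  moreover have "ord_at \<Gamma> (c p) p = ord_at \<Gamma> f p" for p unfolding ord_at_def shift ..
  moreover have "gradient_chain \<Gamma> (\<lambda>p q. c p q - 0)" unfolding gradient_chain_def by (intro exI[of _ f]) (simp add: c_def)
  ultimately show "D \<in> jacobian_class \<Gamma> (\<lambda>_ _. 0)" unfolding jacobian_class_def using f by auto
next
  assume "D \<in> jacobian_class \<Gamma> (\<lambda>_ _. 0)"
  then obtain c where c: "integer_chain \<Gamma> c" and ord: "\<And>p. p \<in> \<Gamma> \<Longrightarrow> of_int (Poly_Mapping.lookup D p) = ord_at \<Gamma> (c p) p"
    and grad: "gradient_chain \<Gamma> (\<lambda>p q. c p q - 0)" and keys: "D \<in> Div \<Gamma>"
    unfolding jacobian_class_def by auto
  obtain \<mu> where \<mu>: "chain_slopes c \<mu>" and int: "\<And>p d. p \<in> \<Gamma> \<Longrightarrow> d \<in> dirs p \<Longrightarrow> \<mu> p d \<in> \<int>"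
    using integer_chain_slopes[OF c] by blast
  obtain f where f: "\<And>p. p \<in> \<Gamma> \<Longrightarrow> \<forall>\<^sub>F q in at p within \<Gamma>. c p q = f q - f p"
    using grad unfolding gradient_chain_def by auto
  have fs: "has_dslopes f p (\<mu> p)" if p: "p \<in> \<Gamma>" for p
  proof -
    obtain r1 where r1: "r1 > 0" "\<And>d t. d \<in> dirs p \<Longrightarrow> 0 < t \<Longrightarrow> t < r1 \<Longrightarrow> c p (pt p d t) = f (pt p d t) - f p"
      using f[OF p] unfolding eventually_near[OF p] by blast
    have "c p p = 0" "has_dslopes (c p) p (\<mu> p)" using \<mu> p by (auto simp: chain_slopes_def)
    then obtain r2 where r2: "r2 > 0" "\<And>d t. d \<in> dirs p \<Longrightarrow> 0 \<le> t \<Longrightarrow> t < r2 \<Longrightarrow> c p (pt p d t) = \<mu> p d * t"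
      unfolding has_dslopes_def by fastforce
    show ?thesis
    proof (rule has_dslopesI)
      fix d assume d: "d \<in> dirs p"
      have "f (pt p d t) = f p + \<mu> p d * t" if "0 < t" "t < min r1 r2" for t
        using r1(2)[OF d, of t] r2(2)[OF d, of t] that by simp
      then show "\<exists>r>0. \<forall>t. 0 < t \<and> t < r \<longrightarrow> f (pt p d t) = f p + \<mu> p d * t"
        using r1(1) r2(1) by (intro exI[of _ "min r1 r2"]) auto
    qed
  qed
  have "pl_integer \<Gamma> f"
    unfolding pl_integer_def
  proof (intro conjI ballI)
    show "continuous_on \<Gamma> f" using fs by (intro continuous_of_dslopes) blast
    fix p assume p: "p \<in> \<Gamma>"
    obtain n m' where m': "local_slopes \<Gamma> f p n m'" "m' ` {..<n} \<subseteq> \<mu> p ` dirs p"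
      using local_slopes_of_dslopes[OF p fs[OF p]] by blast
    then have "\<forall>k<n. m' k \<in> \<int>" using int[OF p] by (force simp: image_subset_iff)
    then show "\<exists>n m. local_slopes \<Gamma> f p n m \<and> (\<forall>k<n. m k \<in> \<int>)" using m'(1) by blast
  qed
  moreover have "ord_at \<Gamma> (c p) p = ord_at \<Gamma> f p" if p: "p \<in> \<Gamma>" for p
    using ord_at_dslopes[OF p fs[OF p]] ord_at_dslopes[OF p, of "c p" "\<mu> p"] \<mu> p by (simp add: chain_slopes_def)
  ultimately show "principal \<Gamma> D" unfolding principal_def using keys ord by auto
qed

text \<open>Abel's theorem for a tree of loops, as the case of the zero cycle.\<close>

lemma principal_iff:
  "principal \<Gamma> D \<longleftrightarrow> Poly_Mapping.keys D \<subseteq> \<Gamma> \<and> div_degree D = 0 \<and> (\<forall>L\<in>\<L>. eqm L (\<Phi> L D) 0)"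
  unfolding principal_iff_jacobian_class jacobian_class_iff[OF zero_cycle] by simp

lemma \<Phi>_diff: "\<Phi> L (D - E) = \<Phi> L D - \<Phi> L E"
  by (simp add: \<Phi>_def pairing_diff)

lemma \<Phi>_add: "\<Phi> L (D + E) = \<Phi> L D + \<Phi> L E"
  by (simp add: \<Phi>_def pairing_add)

lemma \<Phi>_single: "\<Phi> L (Poly_Mapping.single p n) = of_int n * \<theta> L p"
  by (simp add: \<Phi>_def pairing_single)

lemma \<Phi>_sum: "\<Phi> L (\<Sum>i\<in>I. f i) = (\<Sum>i\<in>I. \<Phi> L (f i))"
  by (simp add: \<Phi>_def pairing_sum)

lemma eqm_diff_0: "eqm L (a - b) 0 \<longleftrightarrow> eqm L a b"
  by (simp add: eqm_def)

lemma lin_equiv_iff: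
  "(D, D') \<in> lin_equiv \<Gamma> \<longleftrightarrow> Poly_Mapping.keys D \<subseteq> \<Gamma> \<and> Poly_Mapping.keys D' \<subseteq> \<Gamma> \<and>
    div_degree D = div_degree D' \<and> (\<forall>L\<in>\<L>. eqm L (\<Phi> L D) (\<Phi> L D'))"
proof -
  have "Poly_Mapping.keys D \<subseteq> \<Gamma> \<Longrightarrow> Poly_Mapping.keys D' \<subseteq> \<Gamma> \<Longrightarrow> Poly_Mapping.keys (D - D') \<subseteq> \<Gamma>"
    by (rule keys_diff_subset)
  moreover have "div_degree D - div_degree D' = 0 \<longleftrightarrow> div_degree D = div_degree D'" by simp
  ultimately show ?thesis
    unfolding lin_equiv_def mem_Collect_eq prod.case principal_iff div_degree_diff \<Phi>_diff eqm_diff_0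
      carrier_free_Abelian_group_iff by blast
qed

end

section \<open>Effective classes and rank\<close>

context loop_tree
begin

lemma div_degree_0: "div_degree (0 :: 'b \<Rightarrow>\<^sub>0 int) = 0"
  by (simp add: div_degree_def)

lemma \<Phi>_0: "\<Phi> L 0 = 0"
  by (simp add: \<Phi>_def pairing_0)

definition coord :: "'a set \<Rightarrow> 'a set \<Rightarrow> real" where
  "coord L M = \<theta> L (att L M)"

lemma \<theta>_coord: "L \<in> \<L> \<Longrightarrow> M \<in> \<L> \<Longrightarrow> L \<noteq> M \<Longrightarrow> x \<in> M \<Longrightarrow> \<theta> L x = coord L M"
  unfolding coord_def by (intro \<theta>_cong) (simp add: proj_att proj_id att_in)

text \<open>The contribution to \<open>\<Phi> L\<close> of the chips on other loops, which depends
  only on how many lie on each loop and not on their positions.\<close>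

definition outer :: "'a set \<Rightarrow> ('a set \<Rightarrow> nat) \<Rightarrow> real" where
  "outer L n = (\<Sum>M\<in>\<L>-{L}. real (n M) * coord L M)"

text \<open>\<open>n L\<close> is the number of chips that an effective divisor in the class places on the loop \<open>L\<close>;
  if it is positive, then the coordinate of the class at \<open>L\<close> imposes no condition.\<close>

definition eff_class :: "int \<Rightarrow> ('a set \<Rightarrow> real) \<Rightarrow> bool" where
  "eff_class d \<phi> \<longleftrightarrow> (\<exists>n. (\<Sum>L\<in>\<L>. int (n L)) = d \<and> (\<forall>L\<in>\<L>. n L = 0 \<longrightarrow> eqm L (\<phi> L) (outer L n)))"

lemma eff_class_cong:
  assumes "eff_class d \<phi>" "\<And>L. L \<in> \<L> \<Longrightarrow> eqm L (\<phi> L) (\<psi> L)" shows "eff_class d \<psi>"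
proof -
  obtain n where n: "(\<Sum>L\<in>\<L>. int (n L)) = d" "\<And>L. L \<in> \<L> \<Longrightarrow> n L = 0 \<Longrightarrow> eqm L (\<phi> L) (outer L n)"
    using assms(1) unfolding eff_class_def by blast
  have "eqm L (\<psi> L) (outer L n)" if "L \<in> \<L>" "n L = 0" for L
    using eqm_trans[OF eqm_sym[OF assms(2)[OF that(1)]] n(2)[OF that]] .
  then show ?thesis unfolding eff_class_def using n(1) by blast
qed

text \<open>Each point is assigned to one of the loops through it by a choice \<open>l\<close>. A
  loop to which no point is assigned sees all chips through its branches, even those at its own
  attaching points, so its coordinate equals \<open>outer L e\<close> exactly.\<close>

lemma effective_profile:
  assumes E: "Poly_Mapping.keys E \<subseteq> \<Gamma>" "effective E"
  shows "\<exists>e. (\<Sum>L\<in>\<L>. int (e L)) = div_degree E \<and> (\<forall>L\<in>\<L>. e L = 0 \<longrightarrow> \<Phi> L E = outer L e)"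
proof -
  define K where "K = Poly_Mapping.keys E"
  define w where "w = Poly_Mapping.lookup E"
  have w: "0 < w p" if "p \<in> K" for p
    using that E(2) by (auto simp: K_def w_def effective_def in_keys_iff order_less_le)
  have fin: "finite K" by (simp add: K_def)
  have "\<forall>p\<in>K. \<exists>L. L \<in> \<L> \<and> p \<in> L" using E(1) union by (auto simp: K_def)
  then obtain l where l: "\<And>p. p \<in> K \<Longrightarrow> l p \<in> \<L> \<and> p \<in> l p" by metis
  define e where "e L = nat (\<Sum>p | p \<in> K \<and> l p = L. w p)" for L
  have e: "int (e L) = (\<Sum>p | p \<in> K \<and> l p = L. w p)" for L
  proof -
    have "0 \<le> (\<Sum>p | p \<in> K \<and> l p = L. w p)" by (intro sum_nonneg) (auto intro: less_imp_le[OF w])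
    then show ?thesis by (simp add: e_def)
  qed
  have im: "l ` K \<subseteq> \<L>" using l by auto
  have "(\<Sum>L\<in>\<L>. int (e L)) = (\<Sum>p\<in>K. w p)"
    unfolding e using sum.group[OF fin finite_loops im, of w] .
  also have "\<dots> = div_degree E" by (simp add: div_degree_def K_def w_def)
  finally have deg: "(\<Sum>L\<in>\<L>. int (e L)) = div_degree E" .
  have "\<Phi> L E = outer L e" if L: "L \<in> \<L>" "e L = 0" for L
  proof -
    have noL: "l p \<noteq> L" if p: "p \<in> K" for p
    proof
      assume "l p = L"
      then have "w p \<le> (\<Sum>p | p \<in> K \<and> l p = L. w p)"
        using p fin \<open>l p = L\<close> by (intro member_le_sum) (auto intro: less_imp_le[OF w])
      then show False using e[of L] L(2) w[OF p] by simp
    qed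
    have "\<Phi> L E = (\<Sum>p\<in>K. of_int (w p) * \<theta> L p)" by (simp add: \<Phi>_def pairing_def K_def w_def)
    also have "\<dots> = (\<Sum>p\<in>K. of_int (w p) * coord L (l p))"
    proof (intro sum.cong refl)
      fix p assume p: "p \<in> K"
      show "of_int (w p) * \<theta> L p = of_int (w p) * coord L (l p)"
        using \<theta>_coord[OF L(1), of "l p" p] l[OF p] noL[OF p] by simp
    qed
    also have "\<dots> = (\<Sum>M\<in>\<L>. \<Sum>p | p \<in> K \<and> l p = M. of_int (w p) * coord L (l p))"
      using sum.group[OF fin finite_loops im, of "\<lambda>p. of_int (w p) * coord L (l p)"] by simp
    also have "\<dots> = (\<Sum>M\<in>\<L>. real (e M) * coord L M)"
    proof (intro sum.cong refl)
      fix M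
      have "(\<Sum>p | p \<in> K \<and> l p = M. of_int (w p) * coord L (l p)) = of_int (\<Sum>p | p \<in> K \<and> l p = M. w p) * coord L M"
        by (simp add: sum_distrib_right)
      then show "(\<Sum>p | p \<in> K \<and> l p = M. of_int (w p) * coord L (l p)) = real (e M) * coord L M"
        using e[of M] by (metis of_int_of_nat_eq)
    qed
    also have "\<dots> = outer L e" unfolding outer_def using finite_loops L by (simp add: sum.remove)
    finally show ?thesis .
  qed
  then show ?thesis using deg by blast
qed

text \<open>On a loop with chips all but one are parked at a base point \<open>b L\<close>, and the
  last one, \<open>c L\<close>, solves the congruence at \<open>L\<close>. Its position is invisible
  from every other loop, so the congruences are solved independently.\<close>

lemma effective_realize:
  assumes n: "\<And>L. L \<in> \<L> \<Longrightarrow> n L = 0 \<Longrightarrow> eqm L (\<phi> L) (outer L n)"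
  shows "\<exists>D. Poly_Mapping.keys D \<subseteq> \<Gamma> \<and> effective D \<and> div_degree D = (\<Sum>L\<in>\<L>. int (n L)) \<and>
    (\<forall>L\<in>\<L>. eqm L (\<Phi> L D) (\<phi> L))"
proof -
  have "\<exists>b. b \<in> L" if "L \<in> \<L>" for L using loop_nonempty[OF that] by blast
  then obtain b where b: "\<And>L. L \<in> \<L> \<Longrightarrow> b L \<in> L" by metis
  have "\<exists>c. c \<in> L \<and> eqm L (\<theta> L c) (\<phi> L - outer L n - (real (n L) - 1) * \<theta> L (b L))" if "L \<in> \<L>" for L
    using obtain_point[OF that] by blast
  then obtain c where c: "\<And>L. L \<in> \<L> \<Longrightarrow> c L \<in> L \<and> eqm L (\<theta> L (c L)) (\<phi> L - outer L n - (real (n L) - 1) * \<theta> L (b L))"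
    by metis
  define f where "f L = (if n L = 0 then 0 else Poly_Mapping.single (b L) (int (n L) - 1) + Poly_Mapping.single (c L) 1)" for L
  define D where "D = (\<Sum>L\<in>\<L>. f L)"
  have kf: "Poly_Mapping.keys (f L) \<subseteq> \<Gamma>" if L: "L \<in> \<L>" for L
  proof -
    have "b L \<in> \<Gamma>" "c L \<in> \<Gamma>" using b[OF L] c[OF L] loop_subset[OF L] by auto
    then have "Poly_Mapping.keys (Poly_Mapping.single (b L) (int (n L) - 1)) \<subseteq> \<Gamma>"
      "Poly_Mapping.keys (Poly_Mapping.single (c L) (1::int)) \<subseteq> \<Gamma>" by auto
    from keys_add_subset[OF this] show ?thesis by (simp add: f_def)
  qed
  have eff: "effective (f L)" for L
  proof (cases "n L = 0")
    case True
    then show ?thesis by (simp add: f_def effective_def)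
  next
    case False
    then have "effective (Poly_Mapping.single (b L) (int (n L) - 1))" by (intro effective_single) auto
    moreover have "effective (Poly_Mapping.single (c L) (1::int))" by (intro effective_single) auto
    ultimately show ?thesis using False effective_add by (simp add: f_def)
  qed
  have degf: "div_degree (f L) = int (n L)" for L
    using div_degree_single[of "c L" 1] by (simp add: f_def div_degree_add div_degree_single div_degree_0)
  have out: "\<Phi> L (f M) = real (n M) * coord L M" if "L \<in> \<L>" "M \<in> \<L>" "L \<noteq> M" for L M
    using \<theta>_coord[OF that b[OF that(2)]] \<theta>_coord[OF that, of "c M"] c[OF that(2)]
    using \<Phi>_single[of L "c M" 1] by (simp add: f_def \<Phi>_add \<Phi>_single algebra_simps \<Phi>_0)
  have "eqm L (\<Phi> L D) (\<phi> L)" if L: "L \<in> \<L>" for L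
  proof -
    have "\<Phi> L D = \<Phi> L (f L) + (\<Sum>M\<in>\<L>-{L}. \<Phi> L (f M))"
      unfolding D_def \<Phi>_sum using finite_loops L by (rule sum.remove)
    also have "(\<Sum>M\<in>\<L>-{L}. \<Phi> L (f M)) = outer L n" unfolding outer_def using out L by (intro sum.cong) auto
    finally have D: "\<Phi> L D = \<Phi> L (f L) + outer L n" .
    show ?thesis
    proof (cases "n L = 0")
      case True
      then have "\<Phi> L D = outer L n" using D by (simp add: f_def \<Phi>_def pairing_0)
      then show ?thesis using n[OF L True] eqm_sym by simp
    next
      case False
      then have "\<Phi> L (f L) = (real (n L) - 1) * \<theta> L (b L) + \<theta> L (c L)"
        using \<Phi>_single[of L "c L" 1] by (simp add: f_def \<Phi>_add \<Phi>_single)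
      then have "\<Phi> L D = \<theta> L (c L) + ((real (n L) - 1) * \<theta> L (b L) + outer L n)" using D by simp
      moreover have "eqm L (\<theta> L (c L) + ((real (n L) - 1) * \<theta> L (b L) + outer L n))
          ((\<phi> L - outer L n - (real (n L) - 1) * \<theta> L (b L)) + ((real (n L) - 1) * \<theta> L (b L) + outer L n))"
        using c[OF L] by (intro eqm_add) auto
      ultimately show ?thesis by simp
    qed
  qed
  moreover have "Poly_Mapping.keys D \<subseteq> \<Gamma>" unfolding D_def by (rule keys_sum_subset[OF kf])
  moreover have "effective D" unfolding D_def by (rule effective_sum[OF eff])
  moreover have "div_degree D = (\<Sum>L\<in>\<L>. int (n L))" unfolding D_def div_degree_sum degf ..
  ultimately show ?thesis by blast
qed

lemma equiv_to_effective_iff: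
  assumes D: "Poly_Mapping.keys D \<subseteq> \<Gamma>"
  shows "equiv_to_effective \<Gamma> D \<longleftrightarrow> eff_class (div_degree D) (\<lambda>L. \<Phi> L D)"
proof
  assume "equiv_to_effective \<Gamma> D"
  then obtain D' where D': "effective D'" "Poly_Mapping.keys D' \<subseteq> \<Gamma>" "div_degree D = div_degree D'"
    "\<And>L. L \<in> \<L> \<Longrightarrow> eqm L (\<Phi> L D) (\<Phi> L D')"
    unfolding equiv_to_effective_def lin_equiv_iff by blast
  obtain e where "(\<Sum>L\<in>\<L>. int (e L)) = div_degree D'" "\<forall>L\<in>\<L>. e L = 0 \<longrightarrow> \<Phi> L D' = outer L e"
    using effective_profile[OF D'(2,1)] by blast
  then show "eff_class (div_degree D) (\<lambda>L. \<Phi> L D)" unfolding eff_class_def using D'(3,4) by metis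
next
  assume "eff_class (div_degree D) (\<lambda>L. \<Phi> L D)"
  then obtain n where n: "(\<Sum>L\<in>\<L>. int (n L)) = div_degree D" "\<And>L. L \<in> \<L> \<Longrightarrow> n L = 0 \<Longrightarrow> eqm L (\<Phi> L D) (outer L n)"
    unfolding eff_class_def by blast
  obtain D' where "Poly_Mapping.keys D' \<subseteq> \<Gamma>" "effective D'" "div_degree D' = (\<Sum>L\<in>\<L>. int (n L))"
    "\<forall>L\<in>\<L>. eqm L (\<Phi> L D') (\<Phi> L D)"
    using effective_realize[of n "\<lambda>L. \<Phi> L D"] n(2) by blast
  then show "equiv_to_effective \<Gamma> D"
    unfolding equiv_to_effective_def lin_equiv_iff using D n(1) eqm_sym by metis
qed

text \<open>The rank expressed through the degree and the coordinates of a class; any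
  \<open>\<phi>\<close> may occur, as the coordinates can be prescribed arbitrarily.\<close>

definition rank_ge :: "int \<Rightarrow> int \<Rightarrow> ('a set \<Rightarrow> real) \<Rightarrow> bool" where
  "rank_ge r d \<phi> \<longleftrightarrow> (\<forall>E. Poly_Mapping.keys E \<subseteq> \<Gamma> \<and> effective E \<and> div_degree E = r \<longrightarrow>
     eff_class (d - r) (\<lambda>L. \<phi> L - \<Phi> L E))"

lemma rank_ge_cong:
  assumes "rank_ge r d \<phi>" "\<And>L. L \<in> \<L> \<Longrightarrow> eqm L (\<phi> L) (\<psi> L)" shows "rank_ge r d \<psi>"
  unfolding rank_ge_def
proof (intro allI impI)
  fix E assume "Poly_Mapping.keys E \<subseteq> \<Gamma> \<and> effective E \<and> div_degree E = r"
  then have "eff_class (d - r) (\<lambda>L. \<phi> L - \<Phi> L E)" using assms(1) unfolding rank_ge_def by blast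
  then show "eff_class (d - r) (\<lambda>L. \<psi> L - \<Phi> L E)"
    by (rule eff_class_cong) (intro eqm_diff assms(2), auto)
qed

lemma eff_class_nonneg: "eff_class d \<phi> \<Longrightarrow> 0 \<le> d"
  unfolding eff_class_def by (metis of_nat_0_le_iff sum_nonneg)

lemma eff_class_add_point:
  assumes n: "eff_class (d - 1) (\<lambda>L. \<phi> L - \<theta> L p)" and p: "p \<in> \<Gamma>"
  shows "eff_class d \<phi>"
proof -
  obtain n where n: "(\<Sum>L\<in>\<L>. int (n L)) = d - 1" "\<And>L. L \<in> \<L> \<Longrightarrow> n L = 0 \<Longrightarrow> eqm L (\<phi> L - \<theta> L p) (outer L n)"
    using n unfolding eff_class_def by blast
  obtain M where M: "M \<in> \<L>" "p \<in> M" using p union by blast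
  define n' where "n' = n(M := n M + 1)"
  have "(\<Sum>L\<in>\<L>. int (n' L)) = (\<Sum>L\<in>\<L>. int (n L) + (if L = M then 1 else 0))"
    by (intro sum.cong) (auto simp: n'_def)
  then have "(\<Sum>L\<in>\<L>. int (n' L)) = d" using n(1) M finite_loops by (simp add: sum.distrib)
  moreover have "eqm L (\<phi> L) (outer L n')" if L: "L \<in> \<L>" "n' L = 0" for L
  proof -
    have LM: "L \<noteq> M" using L by (auto simp: n'_def)
    have "outer L n' = (\<Sum>N\<in>\<L>-{L}. real (n N) * coord L N + (if N = M then coord L M else 0))"
      unfolding outer_def by (intro sum.cong) (auto simp: n'_def algebra_simps)
    then have "outer L n' = outer L n + \<theta> L p"
      using \<theta>_coord[OF L(1) M(1) LM M(2)] M LM finite_loops by (simp add: sum.distrib outer_def)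
    moreover have "eqm L ((\<phi> L - \<theta> L p) + \<theta> L p) (outer L n + \<theta> L p)"
      using n(2)[OF L(1)] L LM by (intro eqm_add) (auto simp: n'_def)
    ultimately show ?thesis by simp
  qed
  ultimately show ?thesis unfolding eff_class_def by blast
qed

lemma rank_ge_Suc:
  assumes "rank_ge (int (Suc r)) d \<phi>" shows "rank_ge (int r) d \<phi>"
  unfolding rank_ge_def
proof (intro allI impI)
  fix E assume E: "Poly_Mapping.keys E \<subseteq> \<Gamma> \<and> effective E \<and> div_degree E = int r"
  obtain p where p: "p \<in> \<Gamma>" using graph_nonempty by blast
  define E' where "E' = E + Poly_Mapping.single p 1"
  have "Poly_Mapping.keys E' \<subseteq> \<Gamma>" unfolding E'_def using E p by (intro keys_add_subset) auto
  moreover have "effective E'" unfolding E'_def using E by (intro effective_add effective_single) auto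
  moreover have "div_degree E' = int (Suc r)" using E by (simp add: E'_def div_degree_add div_degree_single)
  ultimately have "eff_class (d - int (Suc r)) (\<lambda>L. \<phi> L - \<Phi> L E')" using assms unfolding rank_ge_def by blast
  then have "eff_class (d - int r - 1) (\<lambda>L. \<phi> L - \<Phi> L E - \<theta> L p)"
    by (simp add: E'_def \<Phi>_add \<Phi>_single algebra_simps)
  then show "eff_class (d - int r) (\<lambda>L. \<phi> L - \<Phi> L E)"
    using eff_class_add_point[of "d - int r" "\<lambda>L. \<phi> L - \<Phi> L E" p] p by blast
qed

lemma rank_ge_mono: "rank_ge (int r) d \<phi> \<Longrightarrow> s \<le> r \<Longrightarrow> rank_ge (int s) d \<phi>"
proof (induction r)
  case (Suc r)
  then show ?case using rank_ge_Suc[OF Suc.prems(1)] by (cases "s = Suc r") auto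
qed simp

lemma rank_ge_0: "rank_ge 0 d \<phi> \<longleftrightarrow> eff_class d \<phi>"
proof
  assume "rank_ge 0 d \<phi>"
  moreover have "effective (0 :: 'a \<Rightarrow>\<^sub>0 int)" "div_degree (0 :: 'a \<Rightarrow>\<^sub>0 int) = 0"
    by (auto simp: effective_def div_degree_def)
  ultimately have "eff_class (d - 0) (\<lambda>L. \<phi> L - \<Phi> L 0)" unfolding rank_ge_def by (metis empty_subsetI keys_zero)
  then show "eff_class d \<phi>" by (simp add: \<Phi>_def pairing_0)
next
  assume "eff_class d \<phi>"
  show "rank_ge 0 d \<phi>"
    unfolding rank_ge_def
  proof (intro allI impI)
    fix E assume "Poly_Mapping.keys E \<subseteq> \<Gamma> \<and> effective E \<and> div_degree E = 0"
    then have "E = 0" using effective_degree_0 by blast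
    then show "eff_class (d - 0) (\<lambda>L. \<phi> L - \<Phi> L E)" using \<open>eff_class d \<phi>\<close> by (simp add: \<Phi>_def pairing_0)
  qed
qed

lemma rank_ge_le_degree:
  assumes "rank_ge (int r) d \<phi>" shows "int r \<le> d"
proof -
  obtain p where p: "p \<in> \<Gamma>" using graph_nonempty by blast
  define E where "E = Poly_Mapping.single p (int r)"
  have "Poly_Mapping.keys E \<subseteq> \<Gamma> \<and> effective E \<and> div_degree E = int r"
    using p effective_single[of "int r" p] by (auto simp: E_def div_degree_single)
  then have "eff_class (d - int r) (\<lambda>L. \<phi> L - \<Phi> L E)" using assms unfolding rank_ge_def by blast
  then show ?thesis using eff_class_nonneg by fastforce
qed

text \<open>The conditions \<open>rank_ge\<close> are downward closed in the rank and bounded by the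
  degree, so their greatest member decides all of them.\<close>

lemma div_rank_ge_iff:
  assumes D: "Poly_Mapping.keys D \<subseteq> \<Gamma>"
  shows "int r \<le> div_rank \<Gamma> D \<longleftrightarrow> rank_ge (int r) (div_degree D) (\<lambda>L. \<Phi> L D)"
proof -
  define P where "P r \<longleftrightarrow> rank_ge (int r) (div_degree D) (\<lambda>L. \<Phi> L D)" for r
  have "equiv_to_effective \<Gamma> (D - E) \<longleftrightarrow> eff_class (div_degree D - div_degree E) (\<lambda>L. \<Phi> L D - \<Phi> L E)"
    if "Poly_Mapping.keys E \<subseteq> \<Gamma>" for E
    using equiv_to_effective_iff[OF keys_diff_subset[OF D that]] by (simp add: div_degree_diff \<Phi>_diff)
  then have P: "(\<forall>E\<in>Div \<Gamma>. effective E \<and> div_degree E = int s \<longrightarrow> equiv_to_effective \<Gamma> (D - E)) \<longleftrightarrow> P s" for s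
    unfolding P_def rank_ge_def carrier_free_Abelian_group_iff Ball_def by (metis (no_types, lifting))
  have bound: "s \<le> nat (div_degree D)" if "P s" for s
    using rank_ge_le_degree that unfolding P_def by fastforce
  show ?thesis
  proof (cases "equiv_to_effective \<Gamma> D")
    case True
    then have P0: "P 0" using rank_ge_0 equiv_to_effective_iff[OF D] by (simp add: P_def)
    have G: "P (Greatest P)" using GreatestI_nat[of P 0 "nat (div_degree D)"] P0 bound by blast
    have "r \<le> Greatest P \<longleftrightarrow> P r"
      using Greatest_le_nat[of P r "nat (div_degree D)"] bound rank_ge_mono G unfolding P_def by blast
    moreover have "div_rank \<Gamma> D = int (Greatest P)" unfolding div_rank_def P using True by simp
    ultimately show ?thesis by (simp add: P_def)
  next
    case False
    then have "\<not> P 0" using rank_ge_0 equiv_to_effective_iff[OF D] by (simp add: P_def)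
    then have "\<not> P r" using rank_ge_mono[of r _ _ 0] unfolding P_def by blast
    then show ?thesis using False by (simp add: div_rank_def P_def)
  qed
qed

section \<open>Cells in Brill-Noether loci\<close>

lemma lin_equiv_equiv: "equiv (Div \<Gamma>) (lin_equiv \<Gamma>)"
proof (rule equivI)
  show "refl_on (Div \<Gamma>) (lin_equiv \<Gamma>)" by (auto simp: refl_on_def lin_equiv_iff)
  show "lin_equiv \<Gamma> \<subseteq> Div \<Gamma> \<times> Div \<Gamma>" by (auto simp: lin_equiv_def)
  show "sym (lin_equiv \<Gamma>)" by (auto simp: sym_def lin_equiv_iff intro: eqm_sym)
  show "trans (lin_equiv \<Gamma>)" unfolding trans_def lin_equiv_iff by (metis eqm_trans)
qed

lemma W_iff:
  "c \<in> W \<Gamma> r d \<longleftrightarrow> (\<exists>D. Poly_Mapping.keys D \<subseteq> \<Gamma> \<and> div_degree D = int d \<and> c = lin_equiv \<Gamma> `` {D} \<and>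
     rank_ge (int r) (int d) (\<lambda>L. \<Phi> L D))"
proof
  assume c: "c \<in> W \<Gamma> r d"
  then obtain D D' where D: "Poly_Mapping.keys D \<subseteq> \<Gamma>" "div_degree D = int d" "c = lin_equiv \<Gamma> `` {D}"
    "D' \<in> c" "int r \<le> div_rank \<Gamma> D'"
    unfolding W_def Pic_def quotient_def by auto
  have DD': "(D, D') \<in> lin_equiv \<Gamma>" using D by simp
  then have D': "Poly_Mapping.keys D' \<subseteq> \<Gamma>" "div_degree D' = int d" "\<And>L. L \<in> \<L> \<Longrightarrow> eqm L (\<Phi> L D) (\<Phi> L D')"
    using D unfolding lin_equiv_iff by auto
  have "rank_ge (int r) (int d) (\<lambda>L. \<Phi> L D')" using div_rank_ge_iff[OF D'(1)] D(5) D'(2) by simp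
  moreover have "c = lin_equiv \<Gamma> `` {D'}" using D(3) equiv_class_eq[OF lin_equiv_equiv DD'] by simp
  ultimately show "\<exists>D. Poly_Mapping.keys D \<subseteq> \<Gamma> \<and> div_degree D = int d \<and> c = lin_equiv \<Gamma> `` {D} \<and>
     rank_ge (int r) (int d) (\<lambda>L. \<Phi> L D)" using D' by blast
next
  assume "\<exists>D. Poly_Mapping.keys D \<subseteq> \<Gamma> \<and> div_degree D = int d \<and> c = lin_equiv \<Gamma> `` {D} \<and>
     rank_ge (int r) (int d) (\<lambda>L. \<Phi> L D)"
  then obtain D where D: "Poly_Mapping.keys D \<subseteq> \<Gamma>" "div_degree D = int d" "c = lin_equiv \<Gamma> `` {D}"
     "rank_ge (int r) (int d) (\<lambda>L. \<Phi> L D)" by blast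
  then have "int r \<le> div_rank \<Gamma> D" using div_rank_ge_iff by simp
  moreover have "D \<in> c" using D by (simp add: lin_equiv_iff)
  moreover have "c \<in> Pic \<Gamma> d" unfolding Pic_def quotient_def using D by auto
  ultimately show "c \<in> W \<Gamma> r d" unfolding W_def by blast
qed

text \<open>One chip on every loop realises arbitrary coordinates. The degree is then corrected by a
  multiple of one point, whose effect on the coordinates is compensated beforehand.\<close>

lemma divisor_exists:
  "\<exists>D. Poly_Mapping.keys D \<subseteq> \<Gamma> \<and> div_degree D = d \<and> (\<forall>L\<in>\<L>. eqm L (\<Phi> L D) (\<phi> L))"
proof -
  obtain p where p: "p \<in> \<Gamma>" using graph_nonempty by blast
  define N where "N = int (card \<L>) - d"
  obtain D where D: "Poly_Mapping.keys D \<subseteq> \<Gamma>" "div_degree D = (\<Sum>L\<in>\<L>. int 1)"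
    "\<forall>L\<in>\<L>. eqm L (\<Phi> L D) (\<phi> L + of_int N * \<theta> L p)"
    using effective_realize[of "\<lambda>_. 1" "\<lambda>L. \<phi> L + of_int N * \<theta> L p"] by auto
  define D' where "D' = D - Poly_Mapping.single p N"
  have "Poly_Mapping.keys D' \<subseteq> \<Gamma>" unfolding D'_def using D p by (intro keys_diff_subset) auto
  moreover have "div_degree D' = d" using D(2) by (simp add: D'_def div_degree_diff div_degree_single N_def)
  moreover have "eqm L (\<Phi> L D') (\<phi> L)" if "L \<in> \<L>" for L
    using eqm_diff[of L "\<Phi> L D" "\<phi> L + of_int N * \<theta> L p" "of_int N * \<theta> L p" "of_int N * \<theta> L p"] D(3) that
    by (simp add: D'_def \<Phi>_diff \<Phi>_single)
  ultimately show ?thesis by blast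
qed

lemma translate_jacobian_class:
  assumes h: "real_cycle \<Gamma> h" "coefs h x" and D: "Poly_Mapping.keys D \<subseteq> \<Gamma>"
  shows "D' \<in> (+) D ` jacobian_class \<Gamma> h \<longleftrightarrow> Poly_Mapping.keys D' \<subseteq> \<Gamma> \<and> div_degree D' = div_degree D \<and>
    (\<forall>L\<in>\<L>. eqm L (\<Phi> L D') (\<Phi> L D + x L * len L))"
proof -
  have shift: "eqm L (a - b) c \<longleftrightarrow> eqm L a (b + c)" for L a b c by (simp add: eqm_def algebra_simps)
  have "D' \<in> (+) D ` jacobian_class \<Gamma> h \<longleftrightarrow> D' - D \<in> jacobian_class \<Gamma> h"
    by (force simp: image_iff)
  also have "\<dots> \<longleftrightarrow> Poly_Mapping.keys (D' - D) \<subseteq> \<Gamma> \<and> div_degree D' - div_degree D = 0 \<and>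
      (\<forall>L\<in>\<L>. eqm L (\<Phi> L D') (\<Phi> L D + x L * len L))"
    unfolding jacobian_class_iff[OF h] div_degree_diff \<Phi>_diff shift ..
  also have "Poly_Mapping.keys (D' - D) \<subseteq> \<Gamma> \<longleftrightarrow> Poly_Mapping.keys D' \<subseteq> \<Gamma>"
    using keys_diff_subset[OF _ D, of D'] keys_add_subset[of "D' - D" \<Gamma> D] D by auto
  finally show ?thesis by simp
qed

lemma cell_in_W_iff:
  assumes h: "real_cycle \<Gamma> h" "coefs h x" and D: "Poly_Mapping.keys D \<subseteq> \<Gamma>"
  shows "(+) D ` jacobian_class \<Gamma> h \<in> W \<Gamma> r d \<longleftrightarrow>
    div_degree D = int d \<and> rank_ge (int r) (int d) (\<lambda>L. \<Phi> L D + x L * len L)"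
proof
  assume "(+) D ` jacobian_class \<Gamma> h \<in> W \<Gamma> r d"
  then obtain D' where D': "Poly_Mapping.keys D' \<subseteq> \<Gamma>" "div_degree D' = int d"
    "(+) D ` jacobian_class \<Gamma> h = lin_equiv \<Gamma> `` {D'}" "rank_ge (int r) (int d) (\<lambda>L. \<Phi> L D')"
    unfolding W_iff by blast
  have "D' \<in> (+) D ` jacobian_class \<Gamma> h" unfolding D'(3) using D'(1) by (simp add: lin_equiv_iff)
  then have "div_degree D' = div_degree D" "\<And>L. L \<in> \<L> \<Longrightarrow> eqm L (\<Phi> L D') (\<Phi> L D + x L * len L)"
    unfolding translate_jacobian_class[OF h D] by auto
  then show "div_degree D = int d \<and> rank_ge (int r) (int d) (\<lambda>L. \<Phi> L D + x L * len L)"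
    using D'(2) rank_ge_cong[OF D'(4)] by simp
next
  assume R: "div_degree D = int d \<and> rank_ge (int r) (int d) (\<lambda>L. \<Phi> L D + x L * len L)"
  obtain D' where D': "Poly_Mapping.keys D' \<subseteq> \<Gamma>" "div_degree D' = int d"
    "\<And>L. L \<in> \<L> \<Longrightarrow> eqm L (\<Phi> L D') (\<Phi> L D + x L * len L)"
    using divisor_exists[of "int d" "\<lambda>L. \<Phi> L D + x L * len L"] by blast
  have "rank_ge (int r) (int d) (\<lambda>L. \<Phi> L D')"
    by (rule rank_ge_cong[OF conjunct2[OF R]]) (rule eqm_sym[OF D'(3)])
  moreover have "(+) D ` jacobian_class \<Gamma> h = lin_equiv \<Gamma> `` {D'}"
  proof (rule Set.set_eqI)
    fix D''
    have "(\<forall>L\<in>\<L>. eqm L (\<Phi> L D'') (\<Phi> L D + x L * len L)) \<longleftrightarrow> (\<forall>L\<in>\<L>. eqm L (\<Phi> L D') (\<Phi> L D''))"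
      using eqm_trans[OF D'(3)] eqm_trans[OF eqm_sym[OF D'(3)]] eqm_sym by blast
    then show "D'' \<in> (+) D ` jacobian_class \<Gamma> h \<longleftrightarrow> D'' \<in> lin_equiv \<Gamma> `` {D'}"
      unfolding translate_jacobian_class[OF h D] Image_singleton_iff lin_equiv_iff using D'(1,2) R by auto
  qed
  ultimately show "(+) D ` jacobian_class \<Gamma> h \<in> W \<Gamma> r d" unfolding W_iff using D' by blast
qed

definition indep :: "nat \<Rightarrow> (nat \<Rightarrow> 'a set \<Rightarrow> real) \<Rightarrow> bool" where
  "indep k w \<longleftrightarrow> (\<forall>x. (\<forall>L\<in>\<L>. (\<Sum>i<k. x i * w i L) = 0) \<longrightarrow> (\<forall>i<k. x i = 0))"

lemma real_cycle_lin_comb: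
  assumes "\<And>i. i < k \<Longrightarrow> real_cycle \<Gamma> (v i)"
  shows "real_cycle \<Gamma> (lin_comb k x v)"
proof -
  have "\<forall>i<k. \<exists>w. coefs (v i) w" using assms cycle_coefs by blast
  then obtain w where w: "\<And>i. i < k \<Longrightarrow> coefs (v i) (w i)" by metis
  have c: "coefs (lin_comb k x v) (\<lambda>L. \<Sum>i<k. x i * w i L)" using coefs_lin_comb[OF w] .
  define h where "h = lin_comb k x v"
  have cs: "chain_slopes h (\<lambda>p d. sg (snd d) * (\<Sum>i<k. x i * w i (fst d)))" using c by (simp add: coefs_def h_def)
  have "real_chain \<Gamma> h"
    unfolding real_chain_def
  proof (intro ballI conjI)
    fix p assume p: "p \<in> \<Gamma>"
    show "h p p = 0" using cs p by (simp add: chain_slopes_def)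
    show "\<exists>n m. local_slopes \<Gamma> (h p) p n m"
      using cs p local_slopes_of_dslopes[OF p] unfolding chain_slopes_def by blast
    have "\<forall>\<^sub>F q in at p within \<Gamma>. \<forall>i\<in>{..<k}. \<forall>\<^sub>F y in at q within \<Gamma>. v i q y = v i p y - v i p q"
      using assms p unfolding real_cycle_def real_chain_def by (intro eventually_ball_finite) auto
    then have "\<forall>\<^sub>F q in at p within \<Gamma>. \<forall>\<^sub>F y in at q within \<Gamma>. \<forall>i\<in>{..<k}. v i q y = v i p y - v i p q"
      by (rule eventually_mono) (intro eventually_ball_finite, auto)
    then show "\<forall>\<^sub>F q in at p within \<Gamma>. \<forall>\<^sub>F y in at q within \<Gamma>. h q y = h p y - h p q"
    proof (rule eventually_mono)
      fix q assume "\<forall>\<^sub>F y in at q within \<Gamma>. \<forall>i\<in>{..<k}. v i q y = v i p y - v i p q"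
      then show "\<forall>\<^sub>F y in at q within \<Gamma>. h q y = h p y - h p q"
        by (rule eventually_mono)
          (simp add: h_def lin_comb_def sum_subtractf[symmetric] right_diff_distrib)
    qed
  qed
  moreover have "ord_at \<Gamma> (h p) p = 0" if "p \<in> \<Gamma>" for p
    using ord_chain[OF cs that] by (simp add: jump_def sg_def)
  ultimately show ?thesis by (simp add: real_cycle_def h_def)
qed

text \<open>By the Abel-Jacobi theorem, cells become simplices in the space of coordinates: the
  divisor provides the base point \<open>\<phi>\<close>, and a cycle with coefficients
  \<open>w i\<close> moves the coordinate at \<open>L\<close> in proportion to
  \<open>w i L * len L\<close>.\<close>

lemma contains_cell_W_iff:
  "contains_cell \<Gamma> (W \<Gamma> r d) k \<longleftrightarrow> (\<exists>\<phi> w. indep k w \<and>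
     (\<forall>x. (\<forall>i<k. 0 \<le> x i) \<and> (\<Sum>i<k. x i) \<le> 1 \<longrightarrow>
        rank_ge (int r) (int d) (\<lambda>L. \<phi> L + (\<Sum>i<k. x i * w i L) * len L)))"
proof
  assume "contains_cell \<Gamma> (W \<Gamma> r d) k"
  then obtain D v where D: "Poly_Mapping.keys D \<subseteq> \<Gamma>" and v: "independent_cycles \<Gamma> k v"
    and cell: "\<And>x. (\<forall>i<k. 0 \<le> x i) \<and> (\<Sum>i<k. x i) \<le> 1 \<Longrightarrow> (+) D ` jacobian_class \<Gamma> (lin_comb k x v) \<in> W \<Gamma> r d"
    unfolding contains_cell_def by auto
  have "\<forall>i<k. \<exists>w. real_cycle \<Gamma> (v i) \<and> coefs (v i) w"
    using v cycle_coefs by (auto simp: independent_cycles_def)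
  then obtain w where w: "\<And>i. i < k \<Longrightarrow> real_cycle \<Gamma> (v i) \<and> coefs (v i) (w i)" by metis
  have "rank_ge (int r) (int d) (\<lambda>L. \<Phi> L D + (\<Sum>i<k. x i * w i L) * len L)"
    if "(\<forall>i<k. 0 \<le> x i) \<and> (\<Sum>i<k. x i) \<le> 1" for x
    using cell[OF that] cell_in_W_iff[OF real_cycle_lin_comb coefs_lin_comb D, of k v w x r d] w by blast
  moreover have "indep k w" using v independent_cycles_iff[of k v w] w unfolding indep_def by blast
  ultimately show "\<exists>\<phi> w. indep k w \<and> (\<forall>x. (\<forall>i<k. 0 \<le> x i) \<and> (\<Sum>i<k. x i) \<le> 1 \<longrightarrow>
        rank_ge (int r) (int d) (\<lambda>L. \<phi> L + (\<Sum>i<k. x i * w i L) * len L))"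
    by (intro exI[of _ "\<lambda>L. \<Phi> L D"] exI[of _ w]) simp
next
  assume "\<exists>\<phi> w. indep k w \<and> (\<forall>x. (\<forall>i<k. 0 \<le> x i) \<and> (\<Sum>i<k. x i) \<le> 1 \<longrightarrow>
        rank_ge (int r) (int d) (\<lambda>L. \<phi> L + (\<Sum>i<k. x i * w i L) * len L))"
  then obtain \<phi> w where w: "indep k w" and cell: "\<And>x. (\<forall>i<k. 0 \<le> x i) \<and> (\<Sum>i<k. x i) \<le> 1 \<Longrightarrow>
        rank_ge (int r) (int d) (\<lambda>L. \<phi> L + (\<Sum>i<k. x i * w i L) * len L)" by blast
  obtain D where D: "Poly_Mapping.keys D \<subseteq> \<Gamma>" "div_degree D = int d" "\<And>L. L \<in> \<L> \<Longrightarrow> eqm L (\<Phi> L D) (\<phi> L)"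
    using divisor_exists[of "int d" \<phi>] by blast
  have "\<forall>i. \<exists>h. real_cycle \<Gamma> h \<and> coefs h (w i)" using cycle_exists by blast
  then obtain v where v: "\<And>i. real_cycle \<Gamma> (v i) \<and> coefs (v i) (w i)" by metis
  have "(+) D ` jacobian_class \<Gamma> (lin_comb k x v) \<in> W \<Gamma> r d" if x: "(\<forall>i<k. 0 \<le> x i) \<and> (\<Sum>i<k. x i) \<le> 1" for x
  proof -
    have "rank_ge (int r) (int d) (\<lambda>L. \<Phi> L D + (\<Sum>i<k. x i * w i L) * len L)"
      by (rule rank_ge_cong[OF cell[OF x]]) (rule eqm_add[OF eqm_sym[OF D(3)] eqm_refl])
    then show ?thesis
      using cell_in_W_iff[OF real_cycle_lin_comb coefs_lin_comb D(1), of k v w x r d] v D(2) by blast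
  qed
  moreover have "independent_cycles \<Gamma> k v" using w independent_cycles_iff[of k v w] v unfolding indep_def by blast
  ultimately show "contains_cell \<Gamma> (W \<Gamma> r d) k" unfolding contains_cell_def using D(1)
    by (intro bexI[of _ D] exI[of _ v]) simp_all
qed

lemma contains_cell_le: "contains_cell \<Gamma> S k \<Longrightarrow> k \<le> card \<L>"
  unfolding contains_cell_def using independent_cycles_le by blast

lemma W_empty_iff: "W \<Gamma> r d = {} \<longleftrightarrow> (\<forall>\<phi>. \<not> rank_ge (int r) (int d) \<phi>)"
proof
  assume W: "W \<Gamma> r d = {}"
  show "\<forall>\<phi>. \<not> rank_ge (int r) (int d) \<phi>"
  proof (intro allI notI)
    fix \<phi> assume R: "rank_ge (int r) (int d) \<phi>"
    obtain D where D: "Poly_Mapping.keys D \<subseteq> \<Gamma>" "div_degree D = int d" "\<And>L. L \<in> \<L> \<Longrightarrow> eqm L (\<Phi> L D) (\<phi> L)"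
      using divisor_exists[of "int d" \<phi>] by blast
    have "rank_ge (int r) (int d) (\<lambda>L. \<Phi> L D)" by (rule rank_ge_cong[OF R]) (rule eqm_sym[OF D(3)])
    then have "lin_equiv \<Gamma> `` {D} \<in> W \<Gamma> r d" unfolding W_iff using D by blast
    then show False using W by blast
  qed
qed (use W_iff in blast)

lemma polyhedral_dim_eqI:
  assumes "contains_cell \<Gamma> (W \<Gamma> r d) k" "\<And>l. contains_cell \<Gamma> (W \<Gamma> r d) l \<Longrightarrow> l \<le> k"
  shows "polyhedral_dim \<Gamma> (W \<Gamma> r d) = int k"
proof -
  \<comment> \<open>The vertex of the simplex at the origin shows that the locus is
    nonempty.\<close>
  have "(\<forall>i<k. 0 \<le> (\<lambda>_::nat. 0 :: real) i) \<and> (\<Sum>i<k. (\<lambda>_::nat. 0 :: real) i) \<le> 1" by simp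
  then have "W \<Gamma> r d \<noteq> {}" using assms(1) unfolding contains_cell_def by (metis empty_iff)
  moreover have "(GREATEST k. contains_cell \<Gamma> (W \<Gamma> r d) k) = k" using assms by (intro Greatest_equality)
  ultimately show ?thesis by (simp add: polyhedral_dim_def)
qed

lemma polyhedral_dim_ge:
  assumes "contains_cell \<Gamma> (W \<Gamma> r d) k" shows "int k \<le> polyhedral_dim \<Gamma> (W \<Gamma> r d)"
proof -
  have "(\<forall>i<k. 0 \<le> (\<lambda>_::nat. 0 :: real) i) \<and> (\<Sum>i<k. (\<lambda>_::nat. 0 :: real) i) \<le> 1" by simp
  then have "W \<Gamma> r d \<noteq> {}" using assms unfolding contains_cell_def by (metis empty_iff)
  moreover have "k \<le> (GREATEST k. contains_cell \<Gamma> (W \<Gamma> r d) k)"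
    using contains_cell_le assms by (intro Greatest_le_nat)
  ultimately show ?thesis by (simp add: polyhedral_dim_def)
qed

text \<open>If fixing the coordinates outside \<open>T\<close> already guarantees the rank, the
  coordinates in \<open>T\<close> move freely, and the unit vectors of \<open>T\<close> span a
  cell.\<close>

lemma loop_cell:
  assumes T: "T \<subseteq> \<L>" and R: "\<And>\<psi>. (\<And>L. L \<in> \<L> - T \<Longrightarrow> \<psi> L = \<phi> L) \<Longrightarrow> rank_ge (int r) (int d) \<psi>"
  shows "contains_cell \<Gamma> (W \<Gamma> r d) (card T)"
proof -
  obtain e where e: "bij_betw e {..<card T} T"
    using ex_bij_betw_nat_finite[of T] finite_subset[OF T finite_loops] by (auto simp: lessThan_atLeast0)
  define w where "w i L = (if L = e i then 1 else 0 :: real)" for i L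
  have eT: "e i \<in> T" if "i < card T" for i using e that by (auto simp: bij_betw_def)
  have "indep (card T) w"
    unfolding indep_def
  proof (intro allI impI)
    fix x :: "nat \<Rightarrow> real" and i assume x: "\<forall>L\<in>\<L>. (\<Sum>i<card T. x i * w i L) = 0" and i: "i < card T"
    have "(\<Sum>j<card T. x j * w j (e i)) = 0" using x eT[OF i] T by blast
    moreover have "(\<Sum>j<card T. x j * w j (e i)) = (\<Sum>j<card T. if j = i then x j else 0)"
      using e i by (intro sum.cong) (auto simp: bij_betw_def inj_on_def w_def)
    ultimately show "x i = 0" using i by simp
  qed
  moreover have "rank_ge (int r) (int d) (\<lambda>L. \<phi> L + (\<Sum>i<card T. x i * w i L) * len L)" for x
  proof (rule R)
    fix L assume "L \<in> \<L> - T"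
    then have "(\<Sum>i<card T. x i * w i L) = 0" using eT by (intro sum.neutral) (auto simp: w_def)
    then show "\<phi> L + (\<Sum>i<card T. x i * w i L) * len L = \<phi> L" by simp
  qed
  ultimately show ?thesis unfolding contains_cell_W_iff by blast
qed

text \<open>With a chip on every loop no congruence is imposed; one loop takes the surplus.\<close>

lemma eff_class_large:
  assumes "int (card \<L>) \<le> d" shows "eff_class d \<phi>"
proof -
  obtain M where M: "M \<in> \<L>" using loops_ne by blast
  define n where "n L = 1 + (if L = M then nat (d - int (card \<L>)) else 0)" for L
  have "(\<Sum>L\<in>\<L>. int (n L)) = (\<Sum>L\<in>\<L>. 1 + (if L = M then d - int (card \<L>) else 0))"
    using assms by (intro sum.cong) (auto simp: n_def)
  then have "(\<Sum>L\<in>\<L>. int (n L)) = d" using M finite_loops by (simp add: sum.distrib)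
  then show ?thesis unfolding eff_class_def by (intro exI[of _ n]) (simp add: n_def)
qed

lemma contains_cell_large:
  assumes "int (card \<L>) \<le> int d - int r"
  shows "contains_cell \<Gamma> (W \<Gamma> r d) (card \<L>)"
  by (rule loop_cell) (auto simp: rank_ge_def intro: eff_class_large[OF assms])

section \<open>Loops with three neighbours\<close>

lemma coord_eq_of_meet:
  assumes "L \<in> \<L>" "M \<in> \<L>" "N \<in> \<L>" "L \<noteq> M" "L \<noteq> N" "M \<inter> N \<noteq> {}"
  shows "coord L M = coord L N"
proof -
  obtain x where "x \<in> M" "x \<in> N" using assms(6) by blast
  then show ?thesis using \<theta>_coord[OF assms(1,2,4)] \<theta>_coord[OF assms(1,3,5)] by metis
qed

text \<open>\<open>proj_off_branch\<close> in terms of the coordinates of whole loops.\<close>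

lemma coord_off_branch:
  assumes "L \<in> \<L>" "M \<in> \<L>" "N \<in> \<L>" "L \<noteq> M" "N \<noteq> L" "N \<noteq> M" and ne: "coord L N \<noteq> coord L M"
  shows "coord M N = coord M L"
proof -
  obtain y where y: "y \<in> N" using loop_nonempty[OF assms(3)] by blast
  have "\<theta> L y = coord L N" using \<theta>_coord[OF assms(1,3) _ y] assms(5) by simp
  have "\<rho> L y \<noteq> att L M"
  proof
    assume "\<rho> L y = att L M"
    then have "\<rho> L y = \<rho> L (att L M)" using proj_id att_in assms by simp
    then have "\<theta> L y = \<theta> L (att L M)" by (rule \<theta>_cong)
    then show False using ne \<open>\<theta> L y = coord L N\<close> by (simp add: coord_def)
  qed
  then have "\<rho> M y = att M L" using proj_off_branch[OF assms(1,2,4)] y loop_subset[OF assms(3)] by blast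
  then have "\<rho> M y = \<rho> M (att M L)" using proj_id att_in assms by simp
  then have "\<theta> M y = \<theta> M (att M L)" by (rule \<theta>_cong)
  then show ?thesis using \<theta>_coord[OF assms(2,3) _ y] assms(6) by (simp add: coord_def)
qed

lemma outer_upd:
  assumes "L \<in> \<L>" "M \<in> \<L>" "L \<noteq> M"
  shows "outer L (n(M := m)) = outer L n + (real m - real (n M)) * coord L M"
proof -
  have "outer L (n(M := m)) = (\<Sum>N\<in>\<L>-{L}. real (n N) * coord L N + (if N = M then (real m - real (n M)) * coord L M else 0))"
    unfolding outer_def by (intro sum.cong) (auto simp: algebra_simps)
  then show ?thesis using assms finite_loops by (simp add: sum.distrib outer_def)
qed

lemma sum_upd:
  assumes "M \<in> \<L>"
  shows "(\<Sum>L\<in>\<L>. int ((n(M := m)) L)) = (\<Sum>L\<in>\<L>. int (n L)) + int m - int (n M)"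
proof -
  have "(\<Sum>L\<in>\<L>. int ((n(M := m)) L)) = (\<Sum>L\<in>\<L>. int (n L) + (if L = M then int m - int (n M) else 0))"
    by (intro sum.cong) auto
  then show ?thesis using assms finite_loops by (simp add: sum.distrib)
qed

text \<open>Three chips on a loop \<open>C\<close> have rank 2 there, so any two of them can be moved to the point where
  one of the three neighbours in \<open>N\<close> is attached, and then moved freely along that neighbour. Hence
  the neighbours need no chips of their own for the divisor to have rank 1.\<close>

lemma contains_cell_three_neighbours:
  assumes C: "C \<in> \<L>" and N: "N \<subseteq> \<L>" "C \<notin> N" "card N = 3" and CN: "\<And>L. L \<in> N \<Longrightarrow> L \<inter> C \<noteq> {}"
  shows "contains_cell \<Gamma> (W \<Gamma> 1 (card \<L> - 1)) (card \<L> - 3)"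
proof -
  define g where "g = card \<L>"
  have finN: "finite N" using N finite_loops finite_subset by blast
  have "card (insert C N) \<le> g" unfolding g_def using C N finite_loops by (intro card_mono) auto
  then have g4: "4 \<le> g" using N finN by simp
  \<comment> \<open>Three chips on \<open>C\<close>, none on the three neighbours and one on each of
    the other \<open>g - 4\<close> loops: \<open>g - 1\<close> chips in all, with a coordinate
    prescribed only at the neighbours.\<close>
  define n0 where "n0 L = (if L \<in> N then 0 else if L = C then 3 else 1 :: nat)" for L
  have "(\<Sum>L\<in>\<L>. int (n0 L)) = (\<Sum>L\<in>\<L>. 1 + (if L = C then 2 else 0) - (if L \<in> N then 1 else 0))"
    using N(2) by (intro sum.cong) (auto simp: n0_def)
  also have "\<dots> = int g + 2 - (\<Sum>L\<in>\<L>. if L \<in> N then 1 else 0)"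
    using finite_loops C by (simp add: sum.distrib sum_subtractf g_def)
  also have "(\<Sum>L\<in>\<L>. if L \<in> N then 1 else 0 :: int) = 3"
    using N finite_loops by (simp add: sum.If_cases Int_absorb1)
  finally have sum0: "(\<Sum>L\<in>\<L>. int (n0 L)) = int g - 1" by simp
  define \<phi> where "\<phi> L = outer L n0" for L
  have "rank_ge (int 1) (int (g - 1)) \<psi>" if \<psi>: "\<And>L. L \<in> \<L> - (\<L> - N) \<Longrightarrow> \<psi> L = \<phi> L" for \<psi>
    unfolding rank_ge_def
  proof (intro allI impI)
    fix E assume E: "Poly_Mapping.keys E \<subseteq> \<Gamma> \<and> effective E \<and> div_degree E = int 1"
    obtain e where e: "(\<Sum>L\<in>\<L>. int (e L)) = 1" "\<And>L. L \<in> \<L> \<Longrightarrow> e L = 0 \<Longrightarrow> \<Phi> L E = outer L e"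
      using effective_profile[of E] E by auto
    have "(\<Sum>L\<in>\<L>. e L) = 1" using e(1) by (metis of_nat_1 of_nat_eq_iff of_nat_sum)
    then obtain K where K: "K \<in> \<L>" "e K = 1" "\<And>L. L \<in> \<L> \<Longrightarrow> L \<noteq> K \<Longrightarrow> e L = 0"
      using sum_eq_1_iff[OF finite_loops] by auto
    have \<Phi>E: "\<Phi> L E = coord L K" if L: "L \<in> \<L>" "L \<noteq> K" for L
    proof -
      have "outer L e = (\<Sum>M\<in>\<L>-{L}. if M = K then coord L M else 0)"
        unfolding outer_def using K by (intro sum.cong) auto
      also have "\<dots> = coord L K" using K L finite_loops by simp
      finally show ?thesis using e(2)[OF L(1) K(3)[OF L]] by simp
    qed
    have \<psi>N: "\<psi> L = outer L n0" if "L \<in> N" for L using \<psi>[of L] that N by (auto simp: \<phi>_def)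
    have deg: "int (g - 1) - int 1 = int g - 2" using g4 by simp
    have n0C: "n0 C = 3" using N(2) by (simp add: n0_def)
    show "eff_class (int (g - 1) - int 1) (\<lambda>L. \<psi> L - \<Phi> L E)"
    proof (cases "\<forall>L\<in>N. L \<noteq> K \<and> coord L K = coord L C")
      case True
      \<comment> \<open>Every neighbour sees the removed chip on the side of \<open>C\<close>, so
        one of the three chips of \<open>C\<close> pays for it.\<close>
      define n where "n = n0(C := 2)"
      have "(\<Sum>L\<in>\<L>. int (n L)) = int g - 2" unfolding n_def sum_upd[OF C] sum0 n0C by simp
      moreover have "eqm L (\<psi> L - \<Phi> L E) (outer L n)" if L: "L \<in> \<L>" "n L = 0" for L
      proof -
        have LN: "L \<in> N" "L \<noteq> C" using L N(2) by (auto simp: n_def n0_def split: if_splits)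
        have "outer L n = outer L n0 - coord L C" unfolding n_def outer_upd[OF L(1) C LN(2)] n0C by simp
        then show ?thesis using \<psi>N[OF LN(1)] \<Phi>E[OF L(1)] True LN(1) by simp
      qed
      ultimately show ?thesis unfolding deg eff_class_def by blast
    next
      case False
      then obtain L1 where L1: "L1 \<in> N" "L1 = K \<or> coord L1 K \<noteq> coord L1 C" by blast
      have L1': "L1 \<in> \<L>" "L1 \<noteq> C" "n0 L1 = 0" using L1 N by (auto simp: n0_def)
      \<comment> \<open>The removed chip lies on the neighbour \<open>L1\<close> or behind it. One
        chip of \<open>C\<close> moves onto \<open>L1\<close> and lifts the condition there, one
        pays for the removal, and one stays.\<close>
      define n where "n = n0(C := 1, L1 := 1)"
      have "(\<Sum>L\<in>\<L>. int (n L)) = int g - 2"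
        unfolding n_def sum_upd[OF L1'(1)] sum_upd[OF C] sum0 using n0C L1'(2,3) by simp
      moreover have "eqm L (\<psi> L - \<Phi> L E) (outer L n)" if L: "L \<in> \<L>" "n L = 0" for L
      proof -
        have LN: "L \<in> N" "L \<noteq> C" "L \<noteq> L1" using L N(2) by (auto simp: n_def n0_def split: if_splits)
        have LL1: "coord L L1 = coord L C"
          using coord_eq_of_meet[OF L(1) L1'(1) C LN(3,2) CN[OF L1(1)]] .
        have L1L: "coord L1 L = coord L1 C"
          using coord_eq_of_meet[OF L1'(1) L(1) C _ L1'(2) CN[OF LN(1)]] LN(3) by simp
        \<comment> \<open>The other neighbours see both \<open>L1\<close> and the removed chip on
          the side of \<open>C\<close>, so their conditions change as in the first case.\<close>
        have K': "L \<noteq> K \<and> coord L K = coord L C"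
        proof (cases "L1 = K")
          case True
          then show ?thesis using LL1 LN by simp
        next
          case False
          then have ne: "coord L1 K \<noteq> coord L1 L" using L1 L1L by simp
          then have "L \<noteq> K" by auto
          then show ?thesis
            using coord_off_branch[OF L1'(1) L(1) K(1)] LN(3) False ne LL1 by auto
        qed
        have "outer L n = outer L n0 - 2 * coord L C + coord L L1"
          unfolding n_def outer_upd[OF L(1) L1'(1) LN(3)] outer_upd[OF L(1) C LN(2)] using n0C L1'(2,3) by simp
        then show ?thesis using \<psi>N[OF LN(1)] \<Phi>E[OF L(1)] K' LL1 by simp
      qed
      ultimately show ?thesis unfolding deg eff_class_def by blast
    qed
  qed
  then have "contains_cell \<Gamma> (W \<Gamma> 1 (g - 1)) (card (\<L> - N))"
    using loop_cell[of "\<L> - N" \<phi> 1 "g - 1"] by blast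
  moreover have "card (\<L> - N) = g - 3" using N finN by (simp add: card_Diff_subset g_def)
  ultimately show ?thesis by (simp add: g_def)
qed

lemma not_general_three_neighbours:
  assumes C: "C \<in> \<L>" and N: "N \<subseteq> \<L>" "C \<notin> N" "card N = 3" and CN: "\<And>L. L \<in> N \<Longrightarrow> L \<inter> C \<noteq> {}"
  shows "\<not> brill_noether_general \<Gamma>"
proof
  assume BN: "brill_noether_general \<Gamma>"
  define g where "g = card \<L>"
  have finN: "finite N" using N finite_loops finite_subset by blast
  have "card (insert C N) \<le> g" unfolding g_def using C N finite_loops by (intro card_mono) auto
  then have g4: "4 \<le> g" using N finN by simp
  have bn: "bn_number g 1 (g - 1) = int g - 4" using g4 by (simp add: bn_number_def of_nat_diff)
  then have "bn_number (genus \<Gamma>) 1 (g - 1) \<ge> 0" using g4 by (simp add: genus_eq g_def)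
  then have "polyhedral_dim \<Gamma> (W \<Gamma> 1 (g - 1)) = min (bn_number g 1 (g - 1)) (int g)"
    using BN unfolding brill_noether_general_def genus_eq g_def by blast
  moreover have "int (g - 3) \<le> polyhedral_dim \<Gamma> (W \<Gamma> 1 (g - 1))"
    using polyhedral_dim_ge[OF contains_cell_three_neighbours[OF assms]] by (simp add: g_def)
  ultimately show False using bn g4 by (simp add: of_nat_diff)
qed

section \<open>Dimension of unions of translated coordinate subspaces\<close>

text \<open>A curve \<open>t \<mapsto> (t, t\<^sup>2, \<dots>, t\<^sup>k) / k\<close> in the simplex meets every hyperplane in finitely many
  points only, so a generic point of it avoids countably many hyperplanes.\<close>

lemma indep_coordinate_bound:
  assumes ind: "indep k w" and cnt: "\<And>L. L \<in> \<L> \<Longrightarrow> countable (T L)"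
    and N: "\<And>x. (\<forall>i<k. 0 \<le> x i) \<and> (\<Sum>i<k. x i) \<le> 1 \<Longrightarrow>
      N \<le> card {L \<in> \<L>. \<phi> L + (\<Sum>i<k. x i * w i L) * len L \<in> T L}"
  shows "k + N \<le> card \<L>"
proof -
  \<comment> \<open>The coordinates that vary on the simplex. Independence forces at least
    \<open>k\<close> of them, and at a generic point of the simplex none of them lies in its
    countable set, so the \<open>N\<close> special coordinates are among the others.\<close>
  define G where "G = {L \<in> \<L>. \<exists>i<k. w i L \<noteq> 0}"
  have finG: "finite G" "G \<subseteq> \<L>" using finite_loops by (auto simp: G_def)
  have "k \<le> card G"
  proof (rule ccontr)
    assume "\<not> k \<le> card G"
    then obtain x where x: "\<exists>i\<in>{..<k}. x i \<noteq> 0" "\<forall>L\<in>G. (\<Sum>i<k. x i * w i L) = 0"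
      using underdetermined_system[OF finG(1), of "{..<k}" w] by auto
    have "(\<Sum>i<k. x i * w i L) = 0" if "L \<in> \<L>" for L
    proof (cases "L \<in> G")
      case False
      then show ?thesis using that by (intro sum.neutral) (auto simp: G_def)
    qed (use x in auto)
    then show False using ind x(1) unfolding indep_def by blast
  qed
  moreover have "N \<le> card (\<L> - G)"
  proof (cases "k = 0")
    case True
    then have "G = {}" by (auto simp: G_def)
    have "N \<le> card {L \<in> \<L>. \<phi> L + (\<Sum>i<k. (\<lambda>_. 0) i * w i L) * len L \<in> T L}" by (rule N) (simp add: True)
    also have "\<dots> \<le> card \<L>" using finite_loops by (intro card_mono) auto
    finally show ?thesis using \<open>G = {}\<close> by simp
  next
    case False
    \<comment> \<open>Division by \<open>k\<close> keeps the curve inside the simplex for parameters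
      between 0 and 1.\<close>
    define x where "x t i = t ^ Suc i / real k" for t and i :: nat
    define B where "B L = {t. \<phi> L + (\<Sum>i<k. x t i * w i L) * len L \<in> T L}" for L
    have "countable (B L)" if L: "L \<in> G" for L
    proof -
      have L': "L \<in> \<L>" using L finG by blast
      have "finite {t. \<phi> L + (\<Sum>i<k. x t i * w i L) * len L = y}" for y
      proof -
        \<comment> \<open>Along the curve the coordinate at \<open>L\<close> is a polynomial in
          \<open>t\<close>; a nonzero \<open>w i L\<close> makes it nonconstant.\<close>
        define c where "c i = (case i of 0 \<Rightarrow> \<phi> L - y | Suc j \<Rightarrow> w j L * len L / real k)" for i
        have eq: "\<phi> L + (\<Sum>i<k. x t i * w i L) * len L - y = (\<Sum>i\<le>k. c i * t ^ i)" for t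
        proof -
          have "(\<Sum>i\<le>k. c i * t ^ i) = c 0 + (\<Sum>i<k. c (Suc i) * t ^ Suc i)"
            by (simp add: sum.atMost_shift)
          moreover have "(\<Sum>i<k. x t i * w i L) * len L = (\<Sum>i<k. c (Suc i) * t ^ Suc i)"
            unfolding sum_distrib_right by (intro sum.cong) (auto simp: c_def x_def)
          moreover have "c 0 = \<phi> L - y" by (simp add: c_def)
          ultimately show ?thesis by simp
        qed
        obtain i where i: "i < k" "w i L \<noteq> 0" using L by (auto simp: G_def)
        then have "c (Suc i) \<noteq> 0" using len_pos[OF L'] False by (simp add: c_def)
        then have "\<exists>i\<le>k. c i \<noteq> 0" using i by (intro exI[of _ "Suc i"]) auto
        then have "finite {t. (\<Sum>i\<le>k. c i * t ^ i) = 0}" using polyfun_finite_roots[of c k] by blast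
        then show ?thesis unfolding eq[symmetric] by simp
      qed
      then have "countable (\<Union>y\<in>T L. {t. \<phi> L + (\<Sum>i<k. x t i * w i L) * len L = y})"
        using cnt[OF L'] by (intro countable_UN) (auto intro: countable_finite)
      moreover have "B L = (\<Union>y\<in>T L. {t. \<phi> L + (\<Sum>i<k. x t i * w i L) * len L = y})" by (auto simp: B_def)
      ultimately show ?thesis by simp
    qed
    then have "countable (\<Union>L\<in>G. B L)" using finG by (intro countable_UN) (auto intro: countable_finite)
    moreover have "uncountable {0..1::real}" using uncountable_closed_interval[of 0 "1::real"] by simp
    ultimately have "\<not> {0..1} \<subseteq> (\<Union>L\<in>G. B L)" using countable_subset by blast
    then obtain t where "t \<in> {0..1}" and t': "t \<notin> (\<Union>L\<in>G. B L)" by blast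
    then have t: "0 \<le> t" "t \<le> 1" by auto
    have "(\<Sum>i<k. x t i) \<le> (\<Sum>i<k. 1 / real k)"
    proof (intro sum_mono)
      fix i
      have "t ^ Suc i \<le> 1" using t by (rule power_le_one)
      then show "x t i \<le> 1 / real k" by (simp add: x_def divide_right_mono)
    qed
    then have "(\<forall>i<k. 0 \<le> x t i) \<and> (\<Sum>i<k. x t i) \<le> 1" using t False by (simp add: x_def)
    then have "N \<le> card {L \<in> \<L>. \<phi> L + (\<Sum>i<k. x t i * w i L) * len L \<in> T L}" by (rule N)
    also have "\<dots> \<le> card (\<L> - G)" using t' finite_loops by (intro card_mono) (auto simp: B_def)
    finally show ?thesis .
  qed
  moreover have "card (\<L> - G) = card \<L> - card G" "card G \<le> card \<L>"
    using finG finite_loops by (auto simp: card_Diff_subset card_mono)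
  ultimately show ?thesis by linarith
qed

end

section \<open>Paths of loops\<close>

text \<open>The \<open>j\<close>-th loop attaches to the side of the \<open>i\<close>-th loop with coordinate \<open>a i\<close> if \<open>i < j\<close>, and to
  the side with coordinate \<open>b i\<close> if \<open>j < i\<close>. On the first and on the last loop, one of the two
  coordinates is arbitrary.\<close>

locale loop_path = loop_tree +
  fixes xs :: "'a set list" and a b :: "nat \<Rightarrow> real"
  assumes dist_xs: "distinct xs" and set_xs: "set xs = \<L>"
    and coord_left: "\<And>i j. i < length xs \<Longrightarrow> j < i \<Longrightarrow> coord (xs ! i) (xs ! j) = b i"
    and coord_right: "\<And>i j. j < length xs \<Longrightarrow> i < j \<Longrightarrow> coord (xs ! i) (xs ! j) = a i"
    and vertex: "\<And>i. i \<le> length xs \<Longrightarrow> \<exists>v\<in>\<Gamma>. \<forall>j<length xs. eqm (xs ! j) (\<theta> (xs ! j) v) (if j < i then a j else b j)"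
    and generic: "\<And>i k :: nat. i < length xs \<Longrightarrow> 0 < k \<Longrightarrow> k \<le> 2 * length xs - 2 \<Longrightarrow>
      \<not> eqm (xs ! i) (real k * (a i - b i)) 0"
begin

lemma nth_xs: "i < length xs \<Longrightarrow> xs ! i \<in> \<L>"
  using set_xs nth_mem by blast

lemma bij_xs: "bij_betw ((!) xs) {..<length xs} \<L>"
  using bij_betw_nth[OF dist_xs refl set_xs[symmetric]] .

lemma card_xs: "card \<L> = length xs"
  using distinct_card[OF dist_xs] set_xs by simp

lemma sum_xs: "(\<Sum>L\<in>\<L>. F L) = (\<Sum>i<length xs. F (xs ! i))"
  using sum.reindex_bij_betw[OF bij_xs, of F] by simp

lemma loop_index: "L \<in> \<L> \<Longrightarrow> \<exists>i<length xs. L = xs ! i"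
  using set_xs by (metis in_set_conv_nth)

text \<open>A loop of a path has at most two branches, so only the numbers of chips to its left and
  to its right matter.\<close>

lemma outer_xs:
  assumes i: "i < length xs"
  shows "outer (xs ! i) n = real (\<Sum>j<i. n (xs ! j)) * b i + real (\<Sum>j\<in>{Suc i..<length xs}. n (xs ! j)) * a i"
proof -
  have "bij_betw ((!) xs) ({..<length xs} - {i}) (\<L> - {xs ! i})"
    using bij_betw_DiffI[OF bij_xs, of "{i}" "{xs ! i}"] i nth_xs[OF i] by (simp add: bij_betw_def)
  then have "outer (xs ! i) n = (\<Sum>j\<in>{..<length xs}-{i}. real (n (xs ! j)) * coord (xs ! i) (xs ! j))"
    unfolding outer_def using sum.reindex_bij_betw[of "(!) xs" _ _ "\<lambda>M. real (n M) * coord (xs ! i) M"] by simp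
  also have "{..<length xs} - {i} = {..<i} \<union> {Suc i..<length xs}" using i by auto
  also have "(\<Sum>j\<in>{..<i} \<union> {Suc i..<length xs}. real (n (xs ! j)) * coord (xs ! i) (xs ! j)) =
      (\<Sum>j<i. real (n (xs ! j)) * b i) + (\<Sum>j\<in>{Suc i..<length xs}. real (n (xs ! j)) * a i)"
    using i by (subst sum.union_disjoint) (auto intro!: sum.cong arg_cong2[of _ _ _ _ "(+)"] simp: coord_left coord_right)
  finally show ?thesis by (simp add: sum_distrib_right)
qed

lemma sum_split_index:
  fixes f :: "nat \<Rightarrow> int"
  assumes "i < g"
  shows "(\<Sum>j<g. f j) = (\<Sum>j<i. f j) + f i + (\<Sum>j\<in>{Suc i..<g}. f j)"
proof -
  have "{..<g} = {..<Suc i} \<union> {Suc i..<g}" using assms by auto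
  then have "(\<Sum>j<g. f j) = (\<Sum>j<Suc i. f j) + (\<Sum>j\<in>{Suc i..<g}. f j)"
    by (metis finite_atLeastLessThan finite_lessThan ivl_disj_int_one(2) sum.union_disjoint)
  then show ?thesis by simp
qed

subsection \<open>Necessary conditions\<close>

text \<open>\<open>lingers d \<phi> i t\<close>: with \<open>t\<close> chips left, the \<open>i\<close>-th loop can be passed without losing a chip.\<close>

definition lingers :: "int \<Rightarrow> ('a set \<Rightarrow> real) \<Rightarrow> nat \<Rightarrow> int \<Rightarrow> bool" where
  "lingers d \<phi> i t \<longleftrightarrow> eqm (xs ! i) (\<phi> (xs ! i)) (of_int t * a i + of_int (d - t) * b i)"

definition pass :: "int \<Rightarrow> ('a set \<Rightarrow> real) \<Rightarrow> nat \<Rightarrow> int \<Rightarrow> int" where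
  "pass d \<phi> i t = (if lingers d \<phi> i t then t else t - 1)"

lemma pass_mono: "s \<le> t \<Longrightarrow> pass d \<phi> i s \<le> pass d \<phi> i t"
  by (cases "s = t") (auto simp: pass_def)

text \<open>\<open>least_chips d \<phi> i k\<close> is the number of chips left before the \<open>i\<close>-th loop if an adversary has
  removed \<open>k\<close> chips at the vertices passed so far, in the worst possible way.\<close>

fun least_chips :: "int \<Rightarrow> ('a set \<Rightarrow> real) \<Rightarrow> nat \<Rightarrow> nat \<Rightarrow> int" where
  "least_chips d \<phi> 0 k = d - int k"
| "least_chips d \<phi> (Suc i) 0 = pass d \<phi> i (least_chips d \<phi> i 0)"
| "least_chips d \<phi> (Suc i) (Suc k) =
    min (pass d \<phi> i (least_chips d \<phi> i (Suc k))) (least_chips d \<phi> (Suc i) k - 1)"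

lemma least_chips_le_pass: "least_chips d \<phi> (Suc i) k \<le> pass d \<phi> i (least_chips d \<phi> i k)"
  by (cases k) auto

lemma least_chips_Suc_k: "least_chips d \<phi> i (Suc k) \<le> least_chips d \<phi> i k - 1"
  by (cases i) auto

lemma least_chips_decseq: "k \<le> l \<Longrightarrow> least_chips d \<phi> i l + int (l - k) \<le> least_chips d \<phi> i k"
proof (induction l)
  case (Suc l)
  then show ?case using least_chips_Suc_k[of d \<phi> i l] by (cases "k = Suc l") (auto simp: of_nat_diff)
qed simp

lemma pass_le: "pass d \<phi> i t \<le> t" "t - 1 \<le> pass d \<phi> i t"
  by (auto simp: pass_def)

lemma least_chips_step_le: "least_chips d \<phi> (Suc i) k \<le> least_chips d \<phi> i k"
  using least_chips_le_pass pass_le(1) order_trans by blast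

lemma least_chips_step_ge: "least_chips d \<phi> i k - 1 \<le> least_chips d \<phi> (Suc i) k"
proof (induction k)
  case 0
  then show ?case using pass_le(2) by simp
next
  case (Suc k)
  then show ?case using pass_le(2)[of "least_chips d \<phi> i (Suc k)"] least_chips_Suc_k[of d \<phi> i k] by simp
qed

lemma least_chips_step_lingers:
  assumes "least_chips d \<phi> (Suc i) k = least_chips d \<phi> i k"
  shows "lingers d \<phi> i (least_chips d \<phi> i k)"
  using assms least_chips_le_pass[of d \<phi> i k] by (auto simp: pass_def split: if_splits)

lemma least_chips_antimono: "i \<le> j \<Longrightarrow> least_chips d \<phi> j k \<le> least_chips d \<phi> i k"
  by (induction rule: dec_induct) (use least_chips_step_le order_trans in blast)+

text \<open>One choice of removals is the worst case for all profiles \<open>n\<close> at once. It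
  is built along the recursion of \<open>least_chips\<close>; since \<open>pass\<close> is monotone,
  having fewer chips in front of a loop never helps the player.\<close>

lemma adversary:
  "\<exists>e :: nat \<Rightarrow> nat. (\<Sum>j\<le>i. e j) = k \<and> (\<forall>n. (\<forall>l<i. n l = 0 \<longrightarrow> lingers d \<phi> l (d - int (\<Sum>j<l. n j) - int (\<Sum>j\<le>l. e j)))
     \<longrightarrow> d - int (\<Sum>j<i. n j) - int (\<Sum>j\<le>i. e j) \<le> least_chips d \<phi> i k)"
proof (induction i arbitrary: k)
  case 0
  show ?case by (intro exI[of _ "\<lambda>_. k"]) simp
next
  case (Suc i)
  have from_i: "\<exists>e :: nat \<Rightarrow> nat. (\<Sum>j\<le>Suc i. e j) = k \<and> (\<forall>n. (\<forall>l<Suc i. n l = 0 \<longrightarrow> lingers d \<phi> l (d - int (\<Sum>j<l. n j) - int (\<Sum>j\<le>l. e j)))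
     \<longrightarrow> d - int (\<Sum>j<Suc i. n j) - int (\<Sum>j\<le>Suc i. e j) \<le> pass d \<phi> i (least_chips d \<phi> i k))" for k
  proof -
    obtain e :: "nat \<Rightarrow> nat" where e: "(\<Sum>j\<le>i. e j) = k"
      "\<And>n. (\<And>l. l < i \<Longrightarrow> n l = 0 \<Longrightarrow> lingers d \<phi> l (d - int (\<Sum>j<l. n j) - int (\<Sum>j\<le>l. e j)))
        \<Longrightarrow> d - int (\<Sum>j<i. n j) - int (\<Sum>j\<le>i. e j) \<le> least_chips d \<phi> i k"
      using Suc.IH[of k] by metis
    \<comment> \<open>The first alternative of the minimum: nothing is removed at the new
      vertex.\<close>
    define e' where "e' = e(Suc i := 0)"
    have le: "(\<Sum>j\<le>l. e' j) = (\<Sum>j\<le>l. e j)" if "l \<le> i" for l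
      using that by (intro sum.cong) (auto simp: e'_def)
    have top: "(\<Sum>j\<le>Suc i. e' j) = (\<Sum>j\<le>i. e j)" using le[of i] by (simp add: e'_def)
    have "d - int (\<Sum>j<Suc i. n j) - int (\<Sum>j\<le>Suc i. e' j) \<le> pass d \<phi> i (least_chips d \<phi> i k)"
      if n: "\<forall>l<Suc i. n l = 0 \<longrightarrow> lingers d \<phi> l (d - int (\<Sum>j<l. n j) - int (\<Sum>j\<le>l. e' j))" for n
    proof -
      define t where "t = d - int (\<Sum>j<i. n j) - int (\<Sum>j\<le>i. e j)"
      have "t \<le> least_chips d \<phi> i k" unfolding t_def
      proof (rule e(2))
        fix l assume l: "l < i" "n l = 0"
        then show "lingers d \<phi> l (d - int (\<Sum>j<l. n j) - int (\<Sum>j\<le>l. e j))" 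
          using n[rule_format, of l] le[of l] by (simp del: of_nat_sum)
      qed
      then have "pass d \<phi> i t \<le> pass d \<phi> i (least_chips d \<phi> i k)" by (rule pass_mono)
      \<comment> \<open>Either the loop is empty, which its congruence permits only if the count
        lingers, or the profile spends at least the one chip that \<open>pass\<close> may
        charge.\<close>
      moreover have "t - int (n i) \<le> pass d \<phi> i t"
      proof (cases "n i = 0")
        case True
        then have "lingers d \<phi> i t" using n[rule_format, of i] le[of i] by (simp add: t_def del: of_nat_sum)
        then show ?thesis by (simp add: pass_def)
      qed (simp add: pass_def)
      ultimately show ?thesis unfolding top by (simp add: t_def del: of_nat_sum)
    qed
    then show ?thesis using top e(1) by (intro exI[of _ e']) auto
  qed
  show ?case
  proof (induction k)
    case 0
    show ?case unfolding least_chips.simps by (rule from_i)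
  next
    case (Suc k)
    show ?case
    proof (cases "pass d \<phi> i (least_chips d \<phi> i (Suc k)) \<le> least_chips d \<phi> (Suc i) k - 1")
      case True
      then have eq: "least_chips d \<phi> (Suc i) (Suc k) = pass d \<phi> i (least_chips d \<phi> i (Suc k))" by simp
      show ?thesis unfolding eq by (rule from_i)
    next
      case False
      obtain e :: "nat \<Rightarrow> nat" where e: "(\<Sum>j\<le>Suc i. e j) = k"
        "\<And>n. (\<And>l. l < Suc i \<Longrightarrow> n l = 0 \<Longrightarrow> lingers d \<phi> l (d - int (\<Sum>j<l. n j) - int (\<Sum>j\<le>l. e j)))
          \<Longrightarrow> d - int (\<Sum>j<Suc i. n j) - int (\<Sum>j\<le>Suc i. e j) \<le> least_chips d \<phi> (Suc i) k"
        using Suc.IH by metis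
      \<comment> \<open>The second alternative of the minimum: the additional chip is removed at the
        new vertex.\<close>
      define e' where "e' = e(Suc i := Suc (e (Suc i)))"
      have le: "(\<Sum>j\<le>l. e' j) = (\<Sum>j\<le>l. e j)" if "l \<le> i" for l
        using that by (intro sum.cong) (auto simp: e'_def)
      have top: "(\<Sum>j\<le>Suc i. e' j) = Suc (\<Sum>j\<le>Suc i. e j)" using le[of i] by (simp add: e'_def)
      have "d - int (\<Sum>j<Suc i. n j) - int (\<Sum>j\<le>Suc i. e' j) \<le> least_chips d \<phi> (Suc i) (Suc k)"
        if n: "\<forall>l<Suc i. n l = 0 \<longrightarrow> lingers d \<phi> l (d - int (\<Sum>j<l. n j) - int (\<Sum>j\<le>l. e' j))" for n
      proof -
        have "d - int (\<Sum>j<Suc i. n j) - int (\<Sum>j\<le>Suc i. e j) \<le> least_chips d \<phi> (Suc i) k"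
        proof (rule e(2))
          fix l assume l: "l < Suc i" "n l = 0"
          then show "lingers d \<phi> l (d - int (\<Sum>j<l. n j) - int (\<Sum>j\<le>l. e j))" 
          using n[rule_format, of l] le[of l] by (simp del: of_nat_sum)
        qed
        then show ?thesis unfolding top using False by (simp del: of_nat_sum)
      qed
      moreover have "(\<Sum>j\<le>Suc i. e' j) = Suc k" using top e(1) by (simp only:)
      ultimately show ?thesis by blast
    qed
  qed
qed

text \<open>The rank is tested against the divisor of the adversary. The profile of an effective
  representative uses up all \<open>d - r\<close> remaining chips, so the play ends with zero chips,
  and this is at most \<open>least_chips\<close>.\<close>

lemma rank_ge_imp_least_chips:
  assumes R: "rank_ge (int r) d \<phi>"
  shows "0 \<le> least_chips d \<phi> (length xs) r"
proof -
  define g where "g = length xs"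
  obtain e :: "nat \<Rightarrow> nat" where e: "(\<Sum>j\<le>g. e j) = r"
    "\<And>n. (\<And>l. l < g \<Longrightarrow> n l = 0 \<Longrightarrow> lingers d \<phi> l (d - int (\<Sum>j<l. n j) - int (\<Sum>j\<le>l. e j)))
      \<Longrightarrow> d - int (\<Sum>j<g. n j) - int (\<Sum>j\<le>g. e j) \<le> least_chips d \<phi> g r"
    using adversary[of g r d \<phi>] by metis
  have "\<forall>i. \<exists>v. i \<le> g \<longrightarrow> v \<in> \<Gamma> \<and> (\<forall>j<g. eqm (xs ! j) (\<theta> (xs ! j) v) (if j < i then a j else b j))"
    using vertex unfolding g_def by blast
  then obtain v where v: "\<And>i. i \<le> g \<Longrightarrow> v i \<in> \<Gamma>"
    "\<And>i j. i \<le> g \<Longrightarrow> j < g \<Longrightarrow> eqm (xs ! j) (\<theta> (xs ! j) (v i)) (if j < i then a j else b j)" by metis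
  define E where "E = (\<Sum>i\<le>g. Poly_Mapping.single (v i) (int (e i)))"
  have "Poly_Mapping.keys E \<subseteq> \<Gamma>" unfolding E_def using v(1) by (intro keys_sum_subset) auto
  moreover have "effective E" unfolding E_def by (intro effective_sum effective_single) auto
  moreover have "div_degree E = int r" unfolding E_def div_degree_sum div_degree_single using e(1) by (simp flip: of_nat_sum)
  ultimately have "eff_class (d - int r) (\<lambda>L. \<phi> L - \<Phi> L E)" using R unfolding rank_ge_def by blast
  then obtain n where n: "(\<Sum>L\<in>\<L>. int (n L)) = d - int r"
    "\<And>L. L \<in> \<L> \<Longrightarrow> n L = 0 \<Longrightarrow> eqm L (\<phi> L - \<Phi> L E) (outer L n)"
    unfolding eff_class_def by blast
  have sn: "(\<Sum>j<g. int (n (xs ! j))) = d - int r" using n(1) unfolding sum_xs g_def .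
  have "d - int (\<Sum>j<g. n (xs ! j)) - int (\<Sum>j\<le>g. e j) \<le> least_chips d \<phi> g r"
  proof (rule e(2))
    fix i assume i: "i < g" "n (xs ! i) = 0"
    define t where "t = d - int (\<Sum>j<i. n (xs ! j)) - int (\<Sum>j\<le>i. e j)"
    \<comment> \<open>The chips removed at vertices to the right of loop \<open>i\<close>; the
      vertices with index at most \<open>i\<close> lie to its left.\<close>
    define c where "c = (\<Sum>j\<in>{Suc i..g}. e j)"
    have "{..g} = {..i} \<union> {Suc i..g}" using i by auto
    then have "(\<Sum>j\<le>g. e j) = (\<Sum>j\<le>i. e j) + (\<Sum>j\<in>{Suc i..g}. e j)"
      by (simp add: sum.union_disjoint)
    then have c: "int (\<Sum>j\<le>i. e j) + int c = int r" using e(1) by (simp add: c_def)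
    have "(\<Sum>j<g. int (n (xs ! j))) = (\<Sum>j<i. int (n (xs ! j))) + int (n (xs ! i)) + (\<Sum>j\<in>{Suc i..<g}. int (n (xs ! j)))"
      using sum_split_index[OF i(1)] .
    then have s: "int (\<Sum>j\<in>{Suc i..<g}. n (xs ! j)) = d - int r - int (\<Sum>j<i. n (xs ! j))"
      using sn i(2) by simp
    have \<Phi>E: "eqm (xs ! i) (\<Phi> (xs ! i) E) (real (\<Sum>j\<le>i. e j) * b i + real c * a i)"
    proof -
      have "eqm (xs ! i) (\<Sum>j\<in>J. real (e j) * \<theta> (xs ! i) (v j)) (\<Sum>j\<in>J. real (e j) * (if i < j then a i else b i))"
        if "finite J" "J \<subseteq> {..g}" for J
        using that
      proof (induction J rule: finite_induct)
        case (insert j J)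
        have "eqm (xs ! i) (real m * x) (real m * y)" if xy: "eqm (xs ! i) x y" for m x y
        proof -
          obtain k :: int where "x - y = of_int k * len (xs ! i)" using xy unfolding eqm_def by blast
          then have "real m * x - real m * y = of_int (int m * k) * len (xs ! i)" by (simp flip: right_diff_distrib)
          then show ?thesis unfolding eqm_def by blast
        qed
        then show ?case using insert v(2)[of j i] i(1) by (simp add: eqm_add)
      qed simp
      from this[of "{..g}"] have "eqm (xs ! i) (\<Phi> (xs ! i) E) (\<Sum>j\<le>g. real (e j) * (if i < j then a i else b i))"
        by (simp add: E_def \<Phi>_sum \<Phi>_single)
      also have "(\<Sum>j\<le>g. real (e j) * (if i < j then a i else b i)) =
          (\<Sum>j\<le>i. real (e j) * (if i < j then a i else b i)) + (\<Sum>j\<in>{Suc i..g}. real (e j) * (if i < j then a i else b i))"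
        unfolding \<open>{..g} = {..i} \<union> {Suc i..g}\<close> by (intro sum.union_disjoint) auto
      also have "\<dots> = (\<Sum>j\<le>i. real (e j) * b i) + (\<Sum>j\<in>{Suc i..g}. real (e j) * a i)"
        by (intro arg_cong2[of _ _ _ _ "(+)"] sum.cong) auto
      finally show ?thesis by (simp add: sum_distrib_right c_def)
    qed
    have "eqm (xs ! i) ((\<phi> (xs ! i) - \<Phi> (xs ! i) E) + \<Phi> (xs ! i) E)
      (outer (xs ! i) n + (real (\<Sum>j\<le>i. e j) * b i + real c * a i))"
      using n(2)[OF nth_xs _] i \<Phi>E by (intro eqm_add) (auto simp: g_def)
    \<comment> \<open>Kept and removed chips together number \<open>t\<close> to the right of the
      empty loop and \<open>d - t\<close> to its left.\<close>
    moreover have "outer (xs ! i) n + (real (\<Sum>j\<le>i. e j) * b i + real c * a i) = of_int t * a i + of_int (d - t) * b i"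
    proof -
      have 1: "real (\<Sum>j\<in>{Suc i..<g}. n (xs ! j)) + real c = of_int t"
      proof -
        have "int (\<Sum>j\<in>{Suc i..<g}. n (xs ! j)) + int c = t" using s c by (simp add: t_def)
        then show ?thesis by (metis of_int_add of_int_of_nat_eq)
      qed
      have 2: "real (\<Sum>j<i. n (xs ! j)) + real (\<Sum>j\<le>i. e j) = of_int (d - t)"
      proof -
        have "int (\<Sum>j<i. n (xs ! j)) + int (\<Sum>j\<le>i. e j) = d - t" by (simp add: t_def)
        then show ?thesis by (metis of_int_add of_int_of_nat_eq)
      qed
      have "outer (xs ! i) n = real (\<Sum>j<i. n (xs ! j)) * b i + real (\<Sum>j\<in>{Suc i..<g}. n (xs ! j)) * a i"
        using outer_xs[of i n] i by (simp add: g_def)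
      then show ?thesis unfolding 1[symmetric] 2[symmetric] by (simp add: algebra_simps)
    qed
    ultimately show "lingers d \<phi> i (d - int (\<Sum>j<i. n (xs ! j)) - int (\<Sum>j\<le>i. e j))"
      by (simp add: lingers_def t_def)
  qed
  then show ?thesis using sn e(1) by (simp add: g_def flip: of_nat_sum)
qed

text \<open>Subtracting the two congruences makes \<open>(t - s) * (a i - b i)\<close> a multiple of
  the length, which genericity excludes for differences in this range.\<close>

lemma lingers_unique:
  assumes "i < length xs" "lingers d \<phi> i s" "lingers d \<phi> i t" "s < t" "t - s \<le> int (2 * length xs - 2)"
  shows False
proof -
  have "eqm (xs ! i) (of_int t * a i + of_int (d - t) * b i) (of_int s * a i + of_int (d - s) * b i)"
    using eqm_trans[OF eqm_sym] assms(2,3) unfolding lingers_def by blast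
  then have "eqm (xs ! i) ((of_int t * a i + of_int (d - t) * b i) - (of_int s * a i + of_int (d - s) * b i)) 0"
    by (simp only: eqm_diff_0)
  moreover have "(of_int t * a i + of_int (d - t) * b i) - (of_int s * a i + of_int (d - s) * b i) = real (nat (t - s)) * (a i - b i)"
    using assms(4) by (simp add: algebra_simps)
  ultimately show False using generic[OF assms(1), of "nat (t - s)"] assms(4,5) by simp
qed

text \<open>Each of the \<open>r + 1\<close> strictly ordered chip counts has to end at a nonnegative value, which
  limits the number of drops, and at most one of them can linger at each loop.\<close>

lemma lingering_loops:
  assumes R: "rank_ge (int r) d \<phi>" and d: "d \<le> int (2 * length xs - 2)"
  shows "(int r + 1) * (int (length xs) - d + int r) \<le> int (card {i. i < length xs \<and> (\<exists>t. lingers d \<phi> i t)})"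
proof -
  define g where "g = length xs"
  define X where "X i k = least_chips d \<phi> i k" for i k
  define A where "A i = {k. k \<le> r \<and> X (Suc i) k = X i k}" for i
  have finA: "finite (A i)" for i by (simp add: A_def)
  \<comment> \<open>All counts lie between 0 and \<open>d\<close>, so two of them never differ by
    more than genericity covers.\<close>
  have bounds: "0 \<le> X i k \<and> X i k \<le> d" if "i \<le> g" "k \<le> r" for i k
  proof
    have "0 \<le> X g r" using rank_ge_imp_least_chips[OF R] by (simp add: X_def g_def)
    also have "X g r \<le> X i r" using least_chips_antimono[OF that(1)] by (simp add: X_def)
    also have "X i r \<le> X i k" using least_chips_decseq[OF that(2), of d \<phi> i] by (simp add: X_def)
    finally show "0 \<le> X i k" .
    have "X i k \<le> X 0 k" using least_chips_antimono[of 0 i] by (simp add: X_def)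
    then show "X i k \<le> d" by (simp add: X_def)
  qed
  have card_A: "card (A i) \<le> (if \<exists>t. lingers d \<phi> i t then 1 else 0)" if i: "i < g" for i
  proof -
    have l: "lingers d \<phi> i (X i k)" if "k \<in> A i" for k
      using that least_chips_step_lingers by (auto simp: A_def X_def)
    have "k = l'" if k: "k \<in> A i" "l' \<in> A i" "k \<le> l'" for k l'
    proof (rule ccontr)
      assume "k \<noteq> l'"
      then have "X i l' < X i k" using least_chips_decseq[OF k(3), of d \<phi> i] k(3) by (simp add: X_def)
      moreover have "X i k - X i l' \<le> int (2 * length xs - 2)"
        using bounds[of i k] bounds[of i l'] i k d by (auto simp: A_def)
      ultimately show False using lingers_unique[of i d \<phi> "X i l'" "X i k"] l k i by (simp add: g_def)
    qed
    then have "card (A i) \<le> 1" using finA by (metis card_le_Suc0_iff_eq One_nat_def linear)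
    moreover have "A i = {}" if "\<not> (\<exists>t. lingers d \<phi> i t)" using l that by blast
    ultimately show ?thesis by auto
  qed
  \<comment> \<open>Summed over all \<open>k\<close>, a loop costs \<open>r + 1\<close> chips less
    the number of counts that linger there.\<close>
  have step: "(\<Sum>k\<le>r. X (Suc i) k) = (\<Sum>k\<le>r. X i k) - (int r + 1) + int (card (A i))" for i
  proof -
    have "X (Suc i) k = X i k - 1 + (if X (Suc i) k = X i k then 1 else 0)" for k
      using least_chips_step_le[of d \<phi> i k] least_chips_step_ge[of d \<phi> i k] by (auto simp: X_def)
    then have "(\<Sum>k\<le>r. X (Suc i) k) = (\<Sum>k\<le>r. X i k - 1 + (if X (Suc i) k = X i k then 1 else 0))" by simp
    also have "\<dots> = (\<Sum>k\<le>r. X i k) - (int r + 1) + (\<Sum>k\<le>r. if X (Suc i) k = X i k then 1 else 0)"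
      by (simp add: sum.distrib sum_subtractf)
    also have "(\<Sum>k\<le>r. if X (Suc i) k = X i k then 1 else 0 :: int) = int (card (A i))"
      by (simp add: A_def sum.If_cases Int_def)
    finally show ?thesis .
  qed
  have total: "(\<Sum>k\<le>r. X i k) = (\<Sum>k\<le>r. d - int k) - int i * (int r + 1) + (\<Sum>j<i. int (card (A j)))" for i
  proof (induction i)
    case (Suc i)
    then show ?case using step[of i] by (simp add: algebra_simps)
  qed (simp add: X_def)
  \<comment> \<open>The final counts are strictly ordered and the smallest is nonnegative, so the
    \<open>k\<close>-th one is at least \<open>r - k\<close>.\<close>
  have "(\<Sum>k\<le>r. int r - int k) \<le> (\<Sum>k\<le>r. X g k)"
  proof (intro sum_mono)
    fix k assume "k \<in> {..r}"
    then show "int r - int k \<le> X g k"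
      using least_chips_decseq[of k r d \<phi> g] bounds[of g r] by (simp add: X_def of_nat_diff)
  qed
  then have "(\<Sum>k\<le>r. int r - int k) \<le> (\<Sum>k\<le>r. d - int k) - int g * (int r + 1) + (\<Sum>j<g. int (card (A j)))"
    unfolding total .
  moreover have "(\<Sum>k\<le>r. d - int k) = (\<Sum>k\<le>r. int r - int k) + (int r + 1) * (d - int r)"
    by (simp add: sum_subtractf algebra_simps)
  ultimately have "(int r + 1) * (int g - d + int r) \<le> (\<Sum>j<g. int (card (A j)))"
    by (simp add: algebra_simps)
  also have "\<dots> \<le> (\<Sum>j<g. if \<exists>t. lingers d \<phi> j t then 1 else 0)"
  proof (intro sum_mono)
    fix j assume "j \<in> {..<g}"
    then show "int (card (A j)) \<le> (if \<exists>t. lingers d \<phi> j t then 1 else 0)"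
      using card_A[of j] by (cases "\<exists>t. lingers d \<phi> j t") auto
  qed
  also have "\<dots> = int (card {i. i < g \<and> (\<exists>t. lingers d \<phi> i t)})"
    by (simp add: sum.If_cases Int_def)
  finally show ?thesis by (simp add: g_def)
qed

subsection \<open>Sufficient conditions\<close>

text \<open>The loops are divided into \<open>r + 1\<close> blocks of length \<open>l\<close>. In the \<open>k\<close>-th block, a player who has lost
  \<open>k\<close> chips to the adversary so far and who has played optimally lingers at every loop.\<close>

lemma rank_ge_blocks:
  assumes l: "0 < l" "(r + 1) * l \<le> length xs" and d: "d = int (length xs) - int l + int r"
    and \<psi>: "\<And>i. i < (r + 1) * l \<Longrightarrow> lingers d \<psi> i (d - int (i div l) - int (i div l * l))"
  shows "rank_ge (int r) d \<psi>"
  unfolding rank_ge_def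
proof (intro allI impI)
  fix E assume E: "Poly_Mapping.keys E \<subseteq> \<Gamma> \<and> effective E \<and> div_degree E = int r"
  define g where "g = length xs"
  have g: "0 < g" using l by (cases g) (auto simp: g_def)
  obtain e where e: "(\<Sum>L\<in>\<L>. int (e L)) = int r" "\<And>L. L \<in> \<L> \<Longrightarrow> e L = 0 \<Longrightarrow> \<Phi> L E = outer L e"
    using effective_profile[of E] E by auto
  define f where "f i = e (xs ! i)" for i
  define T where "T i = d - int (i div l) - int (i div l * l)" for i
  \<comment> \<open>The strategy of the player: a chip is spent on every loop, unless nothing is
    removed there and the count is exactly the one that lingers.\<close>
  define n where "n i t = (if f i = 0 \<and> i < (r + 1) * l \<and> t = T i then 0 else 1 :: nat)" for i t
  define \<tau> where "\<tau> = rec_nat d (\<lambda>i t. t - int (f i) - int (n i t))"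
  have \<tau>0: "\<tau> 0 = d" and \<tau>S: "\<tau> (Suc i) = \<tau> i - int (f i) - int (n i (\<tau> i))" for i
    by (simp_all add: \<tau>_def)
  have \<tau>: "\<tau> i = d - (\<Sum>j<i. int (f j)) - (\<Sum>j<i. int (n j (\<tau> j)))" for i
    by (induction i) (simp_all add: \<tau>0 \<tau>S)
  \<comment> \<open>The count guaranteed before loop \<open>i\<close> after the removal of
    \<open>k\<close> chips: each loop costs a chip, except the loops of block \<open>k\<close>
    already passed. With truncated subtraction these number
    \<open>min l (i - k * l)\<close>.\<close>
  define Y where "Y i k = d - int k - int i + int (min l (i - k * l))" for i k
  have sumf: "(\<Sum>j<g. int (f j)) = int r" using e(1) unfolding sum_xs f_def g_def .
  have inv: "Y i (\<Sum>j<i. f j) \<le> \<tau> i" if "i \<le> g" for i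
    using that
  proof (induction i)
    case 0
    show ?case by (simp add: Y_def \<tau>0)
  next
    case (Suc i)
    define k where "k = (\<Sum>j<i. f j)"
    have IH: "Y i k \<le> \<tau> i" using Suc by (simp add: k_def)
    show ?case
    proof (cases "f i = 0")
      case False
      then have n1: "n i (\<tau> i) = 1" by (simp add: n_def)
      \<comment> \<open>A removal moves the relevant block to the right by at least one position, so
        the step past this loop adds no lingering to the guarantee.\<close>
      have "k * l + 1 \<le> (k + f i) * l" using False l(1) by (cases "f i") (auto simp: algebra_simps)
      then have "min l (Suc i - (k + f i) * l) \<le> min l (i - k * l)" by linarith
      then have "Y (Suc i) (k + f i) \<le> Y i k - int (f i) - 1" by (simp add: Y_def)
      then show ?thesis using IH n1 \<tau>S[of i] by (simp add: k_def)
    next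
      case True
      have sum: "(\<Sum>j<Suc i. f j) = k" using True by (simp add: k_def)
      have n1: "n i (\<tau> i) \<le> 1" by (simp add: n_def)
      show ?thesis
      proof (cases "k * l \<le> i \<and> i < (k + 1) * l")
        case blk: True
        then have dv: "i div l = k" using l(1) by (intro div_nat_eqI) (auto simp: algebra_simps)
        have "int (i - k * l) = int i - int (k * l)" using blk by (intro of_nat_diff) simp
        moreover have blk': "k * l \<le> i" "i < k * l + l" using blk by auto
        then have "min l (i - k * l) = i - k * l" by linarith
        ultimately have YT: "Y i k = T i" unfolding Y_def T_def dv by simp
        have YS: "Y (Suc i) k = Y i k"
        proof -
          have "min l (Suc i - k * l) = Suc (min l (i - k * l))" using blk' by linarith
          then show ?thesis by (simp add: Y_def)
        qed
        have "(\<Sum>j<i. int (f j)) \<le> (\<Sum>j<g. int (f j))" using Suc.prems by (intro sum_mono2) auto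
        then have "int k \<le> int r" unfolding sumf k_def by simp
        then have "(k + 1) * l \<le> (r + 1) * l" by (intro mult_le_mono1) simp
        then have ir: "i < (r + 1) * l" using blk by linarith
        show ?thesis
        proof (cases "\<tau> i = T i")
          case True
          then have "n i (\<tau> i) = 0" using ir \<open>f i = 0\<close> by (simp add: n_def)
          then show ?thesis using IH YS \<tau>S[of i] \<open>f i = 0\<close> unfolding sum by simp
        next
          \<comment> \<open>The count then exceeds the guarantee \<open>T i\<close>, and the surplus
            pays for the chip spent here.\<close>
          case False
          then show ?thesis using IH YS YT n1 \<tau>S[of i] \<open>f i = 0\<close> unfolding sum by simp
        qed
      next
        case False
        then have "i < k * l \<or> k * l + l \<le> i" by auto
        then have "min l (Suc i - k * l) = min l (i - k * l)" by linarith
        then have "Y (Suc i) k = Y i k - 1" by (simp add: Y_def)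
        then show ?thesis using IH n1 \<tau>S[of i] True unfolding sum by simp
      qed
    qed
  qed
  have "(\<Sum>j<g. f j) = r" using sumf by (metis of_nat_eq_iff of_nat_sum)
  moreover have "l \<le> g - r * l" using l(2) by (simp add: g_def algebra_simps)
  ultimately have last: "0 \<le> \<tau> g" using inv[of g] d by (simp add: Y_def g_def)
  \<comment> \<open>The chips left over at the end are put on the last loop, so that the profile has
    the required degree.\<close>
  define F where "F i = n i (\<tau> i) + (if Suc i = g then nat (\<tau> g) else 0)" for i
  define m where "m L = F (inv_into {..<g} ((!) xs) L)" for L
  have m: "m (xs ! i) = F i" if "i < g" for i
    using that bij_xs inv_into_f_f[of "(!) xs" "{..<g}" i] by (simp add: m_def g_def bij_betw_def)
  have "(\<Sum>i<g. int (F i)) = (\<Sum>i<g. int (n i (\<tau> i)) + (if i = g - 1 then \<tau> g else 0))"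
    using last g by (intro sum.cong) (auto simp: F_def)
  also have "\<dots> = d - int r" using g \<tau>[of g] sumf by (simp add: sum.distrib)
  finally have sumF: "(\<Sum>i<g. int (F i)) = d - int r" .
  have "(\<Sum>L\<in>\<L>. int (m L)) = (\<Sum>i<g. int (m (xs ! i)))" unfolding sum_xs g_def ..
  then have "(\<Sum>L\<in>\<L>. int (m L)) = d - int r" using m sumF by simp
  moreover have "eqm L (\<psi> L - \<Phi> L E) (outer L m)" if L: "L \<in> \<L>" "m L = 0" for L
  proof -
    obtain i where i: "i < g" "L = xs ! i" using loop_index[OF L(1)] by (auto simp: g_def)
    have "F i = 0" using L(2) m[OF i(1)] i(2) by simp
    then have "n i (\<tau> i) = 0" by (simp add: F_def)
    then have *: "f i = 0" "i < (r + 1) * l" "\<tau> i = T i" by (auto simp: n_def split: if_splits)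
    then have "lingers d \<psi> i (\<tau> i)" using \<psi> by (simp add: T_def)
    then have 1: "eqm L (\<psi> L) (of_int (\<tau> i) * a i + of_int (d - \<tau> i) * b i)" by (simp add: lingers_def i(2))
    have left: "(\<Sum>j<i. int (m (xs ! j)) + int (f j)) = d - \<tau> i"
    proof -
      have "(\<Sum>j<i. int (m (xs ! j)) + int (f j)) = (\<Sum>j<i. int (n j (\<tau> j)) + int (f j))"
        using i(1) m by (intro sum.cong) (auto simp: F_def)
      then show ?thesis using \<tau>[of i] by (simp add: sum.distrib)
    qed
    have "(\<Sum>j<g. int (m (xs ! j)) + int (f j)) = d"
      using m sumF sumf by (simp add: sum.distrib)
    then have right: "(\<Sum>j\<in>{Suc i..<g}. int (m (xs ! j)) + int (f j)) = \<tau> i"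
      using sum_split_index[OF i(1), of "\<lambda>j. int (m (xs ! j)) + int (f j)"] left L(2) i(2) *(1) by simp
    have "outer L m + \<Phi> L E = outer L m + outer L e" using e(2)[OF L(1)] *(1) i(2) by (simp add: f_def)
    also have "\<dots> = real_of_int (\<Sum>j<i. int (m (xs ! j)) + int (f j)) * b i
        + real_of_int (\<Sum>j\<in>{Suc i..<g}. int (m (xs ! j)) + int (f j)) * a i"
      using outer_xs[of i m] outer_xs[of i e] i by (simp add: g_def f_def sum.distrib algebra_simps)
    also have "\<dots> = of_int (\<tau> i) * a i + of_int (d - \<tau> i) * b i" unfolding left right by simp
    finally have "eqm L (\<psi> L - \<Phi> L E) ((outer L m + \<Phi> L E) - \<Phi> L E)" using eqm_diff[OF 1 eqm_refl] by simp
    then show ?thesis by simp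
  qed
  ultimately show "eff_class (d - int r) (\<lambda>L. \<psi> L - \<Phi> L E)" unfolding eff_class_def by blast
qed

section \<open>Non-effective classes, large degrees and the dimension count\<close>

lemma countable_lingering:
  "countable {y. \<exists>t::int. eqm L y (of_int t * a i + of_int (d - t) * b i)}"
proof -
  have "{y. \<exists>t::int. eqm L y (of_int t * a i + of_int (d - t) * b i)} \<subseteq>
      range (\<lambda>(t::int, k::int). of_int t * a i + of_int (d - t) * b i + of_int k * len L)"
    unfolding eqm_def by (auto simp: image_iff) (metis diff_eq_eq add.commute)
  then show ?thesis by (rule countable_subset) simp
qed

text \<open>With \<open>g - 1\<close> chips some loop stays empty, and its coordinate then belongs
  to a countable set; the class is chosen to avoid all these sets.\<close>

lemma not_effective_exists: "\<exists>\<psi>. \<not> eff_class (int (length xs) - 1) \<psi>"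
proof -
  define g where "g = length xs"
  have "\<exists>y. \<not> (\<exists>t::int. eqm (xs ! i) y (of_int t * a i + of_int (int g - 1 - t) * b i))" for i
  proof (rule ccontr)
    assume "\<not> ?thesis"
    then have "{y. \<exists>t::int. eqm (xs ! i) y (of_int t * a i + of_int (int g - 1 - t) * b i)} = UNIV" by blast
    then show False using countable_lingering[of "xs ! i" i "int g - 1"] uncountable_UNIV_real by simp
  qed
  then obtain y where y: "\<And>i t. \<not> eqm (xs ! i) (y i) (of_int t * a i + of_int (int g - 1 - t) * b i)" by metis
  define \<psi> where "\<psi> L = y (inv_into {..<g} ((!) xs) L)" for L
  have \<psi>: "\<psi> (xs ! i) = y i" if "i < g" for i
    using that bij_xs inv_into_f_f[of "(!) xs" "{..<g}" i] by (simp add: \<psi>_def g_def bij_betw_def)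
  have "\<not> eff_class (int g - 1) \<psi>"
  proof
    assume "eff_class (int g - 1) \<psi>"
    then obtain n where n: "(\<Sum>L\<in>\<L>. int (n L)) = int g - 1" "\<And>L. L \<in> \<L> \<Longrightarrow> n L = 0 \<Longrightarrow> eqm L (\<psi> L) (outer L n)"
      unfolding eff_class_def by blast
    have sn: "(\<Sum>i<g. int (n (xs ! i))) = int g - 1" using n(1) unfolding sum_xs g_def .
    have "\<exists>i<g. n (xs ! i) = 0"
    proof (rule ccontr)
      assume "\<not> ?thesis"
      then have "(\<Sum>i<g. 1) \<le> (\<Sum>i<g. int (n (xs ! i)))" by (intro sum_mono) auto
      then show False using sn by simp
    qed
    then obtain i where i: "i < g" "n (xs ! i) = 0" by blast
    define t where "t = (\<Sum>j\<in>{Suc i..<g}. int (n (xs ! j)))"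
    have "(\<Sum>j<i. int (n (xs ! j))) = int g - 1 - t"
      using sum_split_index[OF i(1), of "\<lambda>j. int (n (xs ! j))"] sn i(2) by (simp add: t_def)
    then have left: "real (\<Sum>j<i. n (xs ! j)) = of_int (int g - 1 - t)" by (metis of_int_of_nat_eq of_nat_sum)
    have right: "real (\<Sum>j\<in>{Suc i..<g}. n (xs ! j)) = of_int t" by (simp add: t_def)
    have "outer (xs ! i) n = of_int t * a i + of_int (int g - 1 - t) * b i"
      using outer_xs[of i n] i(1) unfolding left g_def[symmetric] right by simp
    then show False using n(2)[OF nth_xs i(2)] y[of i t] \<psi>[OF i(1)] i(1) by (simp add: g_def)
  qed
  then show ?thesis unfolding g_def by blast
qed

text \<open>An effective divisor of degree at least \<open>g\<close> can have any coordinates.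
  Subtracting one therefore leads from \<open>\<phi>\<close> to any class of the smaller degree, in
  particular to a non-effective one.\<close>

lemma not_rank_ge_large_degree:
  assumes "int (length xs) \<le> int r" "d - int (length xs) + 1 \<le> int r" shows "\<not> rank_ge (int r) d \<phi>"
proof
  assume R: "rank_ge (int r) d \<phi>"
  define g where "g = length xs"
  \<comment> \<open>The least degree that is at least \<open>g\<close> and leaves a remainder of
    degree at most \<open>g - 1\<close>.\<close>
  define m where "m = nat (max (int g) (d - int g + 1))"
  have m: "g \<le> m" "m \<le> r" "d - int m \<le> int g - 1" using assms by (auto simp: m_def g_def)
  have Rm: "rank_ge (int m) d \<phi>" using rank_ge_mono[OF R m(2)] .
  obtain \<psi> where \<psi>: "\<not> eff_class (int g - 1) \<psi>" using not_effective_exists by (auto simp: g_def)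
  obtain M where M: "M \<in> \<L>" using loops_ne by blast
  obtain p where p: "p \<in> \<Gamma>" using graph_nonempty by blast
  \<comment> \<open>The target is the non-effective class of degree \<open>g - 1\<close> lowered by
    \<open>c\<close> copies of \<open>p\<close> to degree \<open>d - m\<close>; if it were
    effective, adding \<open>p\<close> again \<open>c\<close> times would make \<open>\<psi>\<close>
    effective.\<close>
  define c where "c = nat (int g - 1 - (d - int m))"
  define n where "n L = 1 + (if L = M then m - g else 0)" for L
  have "(\<Sum>L\<in>\<L>. int (n L)) = (\<Sum>L\<in>\<L>. 1 + (if L = M then int (m - g) else 0))"
    by (intro sum.cong) (auto simp: n_def)
  then have sn: "(\<Sum>L\<in>\<L>. int (n L)) = int m"
    using M finite_loops m(1) card_xs by (simp add: sum.distrib g_def of_nat_diff)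
  obtain E where E: "Poly_Mapping.keys E \<subseteq> \<Gamma>" "effective E" "div_degree E = int m"
    "\<And>L. L \<in> \<L> \<Longrightarrow> eqm L (\<Phi> L E) (\<phi> L - (\<psi> L - real c * \<theta> L p))"
    using effective_realize[of n "\<lambda>L. \<phi> L - (\<psi> L - real c * \<theta> L p)"] sn by (auto simp: n_def)
  have "eff_class (d - int m) (\<lambda>L. \<phi> L - \<Phi> L E)" using Rm E(1-3) unfolding rank_ge_def by blast
  then have "eff_class (d - int m) (\<lambda>L. \<psi> L - real c * \<theta> L p)"
  proof (rule eff_class_cong)
    fix L assume L: "L \<in> \<L>"
    have "eqm L (\<phi> L - \<Phi> L E) (\<phi> L - (\<phi> L - (\<psi> L - real c * \<theta> L p)))"
      by (rule eqm_diff[OF eqm_refl E(4)[OF L]])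
    then show "eqm L (\<phi> L - \<Phi> L E) (\<psi> L - real c * \<theta> L p)" by simp
  qed
  moreover have "eff_class (d' + int c) \<psi>" if "eff_class d' (\<lambda>L. \<psi> L - real c * \<theta> L p)" for d'
    using that
  proof (induction c arbitrary: d')
    case (Suc c)
    have "eff_class ((d' + 1) - 1) (\<lambda>L. (\<psi> L - real c * \<theta> L p) - \<theta> L p)"
      using Suc.prems by (simp add: algebra_simps)
    then have "eff_class (d' + 1) (\<lambda>L. \<psi> L - real c * \<theta> L p)" by (rule eff_class_add_point[OF _ p])
    then show ?case using Suc.IH[of "d' + 1"] by (simp add: algebra_simps)
  qed simp
  ultimately have "eff_class (d - int m + int c) \<psi>" by blast
  moreover have "d - int m + int c = int g - 1" using m(3) by (simp add: c_def)
  ultimately show False using \<psi> by simp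
qed

theorem brill_noether_general: "brill_noether_general \<Gamma>"
  unfolding brill_noether_general_def genus_eq card_xs
proof (intro allI conjI impI)
  fix r d :: nat
  define g where "g = length xs"
  define l where "l = int g - int d + int r"
  have g: "0 < g" using loops_ne card_xs finite_loops by (auto simp: g_def card_gt_0_iff)
  have bn: "bn_number (length xs) r d = int g - (int r + 1) * l" by (simp add: bn_number_def g_def l_def)
  have ling: "(int r + 1) * l \<le> int (card {i. i < g \<and> (\<exists>t. lingers (int d) \<phi> i t)})"
    if "rank_ge (int r) (int d) \<phi>" "d \<le> 2 * g - 2" for \<phi>
    using lingering_loops[OF that(1)] that(2) by (simp add: g_def l_def)
  have le_g: "card {i. i < g \<and> P i} \<le> g" for P
    using card_mono[of "{..<g}" "{i. i < g \<and> P i}"] by auto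
  show "W \<Gamma> r d = {}" if neg: "bn_number (length xs) r d < 0"
    unfolding W_empty_iff
  proof (intro allI notI)
    fix \<phi> assume R: "rank_ge (int r) (int d) \<phi>"
    show False
    proof (cases "d \<le> 2 * g - 2")
      case True
      have "card {i. i < g \<and> (\<exists>t. lingers (int d) \<phi> i t)} \<le> g" by (rule le_g)
      then show False using ling[OF R True] neg bn by linarith
    next
      \<comment> \<open>Genericity does not cover this range, but now \<open>g - d + r > 0\<close>
        and \<open>d \<ge> 2 * g - 1\<close> force \<open>r \<ge> g\<close>.\<close>
      case False
      have "0 < l"
      proof (rule ccontr)
        assume "\<not> 0 < l"
        then have "(int r + 1) * l \<le> 0" by (intro mult_nonneg_nonpos) auto
        then show False using neg bn by simp
      qed
      then have "\<not> rank_ge (int r) (int d) \<phi>"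
        using False by (intro not_rank_ge_large_degree) (auto simp: g_def l_def)
      then show False using R by blast
    qed
  qed
  show "polyhedral_dim \<Gamma> (W \<Gamma> r d) = min (bn_number (length xs) r d) (int (length xs))"
    if nonneg: "0 \<le> bn_number (length xs) r d"
  proof (cases "0 < l")
    \<comment> \<open>Here \<open>d - r \<ge> g\<close>, so every class has rank at least
      \<open>r\<close> and the locus is the whole torus.\<close>
    case False
    then have "(int r + 1) * l \<le> 0" by (intro mult_nonneg_nonpos) auto
    then have "min (bn_number (length xs) r d) (int (length xs)) = int g" using bn by (simp add: g_def)
    moreover have "contains_cell \<Gamma> (W \<Gamma> r d) g"
      using contains_cell_large[of d r] False by (simp add: card_xs g_def l_def)
    ultimately show ?thesis
      using polyhedral_dim_eqI[of r d g] contains_cell_le card_xs by (simp add: g_def)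
  next
    case True
    define l' where "l' = nat l"
    have l': "0 < l'" "int l' = l" using True by (auto simp: l'_def)
    define N where "N = (r + 1) * l'"
    have N: "int N = (int r + 1) * l" by (simp add: N_def l'(2) algebra_simps)
    have Ng: "N \<le> g" using nonneg bn N by linarith
    \<comment> \<open>The \<open>r + 1\<close> blocks of length at least one fit into
      \<open>g\<close> loops, so \<open>r < g\<close>; with \<open>d < g + r\<close> this bounds the
      degree by \<open>2 * g - 2\<close>.\<close>
    have "(r + 1) * 1 \<le> (r + 1) * l'" using l'(1) by (intro mult_le_mono2) simp
    then have "r + 1 \<le> N" by (simp only: N_def mult_1_right)
    then have d2: "d \<le> 2 * g - 2" using Ng True by (simp add: l_def)
    have min: "min (bn_number (length xs) r d) (int (length xs)) = int (g - N)"
      using bn N Ng by (simp add: g_def of_nat_diff)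
    have "contains_cell \<Gamma> (W \<Gamma> r d) (g - N)"
    proof -
      \<comment> \<open>The blocks occupy the first \<open>N\<close> loops; the coordinates of the
        remaining ones are free.\<close>
      define T where "T = (!) xs ` {N..<g}"
      define t where "t i = int d - int (i div l') - int (i div l' * l')" for i
      define \<phi> where "\<phi> L = (let i = inv_into {..<g} ((!) xs) L in of_int (t i) * a i + of_int (int d - t i) * b i)" for L
      have \<phi>: "\<phi> (xs ! i) = of_int (t i) * a i + of_int (int d - t i) * b i" if "i < g" for i
        using that bij_xs inv_into_f_f[of "(!) xs" "{..<g}" i] by (simp add: \<phi>_def g_def bij_betw_def)
      have inj: "inj_on ((!) xs) {..<g}" using bij_xs by (simp add: bij_betw_def g_def)
      have cT: "card T = g - N" unfolding T_def using inj by (subst card_image) (auto intro: inj_on_subset)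
      have "rank_ge (int r) (int d) \<psi>" if \<psi>: "\<And>L. L \<in> \<L> - T \<Longrightarrow> \<psi> L = \<phi> L" for \<psi>
      proof (rule rank_ge_blocks[OF l'(1)])
        show "(r + 1) * l' \<le> length xs" using Ng by (simp add: N_def g_def)
        show "int d = int (length xs) - int l' + int r" using l'(2) by (simp add: l_def g_def)
        fix i assume "i < (r + 1) * l'"
        then have i: "i < N" "i < g" using Ng by (auto simp: N_def)
        have "xs ! i \<notin> T"
        proof
          assume "xs ! i \<in> T"
          then obtain j where j: "j \<in> {N..<g}" "xs ! i = xs ! j" unfolding T_def by blast
          then have "i = j" using inj_onD[OF inj j(2)] i by simp
          then show False using i j(1) by simp
        qed
        then have "\<psi> (xs ! i) = of_int (t i) * a i + of_int (int d - t i) * b i"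
          using \<psi>[of "xs ! i"] \<phi>[OF i(2)] nth_xs i(2) by (simp add: g_def)
        then show "lingers (int d) \<psi> i (int d - int (i div l') - int (i div l' * l'))"
          unfolding lingers_def t_def[symmetric] by simp
      qed
      moreover have "T \<subseteq> \<L>" using nth_xs by (auto simp: T_def g_def)
      ultimately have "contains_cell \<Gamma> (W \<Gamma> r d) (card T)"
        using loop_cell[of T \<phi> r d] by blast
      then show ?thesis by (simp add: cT)
    qed
    moreover have "k \<le> g - N" if cell: "contains_cell \<Gamma> (W \<Gamma> r d) k" for k
    proof -
      obtain \<phi> w where w: "indep k w" and R: "\<And>x. (\<forall>i<k. 0 \<le> x i) \<and> (\<Sum>i<k. x i) \<le> 1 \<Longrightarrow>
        rank_ge (int r) (int d) (\<lambda>L. \<phi> L + (\<Sum>i<k. x i * w i L) * len L)"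
        using cell unfolding contains_cell_W_iff by blast
      \<comment> \<open>All coordinates at which some count lingers on \<open>L\<close>: a countable
        set, which suffices for the bound even though the lingering loops vary over the
        cell.\<close>
      define T where "T L = {y. \<exists>t::int. eqm L y (of_int t * a (inv_into {..<g} ((!) xs) L)
          + of_int (int d - t) * b (inv_into {..<g} ((!) xs) L))}" for L
      have idx: "inv_into {..<g} ((!) xs) (xs ! i) = i" if "i < g" for i
        using that bij_xs inv_into_f_f[of "(!) xs" "{..<g}" i] by (simp add: g_def bij_betw_def)
      have "k + N \<le> card \<L>"
      proof (rule indep_coordinate_bound[OF w, of T])
        show "countable (T L)" for L unfolding T_def by (rule countable_lingering)
        fix x :: "nat \<Rightarrow> real" assume x: "(\<forall>i<k. 0 \<le> x i) \<and> (\<Sum>i<k. x i) \<le> 1"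
        define \<psi> where "\<psi> L = \<phi> L + (\<Sum>i<k. x i * w i L) * len L" for L
        have "int N \<le> int (card {i. i < g \<and> (\<exists>t. lingers (int d) \<psi> i t)})"
          using ling[OF _ d2] R[OF x] unfolding \<psi>_def N by blast
        also have "card {i. i < g \<and> (\<exists>t. lingers (int d) \<psi> i t)} = card ((!) xs ` {i. i < g \<and> (\<exists>t. lingers (int d) \<psi> i t)})"
          using bij_xs by (intro card_image[symmetric]) (auto simp: bij_betw_def g_def intro: inj_on_subset)
        also have "\<dots> \<le> card {L \<in> \<L>. \<psi> L \<in> T L}"
          using finite_loops nth_xs idx by (intro card_mono of_nat_mono) (auto simp: T_def lingers_def g_def)
        finally show "N \<le> card {L \<in> \<L>. \<phi> L + (\<Sum>i<k. x i * w i L) * len L \<in> T L}" by (simp add: \<psi>_def)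
      qed
      then show ?thesis by (simp add: card_xs g_def)
    qed
    ultimately show ?thesis unfolding min by (rule polyhedral_dim_eqI)
  qed
qed

end

section \<open>Coordinates and genericity on a path of loops\<close>

context loop_tree
begin

text \<open>Inside the path both sides of a loop are attaching points and genericity is the
  hypothesis on arc lengths; at the two ends the missing side can be chosen at will.\<close>

lemma loop_path_exists:
  assumes path: "path_graph \<L> loops_meet" and gen: "generic_edge_lengths \<Gamma> \<L>"
  shows "\<exists>xs a b. loop_path \<Gamma> \<L> len \<gamma> \<rho> xs a b"
proof -
  obtain xs where xs: "xs \<noteq> []" "distinct xs" "set xs = \<L>"
    and adj: "\<And>i j. i < length xs \<Longrightarrow> j < length xs \<Longrightarrow> loops_meet (xs ! i) (xs ! j) \<longleftrightarrow> i = Suc j \<or> j = Suc i"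
    using path unfolding path_graph_def by blast
  define g where "g = length xs"
  have g: "0 < g" using xs by (simp add: g_def)
  have cg: "card \<L> = g" using distinct_card[OF xs(2)] xs(3) by (simp add: g_def)
  have nth: "xs ! i \<in> \<L>" if "i < g" for i using that xs(3) by (auto simp: g_def)
  have neq: "xs ! i \<noteq> xs ! j" if "i < g" "j < g" "i \<noteq> j" for i j
    using that xs(2) by (auto simp: g_def nth_eq_iff_index_eq)
  have cap: "xs ! i \<inter> xs ! Suc i \<noteq> {}" if "Suc i < g" for i
    using adj[of i "Suc i"] that by (simp add: loops_meet_def g_def)
  have l: "0 < len (xs ! i)" if "i < g" for i using len_pos[OF nth[OF that]] .
  \<comment> \<open>At an end the missing side is placed at the fraction \<open>1 / (2 * g)\<close>
    of a turn from the other one. A multiple of this by at most \<open>2 * g - 2\<close> never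
    completes a turn. For a single loop the value 0 is an arbitrary origin.\<close>
  define b where "b i = (if 0 < i then coord (xs ! i) (xs ! (i - 1))
      else if 1 < g then coord (xs ! 0) (xs ! 1) - len (xs ! 0) / (2 * real g) else 0)" for i
  define a where "a i = (if Suc i < g then coord (xs ! i) (xs ! Suc i) else b i + len (xs ! i) / (2 * real g))" for i
  have left: "coord (xs ! i) (xs ! j) = b i" if ij: "i < g" "j < i" for i j
  proof -
    \<comment> \<open>Consecutive loops meet, so loop \<open>i\<close> sees all loops on its left at
      the same point.\<close>
    have "coord (xs ! i) (xs ! (i - 1 - k)) = coord (xs ! i) (xs ! (i - 1))" if "k < i" for k
      using that
    proof (induction k)
      case (Suc k)
      define m where "m = i - 1 - Suc k"
      have m: "Suc m = i - 1 - k" "Suc m < i" using Suc.prems by (auto simp: m_def)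
      have "coord (xs ! i) (xs ! m) = coord (xs ! i) (xs ! Suc m)"
        using m ij by (intro coord_eq_of_meet nth neq cap) auto
      also have "\<dots> = coord (xs ! i) (xs ! (i - 1))" unfolding m(1) using Suc by simp
      finally show ?case by (simp only: m_def)
    qed simp
    from this[of "i - 1 - j"] show ?thesis using ij by (simp add: b_def)
  qed
  have right: "coord (xs ! i) (xs ! j) = a i" if ij: "j < g" "i < j" for i j
  proof -
    have "coord (xs ! i) (xs ! (Suc i + k)) = coord (xs ! i) (xs ! Suc i)" if "Suc i + k < g" for k
      using that
    proof (induction k)
      case (Suc k)
      have "coord (xs ! i) (xs ! (Suc i + k)) = coord (xs ! i) (xs ! Suc (Suc i + k))"
        using Suc.prems by (intro coord_eq_of_meet nth neq cap) auto
      then show ?case using Suc by simp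
    qed simp
    from this[of "j - Suc i"] show ?thesis using ij by (simp add: a_def)
  qed
  have vertex: "\<exists>v\<in>\<Gamma>. \<forall>j<g. eqm (xs ! j) (\<theta> (xs ! j) v) (if j < i then a j else b j)" if i: "i \<le> g" for i
  proof -
    consider "i = 0" | "i = g" | "0 < i" "i < g" using i by linarith
    then show ?thesis
    proof cases
      case 1
      obtain v where v: "v \<in> xs ! 0" "eqm (xs ! 0) (\<theta> (xs ! 0) v) (b 0)" using obtain_point[OF nth[OF g]] by blast
      have "eqm (xs ! j) (\<theta> (xs ! j) v) (b j)" if "j < g" for j
      proof (cases "j = 0")
        case False
        then show ?thesis using \<theta>_coord[OF nth[OF that] nth[OF g] neq[OF that g False] v(1)] left[OF that] by simp
      qed (use v in simp)
      then show ?thesis using 1 v(1) loop_subset[OF nth[OF g]] by (intro bexI[of _ v]) auto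
    next
      case 2
      have g1: "g - 1 < g" using g by simp
      obtain v where v: "v \<in> xs ! (g - 1)" "eqm (xs ! (g - 1)) (\<theta> (xs ! (g - 1)) v) (a (g - 1))"
        using obtain_point[OF nth[OF g1]] by blast
      have "eqm (xs ! j) (\<theta> (xs ! j) v) (a j)" if "j < g" for j
      proof (cases "j = g - 1")
        case False
        then show ?thesis using \<theta>_coord[OF nth[OF that] nth[OF g1] neq[OF that g1 False] v(1)] right[OF g1, of j] that by simp
      qed (use v in simp)
      then show ?thesis using 2 v(1) loop_subset[OF nth[OF g1]] by (intro bexI[of _ v]) auto
    next
      case 3
      \<comment> \<open>An inner vertex is the common point of two consecutive loops; at the ends it
        is a point with the chosen coordinate.\<close>
      obtain v where v: "v \<in> xs ! (i - 1)" "v \<in> xs ! i" using cap[of "i - 1"] 3 by auto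
      have "\<theta> (xs ! j) v = (if j < i then a j else b j)" if "j < g" for j
      proof (cases "j < i")
        case True
        then show ?thesis using \<theta>_coord[OF nth[OF that] nth[OF 3(2)] neq[OF that 3(2)] v(2)] right[OF 3(2) True] by simp
      next
        case False
        have i1: "i - 1 < g" "j \<noteq> i - 1" "i - 1 < j" using False 3 by auto
        then show ?thesis using \<theta>_coord[OF nth[OF that] nth[OF i1(1)] neq[OF that i1(1,2)] v(1)] left[OF that i1(3)] False by simp
      qed
      then show ?thesis using v(2) loop_subset[OF nth[OF 3(2)]] by (intro bexI[of _ v]) auto
    qed
  qed
  have generic: "\<not> eqm (xs ! i) (real k * (a i - b i)) 0" if i: "i < g" and k: "0 < k" "k \<le> 2 * g - 2" for i k
  proof
    assume "eqm (xs ! i) (real k * (a i - b i)) 0"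
    then obtain z :: int where z: "real k * (a i - b i) = of_int z * len (xs ! i)" by (auto simp: eqm_def)
    show False
    proof (cases "0 < i \<and> Suc i < g")
      case False
      then have "a i - b i = len (xs ! i) / (2 * real g)"
        using i by (cases "i = 0") (auto simp: a_def b_def)
      then have "real k * len (xs ! i) / (2 * real g) = of_int z * len (xs ! i)" using z by simp
      then have "real k * len (xs ! i) = (of_int z * (2 * real g)) * len (xs ! i)" using g by (simp add: divide_simps)
      then have "real k = of_int z * (2 * real g)" using l[OF i] by simp
      then have "real_of_int (int k) = of_int (z * (2 * int g))" by simp
      then have kz: "int k = z * (2 * int g)" by (simp only: of_int_eq_iff)
      have "0 < z"
      proof (rule ccontr)
        assume "\<not> 0 < z"
        then have "z * (2 * int g) \<le> 0" by (intro mult_nonpos_nonneg) auto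
        then show False using kz k(1) by simp
      qed
      then have "2 * int g \<le> int k" unfolding kz using g by simp
      then show False using k g by simp
    next
      case True
      define L where "L = xs ! i"
      have L: "L \<in> \<L>" using nth[OF i] by (simp add: L_def)
      have i1: "i - 1 < g" "Suc i < g" using True by auto
      have ne: "L \<noteq> xs ! (i - 1)" "L \<noteq> xs ! Suc i" "xs ! (i - 1) \<noteq> xs ! Suc i"
        unfolding L_def using True neq[OF i i1(1)] neq[OF i i1(2)] neq[OF i1] by linarith+
      obtain p where p: "p \<in> xs ! (i - 1)" "p \<in> L" using cap[of "i - 1"] True by (auto simp: L_def)
      obtain q where q: "q \<in> xs ! Suc i" "q \<in> L" using cap[of i] True by (auto simp: L_def)
      have tb: "\<theta> L p = b i"
        using \<theta>_coord[OF L nth[OF i1(1)] ne(1) p(1)] left[OF i, of "i - 1"] True by (simp add: L_def)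
      have ta: "\<theta> L q = a i"
        using \<theta>_coord[OF L nth[OF i1(2)] ne(2) q(1)] right[OF i1(2), of i] by (simp add: L_def)
      \<comment> \<open>If both neighbours were attached at the same point, they would meet each
        other.\<close>
      have pq: "p \<noteq> q"
      proof
        assume "p = q"
        then have "loops_meet (xs ! (i - 1)) (xs ! Suc i)"
          using p q ne(3) by (auto simp: loops_meet_def)
        then show False using adj[of "i - 1" "Suc i"] i1 True by (auto simp: g_def)
      qed
      have G: "p \<in> \<Gamma>" "q \<in> \<Gamma>" using p q loop_subset[OF L] by auto
      have \<gamma>p: "\<gamma> L (b i) = p" "\<gamma> L (a i) = q" using \<gamma>_\<theta>[OF L p(2)] \<gamma>_\<theta>[OF L q(2)] ta tb by auto
      have att: "p \<in> attaching_points \<L> L" "q \<in> attaching_points \<L> L"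
        unfolding attaching_points_def
        using p q nth[OF i1(1)] nth[OF i1(2)] ne(1,2) by auto
      have rng: "0 \<le> b i" "b i < len L" "0 \<le> a i" "a i < len L"
        using \<theta>(1,2)[OF L G(1)] \<theta>(1,2)[OF L G(2)] ta tb by auto
      define s t where "s = min (a i) (b i)" and "t = max (a i) (b i)"
      have "a i \<noteq> b i" using \<gamma>p pq by auto
      then have st: "0 \<le> s" "s < t" "t < len L" using rng by (auto simp: s_def t_def)
      have attst: "\<gamma> L s \<in> attaching_points \<L> L" "\<gamma> L t \<in> attaching_points \<L> L"
        using att \<gamma>p by (auto simp: s_def t_def min_def max_def)
      have "t - s = \<bar>a i - b i\<bar>" by (auto simp: s_def t_def)
      then have "real k * (t - s) = \<bar>real k * (a i - b i)\<bar>" by (simp add: abs_mult)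
      then have "real k * (t - s) = \<bar>of_int z * len L\<bar>" unfolding z L_def .
      then have kts: "real k * (t - s) = real (nat \<bar>z\<bar>) * len L" using len_pos[OF L] by (simp add: abs_mult)
      define m where "m = nat \<bar>z\<bar>"
      have ll: "0 < len L" using len_pos[OF L] .
      have "0 < real m * len L" using k(1) st unfolding m_def kts[symmetric] by simp
      then have m0: "0 < m" using ll by (simp add: zero_less_mult_iff)
      have "real m * len L < real k * len L"
      proof -
        have "real k * (t - s) < real k * len L" using k(1) st by (intro mult_strict_left_mono) auto
        then show ?thesis using kts by (simp add: m_def)
      qed
      then have mk: "m < k" using ll by simp
      \<comment> \<open>If \<open>k\<close> times the arc makes \<open>m\<close> full turns, the arc
        and its complement have the ratio \<open>m\<close> to \<open>k - m\<close>, whose terms have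
        sum \<open>k\<close>; this is the excluded kind of ratio.\<close>
      have "(t - s) * real (k - m) = real m * (len L - (t - s))"
      proof -
        have "(t - s) * real (k - m) = real k * (t - s) - real m * (t - s)" using mk by (simp add: of_nat_diff algebra_simps)
        also have "\<dots> = real m * len L - real m * (t - s)" using kts by (simp add: m_def)
        finally show ?thesis by (simp add: algebra_simps)
      qed
      then have "(t - s) / (len L - (t - s)) = real m / real (k - m)"
        using mk st by (simp add: divide_simps)
      moreover have "0 < k - m" "m + (k - m) \<le> 2 * genus \<Gamma> - 2" using mk k by (auto simp: genus_eq cg)
      ultimately show False
        using gen L loop_param[OF L] st attst m0 unfolding generic_edge_lengths_def by blast
    qed
  qed
  have "loop_path \<Gamma> \<L> len \<gamma> \<rho> xs a b"
    using loop_tree_axioms xs(2,3) left right vertex generic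
    unfolding loop_path_def loop_path_axioms_def g_def by blast
  then show ?thesis by blast
qed

end

theorem theoremA:
  fixes \<Gamma> :: "'a::metric_space set" and \<L> :: "'a set set"
  assumes "tree_of_loops \<Gamma> \<L>"
    and "generic_edge_lengths \<Gamma> \<L>"
  shows "brill_noether_general \<Gamma> \<longleftrightarrow> path_of_loops \<Gamma> \<L>"
proof -
  obtain len \<gamma> \<rho> where lt: "loop_tree \<Gamma> \<L> len \<gamma> \<rho>" using tree_of_loops_imp_loop_tree[OF assms(1)] by blast
  interpret loop_tree \<Gamma> \<L> len \<gamma> \<rho> by (rule lt)
  show ?thesis
  proof
    assume "path_of_loops \<Gamma> \<L>"
    then obtain xs a b where "loop_path \<Gamma> \<L> len \<gamma> \<rho> xs a b"
      using loop_path_exists assms(2) unfolding path_of_loops_def by blast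
    then show "brill_noether_general \<Gamma>" by (rule loop_path.brill_noether_general)
  next
    assume BN: "brill_noether_general \<Gamma>"
    have tree: "tree_graph \<L> loops_meet" using assms(1) by (simp add: tree_of_loops_def)
    have "path_graph \<L> loops_meet"
    proof (rule path_graph_of_degree_le_2[OF tree finite_loops])
      show "symp (loops_meet :: 'a set \<Rightarrow> _)" "irreflp (loops_meet :: 'a set \<Rightarrow> _)"
        by (auto simp: symp_def irreflp_def loops_meet_def)
      fix C L M N assume *: "C \<in> \<L>" "{L, M, N} \<subseteq> \<L>" "loops_meet C L" "loops_meet C M" "loops_meet C N"
      show "L = M \<or> L = N \<or> M = N"
      proof (rule ccontr)
        assume "\<not> (L = M \<or> L = N \<or> M = N)"
        then have "card {L, M, N} = 3" by simp
        then have "\<not> brill_noether_general \<Gamma>"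
          using * by (intro not_general_three_neighbours[of C "{L, M, N}"]) (auto simp: loops_meet_def)
        then show False using BN by blast
      qed
    qed
    then show "path_of_loops \<Gamma> \<L>" using assms(1) by (simp add: path_of_loops_def)
  qed
qed

end
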